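(* (1) $\mathsf{StoneFrm_{Sup}}$ is equivalent to $\mathsf{BA_M}$ and dually equivalent to $\mathsf{Stone_R}$. (2) $\mathsf{StoneFrm_{FInf}}$ is equivalent to $\mathsf{BA_L}$ and dually equivalent to $\mathsf{Stone_{PS}}$.
   Context: Frames. $\mathsf K(L)$ is the set of compact elements of a complete lattice $L$. In a frame, $a^*=\bigvee\{x\mid a\wedge x=0\}$ and $a$ is complemented if $a\vee a^*=1$; the frame is zero-dimensional if every element is a join of complemented elements, and compact if its top is compact. A Stone frame is a compact zero-dimensional frame. $\mathsf{StoneFrm_{Sup}}$: Stone frames and maps preserving arbitrary joins and compact elements. $\mathsf{StoneFrm_{FInf}}$: Stone frames and those $\mathsf{StoneFrm_{Sup}}$-morphisms $\alpha\colon L_1\to L_2$ such that whenever $\varnothing\ne S\subseteq\mathsf K(L_1)$ is finite and $\bigwedge S\in\mathsf K(L_1)$, then $\alpha(\bigwedge S)=\bigwedge\alpha[S]$. Algebras. $\mathsf{BA_M}$: boolean algebras and maps preserving all finite meets (including $1$). $\mathsf{BA_L}$: boolean algebras and maps preserving all finite meets (including $1$) and nonempty finite joins (the bottom need not be preserved). Spaces. A Stone space is a zero-dimensional compact Hausdorff space, regarded as a Priestley space whose order is equality; $\mathsf{Clop}(X)$ is its set of clopen subsets. For $R\subseteq X\times Y$ write $R[x]=\{y\mid x\mathrel Ry\}$, $\Box_RU=\{x\mid R[x]\subseteq U\}$. $\mathsf{Stone_R}$: Stone spaces and generalized Priestley morphisms, i.e. relations $R\subseteq X\times Y$ such that (i)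 if $x\not\mathrel Ry$ there is $U\in\mathsf{Clop}(Y)$ with $R[x]\subseteq U$, $y\notin U$; (ii) $U\in\mathsf{Clop}(Y)$ implies $\Box_RU\in\mathsf{Clop}(X)$; identities are equality relations and the composite is $x\mathrel{(S*R)}z$ iff for all $U\in\mathsf{Clop}(Z)$, $x\in\Box_R\Box_SU$ implies $z\in U$. $\mathsf{Stone_{PS}}$: Stone spaces and partial strong Priestley morphisms, i.e. partial functions $f\colon X\dashrightarrow Y$ (functions from a subset of $X$ to $Y$) with clopen domain such that $U\in\mathsf{Clop}(Y)$ implies $X\setminus f^{-1}(Y\setminus U)\in\mathsf{Clop}(X)$, with composition of partial functions. *)

theory Defs
  imports "HOL-Algebra.Complete_Lattice" "HOL-Analysis.Analysis"
begin

section \<open>Categories and their equivalence\<close>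

text \<open>A category is given by hom-sets indexed by pairs of objects. These need not be disjoint,
  so \<open>Ident\<close> and \<open>Cmp\<close> take the objects involved as arguments: \<open>Cmp \<C> A B C g f\<close> is the composite
  of \<open>f : A \<rightarrow> B\<close> followed by \<open>g : B \<rightarrow> C\<close>.\<close>

record ('o, 'm) cat =
  Obj :: "'o set"
  Mor :: "'o \<Rightarrow> 'o \<Rightarrow> 'm set"
  Ident :: "'o \<Rightarrow> 'm"
  Cmp :: "'o \<Rightarrow> 'o \<Rightarrow> 'o \<Rightarrow> 'm \<Rightarrow> 'm \<Rightarrow> 'm"

definition is_category :: "('o, 'm) cat \<Rightarrow> bool" where
  "is_category \<C> \<longleftrightarrow>
    (\<forall>A\<in>Obj \<C>. Ident \<C> A \<in> Mor \<C> A A) \<and>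
    (\<forall>A\<in>Obj \<C>. \<forall>B\<in>Obj \<C>. \<forall>C\<in>Obj \<C>. \<forall>f\<in>Mor \<C> A B. \<forall>g\<in>Mor \<C> B C.
       Cmp \<C> A B C g f \<in> Mor \<C> A C) \<and>
    (\<forall>A\<in>Obj \<C>. \<forall>B\<in>Obj \<C>. \<forall>f\<in>Mor \<C> A B.
       Cmp \<C> A A B f (Ident \<C> A) = f \<and> Cmp \<C> A B B (Ident \<C> B) f = f) \<and>
    (\<forall>A\<in>Obj \<C>. \<forall>B\<in>Obj \<C>. \<forall>C\<in>Obj \<C>. \<forall>D\<in>Obj \<C>.
       \<forall>f\<in>Mor \<C> A B. \<forall>g\<in>Mor \<C> B C. \<forall>h\<in>Mor \<C> C D.
         Cmp \<C> A C D h (Cmp \<C> A B C g f) = Cmp \<C> A B D (Cmp \<C> B C D h g) f)"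

definition op_cat :: "('o, 'm) cat \<Rightarrow> ('o, 'm) cat" where
  "op_cat \<C> = \<lparr>Obj = Obj \<C>, Mor = (\<lambda>A B. Mor \<C> B A), Ident = Ident \<C>,
               Cmp = (\<lambda>A B C g f. Cmp \<C> C B A f g)\<rparr>"

record ('o, 'm, 'p, 'n) functr =
  on_obj :: "'o \<Rightarrow> 'p"
  on_mor :: "'o \<Rightarrow> 'o \<Rightarrow> 'm \<Rightarrow> 'n"

definition is_functor ::
    "('o, 'm) cat \<Rightarrow> ('p, 'n) cat \<Rightarrow> ('o, 'm, 'p, 'n) functr \<Rightarrow> bool" where
  "is_functor \<C> \<D> F \<longleftrightarrow>
    (\<forall>A\<in>Obj \<C>. on_obj F A \<in> Obj \<D>) \<and>
    (\<forall>A\<in>Obj \<C>. \<forall>B\<in>Obj \<C>. \<forall>f\<in>Mor \<C> A B. on_mor F A B f \<in> Mor \<D> (on_obj F A) (on_obj F B)) \<and>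
    (\<forall>A\<in>Obj \<C>. on_mor F A A (Ident \<C> A) = Ident \<D> (on_obj F A)) \<and>
    (\<forall>A\<in>Obj \<C>. \<forall>B\<in>Obj \<C>. \<forall>C\<in>Obj \<C>. \<forall>f\<in>Mor \<C> A B. \<forall>g\<in>Mor \<C> B C.
       on_mor F A C (Cmp \<C> A B C g f) =
         Cmp \<D> (on_obj F A) (on_obj F B) (on_obj F C) (on_mor F B C g) (on_mor F A B f))"

definition id_functor :: "('o, 'm, 'o, 'm) functr" where
  "id_functor = \<lparr>on_obj = (\<lambda>A. A), on_mor = (\<lambda>A B f. f)\<rparr>"

definition comp_functor ::
    "('p, 'n, 'q, 'k) functr \<Rightarrow> ('o, 'm, 'p, 'n) functr \<Rightarrow> ('o, 'm, 'q, 'k) functr" where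
  "comp_functor G F =
    \<lparr>on_obj = (\<lambda>A. on_obj G (on_obj F A)),
     on_mor = (\<lambda>A B f. on_mor G (on_obj F A) (on_obj F B) (on_mor F A B f))\<rparr>"

definition is_iso :: "('o, 'm) cat \<Rightarrow> 'o \<Rightarrow> 'o \<Rightarrow> 'm \<Rightarrow> bool" where
  "is_iso \<C> A B f \<longleftrightarrow> f \<in> Mor \<C> A B \<and>
    (\<exists>g\<in>Mor \<C> B A. Cmp \<C> A B A g f = Ident \<C> A \<and> Cmp \<C> B A B f g = Ident \<C> B)"

definition is_natural_iso ::
    "('o, 'm) cat \<Rightarrow> ('p, 'n) cat \<Rightarrow> ('o, 'm, 'p, 'n) functr \<Rightarrow> ('o, 'm, 'p, 'n) functr \<Rightarrow>
     ('o \<Rightarrow> 'n) \<Rightarrow> bool" where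
  "is_natural_iso \<C> \<D> F G \<eta> \<longleftrightarrow>
    (\<forall>A\<in>Obj \<C>. is_iso \<D> (on_obj F A) (on_obj G A) (\<eta> A)) \<and>
    (\<forall>A\<in>Obj \<C>. \<forall>B\<in>Obj \<C>. \<forall>f\<in>Mor \<C> A B.
       Cmp \<D> (on_obj F A) (on_obj F B) (on_obj G B) (\<eta> B) (on_mor F A B f) =
       Cmp \<D> (on_obj F A) (on_obj G A) (on_obj G B) (on_mor G A B f) (\<eta> A))"

definition equivalent_cats :: "('o, 'm) cat \<Rightarrow> ('p, 'n) cat \<Rightarrow> bool" where
  "equivalent_cats \<C> \<D> \<longleftrightarrow> is_category \<C> \<and> is_category \<D> \<and>
    (\<exists>F G \<eta> \<epsilon>. is_functor \<C> \<D> F \<and> is_functor \<D> \<C> G \<and>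
       is_natural_iso \<C> \<C> id_functor (comp_functor G F) \<eta> \<and>
       is_natural_iso \<D> \<D> (comp_functor F G) id_functor \<epsilon>)"

definition dually_equivalent_cats :: "('o, 'm) cat \<Rightarrow> ('p, 'n) cat \<Rightarrow> bool" where
  "dually_equivalent_cats \<C> \<D> \<longleftrightarrow> equivalent_cats (op_cat \<C>) \<D>"

section \<open>Size\<close>

text \<open>There is no type of all Stone frames, say, so every category below depends on a set
  \<open>\<U> :: 'a set set\<close> whose members are the permitted sizes. The size of a boolean algebra is that of
  its carrier, a subset of \<open>'a\<close>. Stone frames and Stone spaces can be exponentially larger; their
  carriers are subsets of \<open>'a set\<close>, and their size is that of \<open>K(L)\<close>, respectively \<open>Clop(X)\<close>.
  For \<open>\<U> = UNIV\<close> this only says that these embed into \<open>'a\<close>, so every Stone frame and every Stone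
  space on any type has an isomorphic copy here for a suitable \<open>'a\<close>. If \<open>'a\<close> is a
  universe and \<open>\<U>\<close> consists of its small subsets, one gets the usual categories of all small
  objects, because \<open>L\<close> is small iff \<open>K(L)\<close> is, and \<open>X\<close> is small iff \<open>Clop(X)\<close> is.\<close>

definition of_size :: "'a set set \<Rightarrow> 'b set \<Rightarrow> bool" where
  "of_size \<U> S \<longleftrightarrow> (\<exists>A\<in>\<U>. S \<approx> A)"

section \<open>Stone frames\<close>

definition frame :: "('a, 'e) gorder_scheme \<Rightarrow> bool" where
  "frame L \<longleftrightarrow> complete_lattice L \<and>
    (\<forall>a\<in>carrier L. \<forall>S\<subseteq>carrier L. a \<sqinter>\<^bsub>L\<^esub> \<Squnion>\<^bsub>L\<^esub>S = \<Squnion>\<^bsub>L\<^esub>((\<lambda>s. a \<sqinter>\<^bsub>L\<^esub> s) ` S))"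

definition compact_elems :: "('a, 'e) gorder_scheme \<Rightarrow> 'a set" where
  "compact_elems L = {k \<in> carrier L. \<forall>S\<subseteq>carrier L. k \<sqsubseteq>\<^bsub>L\<^esub> \<Squnion>\<^bsub>L\<^esub>S \<longrightarrow>
     (\<exists>T\<subseteq>S. finite T \<and> k \<sqsubseteq>\<^bsub>L\<^esub> \<Squnion>\<^bsub>L\<^esub>T)}"

definition pseudocomplement :: "('a, 'e) gorder_scheme \<Rightarrow> 'a \<Rightarrow> 'a" where
  "pseudocomplement L a = \<Squnion>\<^bsub>L\<^esub>{x \<in> carrier L. a \<sqinter>\<^bsub>L\<^esub> x = \<bottom>\<^bsub>L\<^esub>}"

definition complemented_elems :: "('a, 'e) gorder_scheme \<Rightarrow> 'a set" where
  "complemented_elems L = {a \<in> carrier L. a \<squnion>\<^bsub>L\<^esub> pseudocomplement L a = \<top>\<^bsub>L\<^esub>}"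

definition zero_dim_frame :: "('a, 'e) gorder_scheme \<Rightarrow> bool" where
  "zero_dim_frame L \<longleftrightarrow> frame L \<and>
    (\<forall>a\<in>carrier L. \<exists>S\<subseteq>complemented_elems L. a = \<Squnion>\<^bsub>L\<^esub>S)"

definition compact_frame :: "('a, 'e) gorder_scheme \<Rightarrow> bool" where
  "compact_frame L \<longleftrightarrow> frame L \<and> \<top>\<^bsub>L\<^esub> \<in> compact_elems L"

definition stone_frame :: "('a, 'e) gorder_scheme \<Rightarrow> bool" where
  "stone_frame L \<longleftrightarrow> compact_frame L \<and> zero_dim_frame L"

definition sup_morphisms :: "'a gorder \<Rightarrow> 'b gorder \<Rightarrow> ('a \<Rightarrow> 'b) set" where
  "sup_morphisms L M = {\<alpha> \<in> carrier L \<rightarrow>\<^sub>E carrier M.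
     (\<forall>S\<subseteq>carrier L. \<alpha> (\<Squnion>\<^bsub>L\<^esub>S) = \<Squnion>\<^bsub>M\<^esub>(\<alpha> ` S)) \<and>
     \<alpha> ` compact_elems L \<subseteq> compact_elems M}"

definition finf_morphisms :: "'a gorder \<Rightarrow> 'b gorder \<Rightarrow> ('a \<Rightarrow> 'b) set" where
  "finf_morphisms L M = {\<alpha> \<in> sup_morphisms L M.
     \<forall>S. S \<noteq> {} \<and> finite S \<and> S \<subseteq> compact_elems L \<and> \<Sqinter>\<^bsub>L\<^esub>S \<in> compact_elems L \<longrightarrow>
       \<alpha> (\<Sqinter>\<^bsub>L\<^esub>S) = \<Sqinter>\<^bsub>M\<^esub>(\<alpha> ` S)}"

definition StoneFrm_Sup :: "'a set set \<Rightarrow> ('a set gorder, 'a set \<Rightarrow> 'a set) cat" where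
  "StoneFrm_Sup \<U> = \<lparr>Obj = {L. stone_frame L \<and> of_size \<U> (compact_elems L)},
     Mor = sup_morphisms, Ident = (\<lambda>L. \<lambda>x\<in>carrier L. x),
     Cmp = (\<lambda>L M N \<beta> \<alpha>. compose (carrier L) \<beta> \<alpha>)\<rparr>"

definition StoneFrm_FInf :: "'a set set \<Rightarrow> ('a set gorder, 'a set \<Rightarrow> 'a set) cat" where
  "StoneFrm_FInf \<U> = \<lparr>Obj = {L. stone_frame L \<and> of_size \<U> (compact_elems L)},
     Mor = finf_morphisms, Ident = (\<lambda>L. \<lambda>x\<in>carrier L. x),
     Cmp = (\<lambda>L M N \<beta> \<alpha>. compose (carrier L) \<beta> \<alpha>)\<rparr>"

section \<open>Boolean algebras\<close>

definition bool_algebra :: "('a, 'e) gorder_scheme \<Rightarrow> bool" where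
  "bool_algebra B \<longleftrightarrow> bounded_lattice B \<and>
    (\<forall>x\<in>carrier B. \<forall>y\<in>carrier B. \<forall>z\<in>carrier B.
       x \<sqinter>\<^bsub>B\<^esub> (y \<squnion>\<^bsub>B\<^esub> z) = (x \<sqinter>\<^bsub>B\<^esub> y) \<squnion>\<^bsub>B\<^esub> (x \<sqinter>\<^bsub>B\<^esub> z)) \<and>
    (\<forall>x\<in>carrier B. \<exists>y\<in>carrier B. x \<sqinter>\<^bsub>B\<^esub> y = \<bottom>\<^bsub>B\<^esub> \<and> x \<squnion>\<^bsub>B\<^esub> y = \<top>\<^bsub>B\<^esub>)"

text \<open>The case \<open>S = {}\<close> below is preservation of the top, as \<open>\<Sqinter>\<^bsub>B\<^esub>{} = \<top>\<^bsub>B\<^esub>\<close>.\<close>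

definition meet_morphisms :: "'a gorder \<Rightarrow> 'b gorder \<Rightarrow> ('a \<Rightarrow> 'b) set" where
  "meet_morphisms B C = {h \<in> carrier B \<rightarrow>\<^sub>E carrier C.
     \<forall>S\<subseteq>carrier B. finite S \<longrightarrow> h (\<Sqinter>\<^bsub>B\<^esub>S) = \<Sqinter>\<^bsub>C\<^esub>(h ` S)}"

definition lattice_morphisms :: "'a gorder \<Rightarrow> 'b gorder \<Rightarrow> ('a \<Rightarrow> 'b) set" where
  "lattice_morphisms B C = {h \<in> meet_morphisms B C.
     \<forall>S\<subseteq>carrier B. finite S \<and> S \<noteq> {} \<longrightarrow> h (\<Squnion>\<^bsub>B\<^esub>S) = \<Squnion>\<^bsub>C\<^esub>(h ` S)}"

definition BA_M :: "'a set set \<Rightarrow> ('a gorder, 'a \<Rightarrow> 'a) cat" where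
  "BA_M \<U> = \<lparr>Obj = {B. bool_algebra B \<and> of_size \<U> (carrier B)},
     Mor = meet_morphisms, Ident = (\<lambda>B. \<lambda>x\<in>carrier B. x),
     Cmp = (\<lambda>B C D g f. compose (carrier B) g f)\<rparr>"

definition BA_L :: "'a set set \<Rightarrow> ('a gorder, 'a \<Rightarrow> 'a) cat" where
  "BA_L \<U> = \<lparr>Obj = {B. bool_algebra B \<and> of_size \<U> (carrier B)},
     Mor = lattice_morphisms, Ident = (\<lambda>B. \<lambda>x\<in>carrier B. x),
     Cmp = (\<lambda>B C D g f. compose (carrier B) g f)\<rparr>"

section \<open>Stone spaces\<close>

definition Clop :: "'p topology \<Rightarrow> 'p set set" where
  "Clop X = {U. openin X U \<and> closedin X U}"

definition zero_dim_space :: "'p topology \<Rightarrow> bool" where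
  "zero_dim_space X \<longleftrightarrow> (\<forall>U x. openin X U \<and> x \<in> U \<longrightarrow> (\<exists>V\<in>Clop X. x \<in> V \<and> V \<subseteq> U))"

definition stone_space :: "'p topology \<Rightarrow> bool" where
  "stone_space X \<longleftrightarrow> zero_dim_space X \<and> compact_space X \<and> Hausdorff_space X"

definition rel_box :: "'p topology \<Rightarrow> ('p \<times> 'q) set \<Rightarrow> 'q set \<Rightarrow> 'p set" where
  "rel_box X R U = {x \<in> topspace X. R `` {x} \<subseteq> U}"

definition gen_priestley_morphisms :: "'p topology \<Rightarrow> 'q topology \<Rightarrow> ('p \<times> 'q) set set" where
  "gen_priestley_morphisms X Y = {R. R \<subseteq> topspace X \<times> topspace Y \<and>
     (\<forall>x\<in>topspace X. \<forall>y\<in>topspace Y. (x, y) \<notin> R \<longrightarrow> (\<exists>U\<in>Clop Y. R `` {x} \<subseteq> U \<and> y \<notin> U)) \<and>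
     (\<forall>U\<in>Clop Y. rel_box X R U \<in> Clop X)}"

definition gen_priestley_comp ::
    "'p topology \<Rightarrow> 'q topology \<Rightarrow> 'r topology \<Rightarrow> ('q \<times> 'r) set \<Rightarrow> ('p \<times> 'q) set \<Rightarrow> ('p \<times> 'r) set" where
  "gen_priestley_comp X Y Z S R = {(x, z). x \<in> topspace X \<and> z \<in> topspace Z \<and>
     (\<forall>U\<in>Clop Z. x \<in> rel_box X R (rel_box Y S U) \<longrightarrow> z \<in> U)}"

definition Stone_R :: "'a set set \<Rightarrow> ('a set topology, ('a set \<times> 'a set) set) cat" where
  "Stone_R \<U> = \<lparr>Obj = {X. stone_space X \<and> of_size \<U> (Clop X)},
     Mor = gen_priestley_morphisms, Ident = (\<lambda>X. Id_on (topspace X)),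
     Cmp = gen_priestley_comp\<rparr>"

text \<open>For a partial function \<open>f\<close> and \<open>W \<subseteq> topspace Y\<close>, the preimage of \<open>W\<close> is \<open>f -` Some ` W\<close>.\<close>

definition partial_strong_priestley_morphisms ::
    "'p topology \<Rightarrow> 'q topology \<Rightarrow> ('p \<rightharpoonup> 'q) set" where
  "partial_strong_priestley_morphisms X Y = {f. dom f \<subseteq> topspace X \<and> ran f \<subseteq> topspace Y \<and>
     dom f \<in> Clop X \<and>
     (\<forall>U\<in>Clop Y. topspace X - f -` (Some ` (topspace Y - U)) \<in> Clop X)}"

definition Stone_PS :: "'a set set \<Rightarrow> ('a set topology, 'a set \<rightharpoonup> 'a set) cat" where
  "Stone_PS \<U> = \<lparr>Obj = {X. stone_space X \<and> of_size \<U> (Clop X)},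
     Mor = partial_strong_priestley_morphisms,
     Ident = (\<lambda>X. Some |` topspace X),
     Cmp = (\<lambda>X Y Z g f. g \<circ>\<^sub>m f)\<rparr>"

end

theory Submission
  imports Defs
begin

text \<open>All categories in question are compared with categories of boolean algebras.

  In a Stone frame \<open>L\<close> the compact elements are the complemented ones
  (\<open>compact_eq_complemented\<close>). Hence they form a boolean algebra \<open>K(L)\<close>, and every element of \<open>L\<close> is
  the join of the compact elements below it. A map that preserves joins and compact elements is
  therefore determined by its restriction to \<open>K(L)\<close>, and every map between these algebras that
  preserves finite joins extends (\<open>extend_to_frame_morphism\<close>). Reversing the order of \<open>K(L)\<close> turns
  preservation of finite joins into preservation of finite meets, and the extra condition on finite
  meets of compact elements into preservation of nonempty finite joins.

  For a Stone space \<open>X\<close> the boolean algebra is \<open>Clop(X)\<close>, and a relation \<open>R\<close> acts on it by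
  \<open>\<box>\<^sub>R\<close>. Condition (i) on morphisms says that \<open>R[x]\<close> is the intersection of the clopen sets \<open>U\<close> with
  \<open>x \<in> \<box>\<^sub>R U\<close>, so \<open>\<box>\<^sub>R\<close> determines \<open>R\<close>; compactness shows that every meet-preserving map is of this form
  (\<open>rel_box_box_relation\<close>). It preserves binary joins exactly if every \<open>R[x]\<close> has at most one
  element, that is, if \<open>R\<close> is the graph of a partial function.

  So there are fully faithful functors into boolean algebras, covariant for frames and contravariant
  for spaces. They are essentially surjective because a boolean algebra is isomorphic to the reversed
  \<open>K\<close> of its frame of filters (\<open>order_iso_principal_filter\<close>) and to the clopen algebra of its space of
  prime filters (\<open>order_iso_prime_filters_with\<close>). What remains is formal: two categories with fully
  faithful and essentially surjective functors to a common category are equivalent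
  (\<open>equivalent_cats_if_weakly_equivalent_to_common\<close>).\<close>

section \<open>Equivalences from fully faithful functors with a common target\<close>

lemma is_categoryD:
  assumes "is_category \<C>"
  shows cat_id: "\<And>A. A \<in> Obj \<C> \<Longrightarrow> Ident \<C> A \<in> Mor \<C> A A"
    and cat_comp: "\<And>A B C f g. \<lbrakk>A \<in> Obj \<C>; B \<in> Obj \<C>; C \<in> Obj \<C>; f \<in> Mor \<C> A B; g \<in> Mor \<C> B C\<rbrakk> \<Longrightarrow>
      Cmp \<C> A B C g f \<in> Mor \<C> A C"
    and cat_id_right: "\<And>A B f. \<lbrakk>A \<in> Obj \<C>; B \<in> Obj \<C>; f \<in> Mor \<C> A B\<rbrakk> \<Longrightarrow> Cmp \<C> A A B f (Ident \<C> A) = f"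
    and cat_id_left: "\<And>A B f. \<lbrakk>A \<in> Obj \<C>; B \<in> Obj \<C>; f \<in> Mor \<C> A B\<rbrakk> \<Longrightarrow> Cmp \<C> A B B (Ident \<C> B) f = f"
    and cat_assoc: "\<And>A B C D f g h. \<lbrakk>A \<in> Obj \<C>; B \<in> Obj \<C>; C \<in> Obj \<C>; D \<in> Obj \<C>;
      f \<in> Mor \<C> A B; g \<in> Mor \<C> B C; h \<in> Mor \<C> C D\<rbrakk> \<Longrightarrow>
      Cmp \<C> A C D h (Cmp \<C> A B C g f) = Cmp \<C> A B D (Cmp \<C> B C D h g) f"
  using assms unfolding is_category_def by blast+

lemma is_functorD:
  assumes "is_functor \<C> \<D> F"
  shows functor_obj: "\<And>A. A \<in> Obj \<C> \<Longrightarrow> on_obj F A \<in> Obj \<D>"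
    and functor_mor: "\<And>A B f. \<lbrakk>A \<in> Obj \<C>; B \<in> Obj \<C>; f \<in> Mor \<C> A B\<rbrakk> \<Longrightarrow>
      on_mor F A B f \<in> Mor \<D> (on_obj F A) (on_obj F B)"
    and functor_id: "\<And>A. A \<in> Obj \<C> \<Longrightarrow> on_mor F A A (Ident \<C> A) = Ident \<D> (on_obj F A)"
    and functor_comp: "\<And>A B C f g. \<lbrakk>A \<in> Obj \<C>; B \<in> Obj \<C>; C \<in> Obj \<C>; f \<in> Mor \<C> A B; g \<in> Mor \<C> B C\<rbrakk> \<Longrightarrow>
      on_mor F A C (Cmp \<C> A B C g f) =
        Cmp \<D> (on_obj F A) (on_obj F B) (on_obj F C) (on_mor F B C g) (on_mor F A B f)"
  using assms unfolding is_functor_def by blast+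

lemma is_isoE:
  assumes "is_iso \<C> A B f"
  obtains g where "f \<in> Mor \<C> A B" "g \<in> Mor \<C> B A"
    "Cmp \<C> A B A g f = Ident \<C> A" "Cmp \<C> B A B f g = Ident \<C> B"
  using assms unfolding is_iso_def by blast

lemma is_isoI:
  assumes "f \<in> Mor \<C> A B" "g \<in> Mor \<C> B A"
    "Cmp \<C> A B A g f = Ident \<C> A" "Cmp \<C> B A B f g = Ident \<C> B"
  shows "is_iso \<C> A B f"
  using assms unfolding is_iso_def by blast

lemma is_iso_mor: "is_iso \<C> A B f \<Longrightarrow> f \<in> Mor \<C> A B"
  unfolding is_iso_def by blast

lemma cancel_inverse_left:
  assumes \<C>: "is_category \<C>" and o: "A \<in> Obj \<C>" "B \<in> Obj \<C>" "D \<in> Obj \<C>"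
    and m: "f \<in> Mor \<C> A B" "u \<in> Mor \<C> B D" "v \<in> Mor \<C> D B" and inv: "Cmp \<C> B D B v u = Ident \<C> B"
  shows "Cmp \<C> A D B v (Cmp \<C> A B D u f) = f"
  using assms cat_assoc[OF \<C>] cat_id_left[OF \<C>] by simp

lemma cancel_inverse_right:
  assumes \<C>: "is_category \<C>" and o: "A \<in> Obj \<C>" "B \<in> Obj \<C>" "D \<in> Obj \<C>"
    and m: "f \<in> Mor \<C> A B" "u \<in> Mor \<C> A D" "v \<in> Mor \<C> D A" and inv: "Cmp \<C> A D A v u = Ident \<C> A"
  shows "Cmp \<C> A D B (Cmp \<C> D A B f v) u = f"
  using assms cat_assoc[OF \<C>, symmetric] cat_id_right[OF \<C>] by simp

lemma is_iso_comp:
  assumes \<C>: "is_category \<C>" and o: "A \<in> Obj \<C>" "B \<in> Obj \<C>" "D \<in> Obj \<C>"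
    and f: "is_iso \<C> A B f" and g: "is_iso \<C> B D g"
  shows "is_iso \<C> A D (Cmp \<C> A B D g f)"
proof -
  obtain f' where f': "f \<in> Mor \<C> A B" "f' \<in> Mor \<C> B A"
    "Cmp \<C> A B A f' f = Ident \<C> A" "Cmp \<C> B A B f f' = Ident \<C> B" using f by (rule is_isoE)
  obtain g' where g': "g \<in> Mor \<C> B D" "g' \<in> Mor \<C> D B"
    "Cmp \<C> B D B g' g = Ident \<C> B" "Cmp \<C> D B D g g' = Ident \<C> D" using g by (rule is_isoE)
  note c = cat_comp[OF \<C>]
  show ?thesis
  proof (rule is_isoI)
    show "Cmp \<C> A B D g f \<in> Mor \<C> A D" "Cmp \<C> D B A f' g' \<in> Mor \<C> D A"
      using o f' g' c by auto
    have "Cmp \<C> A D A (Cmp \<C> D B A f' g') (Cmp \<C> A B D g f) =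
        Cmp \<C> A B A f' (Cmp \<C> A D B g' (Cmp \<C> A B D g f))"
      using cat_assoc[OF \<C>] o f' g' c by metis
    then show "Cmp \<C> A D A (Cmp \<C> D B A f' g') (Cmp \<C> A B D g f) = Ident \<C> A"
      using cancel_inverse_left[OF \<C>] o f' g' by simp
    have "Cmp \<C> D A D (Cmp \<C> A B D g f) (Cmp \<C> D B A f' g') =
        Cmp \<C> D B D g (Cmp \<C> D A B f (Cmp \<C> D B A f' g'))"
      using cat_assoc[OF \<C>] o f' g' c by metis
    then show "Cmp \<C> D A D (Cmp \<C> A B D g f) (Cmp \<C> D B A f' g') = Ident \<C> D"
      using cancel_inverse_left[OF \<C>] o f' g' by simp
  qed
qed

definition fully_faithful ::
    "('o, 'm) cat \<Rightarrow> ('p, 'n) cat \<Rightarrow> ('o, 'm, 'p, 'n) functr \<Rightarrow> bool" where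
  "fully_faithful \<C> \<D> F \<longleftrightarrow> is_category \<C> \<and> is_category \<D> \<and> is_functor \<C> \<D> F \<and>
    (\<forall>A\<in>Obj \<C>. \<forall>B\<in>Obj \<C>. bij_betw (on_mor F A B) (Mor \<C> A B) (Mor \<D> (on_obj F A) (on_obj F B)))"

text \<open>Essential surjectivity is stated with both directions of the isomorphism, so that it passes to
  the opposite categories as it stands.\<close>

definition weak_equivalence ::
    "('o, 'm) cat \<Rightarrow> ('p, 'n) cat \<Rightarrow> ('o, 'm, 'p, 'n) functr \<Rightarrow> bool" where
  "weak_equivalence \<C> \<D> F \<longleftrightarrow> fully_faithful \<C> \<D> F \<and>
    (\<forall>X\<in>Obj \<D>. \<exists>A\<in>Obj \<C>. \<exists>u\<in>Mor \<D> (on_obj F A) X. \<exists>v\<in>Mor \<D> X (on_obj F A).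
      Cmp \<D> (on_obj F A) X (on_obj F A) v u = Ident \<D> (on_obj F A) \<and>
      Cmp \<D> X (on_obj F A) X u v = Ident \<D> X)"

lemma fully_faithfulD:
  assumes "fully_faithful \<C> \<D> F"
  shows "is_category \<C>" "is_category \<D>" "is_functor \<C> \<D> F"
    and full: "\<And>A B g. \<lbrakk>A \<in> Obj \<C>; B \<in> Obj \<C>; g \<in> Mor \<D> (on_obj F A) (on_obj F B)\<rbrakk> \<Longrightarrow>
      \<exists>f\<in>Mor \<C> A B. on_mor F A B f = g"
    and faithful: "\<And>A B f f'. \<lbrakk>A \<in> Obj \<C>; B \<in> Obj \<C>; f \<in> Mor \<C> A B; f' \<in> Mor \<C> A B;
      on_mor F A B f = on_mor F A B f'\<rbrakk> \<Longrightarrow> f = f'"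
proof -
  fix A B assume "A \<in> Obj \<C>" "B \<in> Obj \<C>"
  then have b: "bij_betw (on_mor F A B) (Mor \<C> A B) (Mor \<D> (on_obj F A) (on_obj F B))"
    using assms unfolding fully_faithful_def by blast
  show "\<exists>f\<in>Mor \<C> A B. on_mor F A B f = g" if "g \<in> Mor \<D> (on_obj F A) (on_obj F B)" for g
    using b that unfolding bij_betw_def by (metis imageE)
  show "f = f'" if "f \<in> Mor \<C> A B" "f' \<in> Mor \<C> A B" "on_mor F A B f = on_mor F A B f'" for f f'
    using b that unfolding bij_betw_def inj_on_def by blast
qed (use assms fully_faithful_def in blast)+

text \<open>A composition structure that embeds into a category is a category: the identity and
  associativity laws can be checked after applying the functor.\<close>

lemma fully_faithfulI:
  assumes E: "is_category \<E>"
    and obj: "\<And>A. A \<in> Obj \<C> \<Longrightarrow> on_obj F A \<in> Obj \<E>"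
    and id: "\<And>A. A \<in> Obj \<C> \<Longrightarrow> Ident \<C> A \<in> Mor \<C> A A \<and> on_mor F A A (Ident \<C> A) = Ident \<E> (on_obj F A)"
    and comp: "\<And>A B C f g. \<lbrakk>A \<in> Obj \<C>; B \<in> Obj \<C>; C \<in> Obj \<C>; f \<in> Mor \<C> A B; g \<in> Mor \<C> B C\<rbrakk> \<Longrightarrow>
      Cmp \<C> A B C g f \<in> Mor \<C> A C \<and> on_mor F A C (Cmp \<C> A B C g f) =
        Cmp \<E> (on_obj F A) (on_obj F B) (on_obj F C) (on_mor F B C g) (on_mor F A B f)"
    and bij: "\<And>A B. \<lbrakk>A \<in> Obj \<C>; B \<in> Obj \<C>\<rbrakk> \<Longrightarrow>
      bij_betw (on_mor F A B) (Mor \<C> A B) (Mor \<E> (on_obj F A) (on_obj F B))"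
  shows "fully_faithful \<C> \<E> F"
proof -
  have mor: "on_mor F A B f \<in> Mor \<E> (on_obj F A) (on_obj F B)"
    if "A \<in> Obj \<C>" "B \<in> Obj \<C>" "f \<in> Mor \<C> A B" for A B f
    using bij[OF that(1,2)] that(3) bij_betwE by blast
  have eqI: "f = g" if "A \<in> Obj \<C>" "B \<in> Obj \<C>" "f \<in> Mor \<C> A B" "g \<in> Mor \<C> A B"
    "on_mor F A B f = on_mor F A B g" for A B f g
    using bij[OF that(1,2)] that(3-) unfolding bij_betw_def inj_on_def by blast
  have is_fun: "is_functor \<C> \<E> F"
    unfolding is_functor_def using obj mor id comp by simp
  have "is_category \<C>"
    unfolding is_category_def
  proof (intro conjI ballI)
    fix A B f assume AB: "A \<in> Obj \<C>" "B \<in> Obj \<C>" and f: "f \<in> Mor \<C> A B"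
    show "Cmp \<C> A A B f (Ident \<C> A) = f"
      by (rule eqI[OF AB]) (use AB f id comp obj mor cat_id_right[OF E] in auto)
    show "Cmp \<C> A B B (Ident \<C> B) f = f"
      by (rule eqI[OF AB]) (use AB f id comp obj mor cat_id_left[OF E] in auto)
    fix C D g h assume CD: "C \<in> Obj \<C>" "D \<in> Obj \<C>" and gh: "g \<in> Mor \<C> B C" "h \<in> Mor \<C> C D"
    show "Cmp \<C> A C D h (Cmp \<C> A B C g f) = Cmp \<C> A B D (Cmp \<C> B C D h g) f"
    proof (rule eqI[OF AB(1) CD(2)])
      show "on_mor F A D (Cmp \<C> A C D h (Cmp \<C> A B C g f)) = on_mor F A D (Cmp \<C> A B D (Cmp \<C> B C D h g) f)"
        using AB CD f gh comp obj mor cat_assoc[OF E] by simp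
    qed (use AB CD f gh comp in auto)
  qed (use id comp in auto)
  then show ?thesis
    unfolding fully_faithful_def using E is_fun bij by blast
qed

lemma is_category_op: "is_category \<C> \<Longrightarrow> is_category (op_cat \<C>)"
  unfolding is_category_def op_cat_def by simp

lemma op_op_cat: "op_cat (op_cat \<C>) = \<C>"
  unfolding op_cat_def by simp

lemma weak_equivalence_op:
  assumes "weak_equivalence \<C> \<D> F"
  shows "weak_equivalence (op_cat \<C>) (op_cat \<D>) \<lparr>on_obj = on_obj F, on_mor = (\<lambda>A B. on_mor F B A)\<rparr>"
proof -
  have "is_category (op_cat \<C>)" "is_category (op_cat \<D>)"
    using assms is_category_op unfolding weak_equivalence_def fully_faithful_def by auto
  moreover have "is_functor (op_cat \<C>) (op_cat \<D>) \<lparr>on_obj = on_obj F, on_mor = (\<lambda>A B. on_mor F B A)\<rparr>"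
    using assms unfolding weak_equivalence_def fully_faithful_def is_functor_def op_cat_def by simp
  moreover have "\<exists>A\<in>Obj \<C>. \<exists>u\<in>Mor \<D> X (on_obj F A). \<exists>v\<in>Mor \<D> (on_obj F A) X.
      Cmp \<D> (on_obj F A) X (on_obj F A) u v = Ident \<D> (on_obj F A) \<and>
      Cmp \<D> X (on_obj F A) X v u = Ident \<D> X" if "X \<in> Obj \<D>" for X
    using assms that unfolding weak_equivalence_def by blast
  ultimately show ?thesis
    using assms unfolding weak_equivalence_def fully_faithful_def by (simp add: op_cat_def)
qed

lemma weak_equivalence_id:
  assumes "is_category \<C>"
  shows "weak_equivalence \<C> \<C> id_functor"
proof -
  have "\<exists>A\<in>Obj \<C>. \<exists>u\<in>Mor \<C> A X. \<exists>v\<in>Mor \<C> X A.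
      Cmp \<C> A X A v u = Ident \<C> A \<and> Cmp \<C> X A X u v = Ident \<C> X" if "X \<in> Obj \<C>" for X
    using that cat_id[OF assms that] cat_id_left[OF assms that that] by blast
  then show ?thesis
    using assms unfolding weak_equivalence_def fully_faithful_def is_functor_def id_functor_def
    by (simp add: bij_betw_def)
qed

lemma fully_faithful_comp:
  assumes F: "fully_faithful \<C> \<D> F" and G: "fully_faithful \<D> \<E> G"
  shows "fully_faithful \<C> \<E> (comp_functor G F)"
proof -
  note FD = fully_faithfulD[OF F] and GD = fully_faithfulD[OF G]
  note FF = is_functorD[OF FD(3)] and GF = is_functorD[OF GD(3)]
  have "is_functor \<C> \<E> (comp_functor G F)"
    using FF GF unfolding is_functor_def comp_functor_def by simp
  moreover have "bij_betw (\<lambda>f. on_mor G (on_obj F A) (on_obj F B) (on_mor F A B f))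
      (Mor \<C> A B) (Mor \<E> (on_obj G (on_obj F A)) (on_obj G (on_obj F B)))"
    if "A \<in> Obj \<C>" "B \<in> Obj \<C>" for A B
    using F G that FF(1) bij_betw_trans unfolding fully_faithful_def comp_def[symmetric] by blast
  ultimately show ?thesis
    using FD GD unfolding fully_faithful_def comp_functor_def by simp
qed

text \<open>Because \<open>H\<close> is essentially surjective, an object \<open>P A\<close> with \<open>F A \<cong> H (P A)\<close> can be chosen;
  because \<open>H\<close> is fully faithful, conjugating \<open>F f\<close> with these isomorphisms gives a morphism that
  comes from a unique one between the chosen objects. So \<open>F\<close> factors through \<open>H\<close> up to isomorphism.\<close>

lemma lift_functor:
  assumes F: "is_category \<C>" "is_functor \<C> \<E> F" and H: "weak_equivalence \<D> \<E> H"
  obtains P u where "is_functor \<C> \<D> P" "is_natural_iso \<C> \<E> F (comp_functor H P) u"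
proof -
  note FF = is_functorD[OF F(2)]
  have Hff: "fully_faithful \<D> \<E> H" using H unfolding weak_equivalence_def by blast
  note HD = fully_faithfulD[OF Hff]
  note HF = is_functorD[OF HD(3)]
  have "\<forall>A\<in>Obj \<C>. \<exists>p u v. p \<in> Obj \<D> \<and> u \<in> Mor \<E> (on_obj F A) (on_obj H p) \<and>
      v \<in> Mor \<E> (on_obj H p) (on_obj F A) \<and>
      Cmp \<E> (on_obj F A) (on_obj H p) (on_obj F A) v u = Ident \<E> (on_obj F A) \<and>
      Cmp \<E> (on_obj H p) (on_obj F A) (on_obj H p) u v = Ident \<E> (on_obj H p)"
    using H FF(1) unfolding weak_equivalence_def by blast
  then obtain P u v where Puv: "\<forall>A\<in>Obj \<C>. P A \<in> Obj \<D> \<and> u A \<in> Mor \<E> (on_obj F A) (on_obj H (P A)) \<and>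
      v A \<in> Mor \<E> (on_obj H (P A)) (on_obj F A) \<and>
      Cmp \<E> (on_obj F A) (on_obj H (P A)) (on_obj F A) (v A) (u A) = Ident \<E> (on_obj F A) \<and>
      Cmp \<E> (on_obj H (P A)) (on_obj F A) (on_obj H (P A)) (u A) (v A) = Ident \<E> (on_obj H (P A))"
    by metis
  let ?F = "on_obj F" and ?H = "\<lambda>A. on_obj H (P A)"
  note P = Puv[rule_format, THEN conjunct1] and u = Puv[rule_format, THEN conjunct2, THEN conjunct1]
    and v = Puv[rule_format, THEN conjunct2, THEN conjunct2, THEN conjunct1]
    and vu = Puv[rule_format, THEN conjunct2, THEN conjunct2, THEN conjunct2, THEN conjunct1]
    and uv = Puv[rule_format, THEN conjunct2, THEN conjunct2, THEN conjunct2, THEN conjunct2]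
  note c = cat_comp[OF HD(2)] and as = cat_assoc[OF HD(2)]
  note obj = FF(1) HF(1)[OF P]
  have "\<forall>A\<in>Obj \<C>. \<forall>B\<in>Obj \<C>. \<forall>f\<in>Mor \<C> A B. \<exists>g\<in>Mor \<D> (P A) (P B).
     on_mor H (P A) (P B) g =
       Cmp \<E> (?H A) (?F B) (?H B) (u B) (Cmp \<E> (?H A) (?F A) (?F B) (on_mor F A B f) (v A))"
    by (intro ballI HD(4) P c obj u v FF(2))
  then obtain p where p: "\<And>A B f. \<lbrakk>A\<in>Obj \<C>; B\<in>Obj \<C>; f\<in>Mor \<C> A B\<rbrakk> \<Longrightarrow> p A B f \<in> Mor \<D> (P A) (P B)"
    and "\<And>A B f. \<lbrakk>A\<in>Obj \<C>; B\<in>Obj \<C>; f\<in>Mor \<C> A B\<rbrakk> \<Longrightarrow> on_mor H (P A) (P B) (p A B f) =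
       Cmp \<E> (?H A) (?F B) (?H B) (u B) (Cmp \<E> (?H A) (?F A) (?F B) (on_mor F A B f) (v A))"
    by metis
  note Hp = this(2)
  have nat: "Cmp \<E> (?F A) (?H A) (?H B) (on_mor H (P A) (P B) (p A B f)) (u A) =
      Cmp \<E> (?F A) (?F B) (?H B) (u B) (on_mor F A B f)"
    if o: "A\<in>Obj \<C>" "B\<in>Obj \<C>" "f\<in>Mor \<C> A B" for A B f
  proof -
    have "Cmp \<E> (?F A) (?H A) (?H B) (on_mor H (P A) (P B) (p A B f)) (u A) =
      Cmp \<E> (?F A) (?F B) (?H B) (u B)
        (Cmp \<E> (?F A) (?H A) (?F B) (Cmp \<E> (?H A) (?F A) (?F B) (on_mor F A B f) (v A)) (u A))"
      unfolding Hp[OF o] by (intro as[symmetric] c obj u v FF(2) o)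
    also have "Cmp \<E> (?F A) (?H A) (?F B) (Cmp \<E> (?H A) (?F A) (?F B) (on_mor F A B f) (v A)) (u A)
        = on_mor F A B f"
      by (intro cancel_inverse_right HD(2) obj u v vu FF(2) o)
    finally show ?thesis .
  qed
  \<comment> \<open>As \<open>u A\<close> is invertible, naturality determines \<open>H (p f)\<close>, and functoriality of \<open>p\<close> follows.\<close>
  have uniq: "g = g'" if o: "A\<in>Obj \<C>" "B\<in>Obj \<C>" and g: "g \<in> Mor \<D> (P A) (P B)" "g' \<in> Mor \<D> (P A) (P B)"
    and eq: "Cmp \<E> (?F A) (?H A) (?H B) (on_mor H (P A) (P B) g) (u A) =
      Cmp \<E> (?F A) (?H A) (?H B) (on_mor H (P A) (P B) g') (u A)" for A B g g'
  proof -
    have "Cmp \<E> (?H A) (?F A) (?H B) (Cmp \<E> (?F A) (?H A) (?H B) (on_mor H (P A) (P B) g) (u A)) (v A)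
      = on_mor H (P A) (P B) g" if "g \<in> Mor \<D> (P A) (P B)" for g
      by (intro cancel_inverse_right HD(2) obj u v uv HF(2) P o that)
    then show ?thesis using eq g HD(5) P o by metis
  qed
  let ?P = "\<lparr>on_obj = P, on_mor = p\<rparr>"
  show thesis
  proof (rule that)
    show "is_natural_iso \<C> \<E> F (comp_functor H ?P) u"
      unfolding is_natural_iso_def comp_functor_def
      using nat is_isoI[OF u v vu uv] by simp
    have "p A A (Ident \<C> A) = Ident \<D> (P A)" if "A \<in> Obj \<C>" for A
    proof (rule uniq[of A A])
      show "p A A (Ident \<C> A) \<in> Mor \<D> (P A) (P A)" "Ident \<D> (P A) \<in> Mor \<D> (P A) (P A)"
        using that p P cat_id[OF F(1)] cat_id[OF HD(1)] by auto
      show "Cmp \<E> (?F A) (?H A) (?H A) (on_mor H (P A) (P A) (p A A (Ident \<C> A))) (u A) =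
        Cmp \<E> (?F A) (?H A) (?H A) (on_mor H (P A) (P A) (Ident \<D> (P A))) (u A)"
        using that P u obj cat_id[OF F(1)]
        by (simp add: nat FF(3) HF(3) cat_id_left[OF HD(2)] cat_id_right[OF HD(2)])
    qed (use that in auto)
    moreover have "p A C (Cmp \<C> A B C g f) = Cmp \<D> (P A) (P B) (P C) (p B C g) (p A B f)"
      if o: "A\<in>Obj \<C>" "B\<in>Obj \<C>" "C\<in>Obj \<C>" and m: "f \<in> Mor \<C> A B" "g \<in> Mor \<C> B C" for A B C f g
    proof (rule uniq[of A C])
      have gf: "Cmp \<C> A B C g f \<in> Mor \<C> A C" using cat_comp[OF F(1)] o m by blast
      show "p A C (Cmp \<C> A B C g f) \<in> Mor \<D> (P A) (P C)" using p o gf by blast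
      show "Cmp \<D> (P A) (P B) (P C) (p B C g) (p A B f) \<in> Mor \<D> (P A) (P C)"
        by (intro cat_comp[OF HD(1)] P p o m)
      let ?p = "\<lambda>A B f. on_mor H (P A) (P B) (p A B f)"
      have "Cmp \<E> (?F A) (?H A) (?H C) (?p A C (Cmp \<C> A B C g f)) (u A) =
          Cmp \<E> (?F A) (?F C) (?H C) (u C) (Cmp \<E> (?F A) (?F B) (?F C) (on_mor F B C g) (on_mor F A B f))"
        using nat[OF o(1,3) gf] FF(4) o m by simp
      also have "\<dots> = Cmp \<E> (?F A) (?F B) (?H C) (Cmp \<E> (?F B) (?F C) (?H C) (u C) (on_mor F B C g)) (on_mor F A B f)"
        by (intro as obj u FF(2) o m)
      also have "\<dots> = Cmp \<E> (?F A) (?F B) (?H C) (Cmp \<E> (?F B) (?H B) (?H C) (?p B C g) (u B)) (on_mor F A B f)"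
        using nat[OF o(2,3) m(2)] by simp
      also have "\<dots> = Cmp \<E> (?F A) (?H B) (?H C) (?p B C g) (Cmp \<E> (?F A) (?F B) (?H B) (u B) (on_mor F A B f))"
        by (intro as[symmetric] obj u FF(2) HF(2) P p o m)
      also have "\<dots> = Cmp \<E> (?F A) (?H B) (?H C) (?p B C g) (Cmp \<E> (?F A) (?H A) (?H B) (?p A B f) (u A))"
        using nat[OF o(1,2) m(1)] by simp
      also have "\<dots> = Cmp \<E> (?F A) (?H A) (?H C) (Cmp \<E> (?H A) (?H B) (?H C) (?p B C g) (?p A B f)) (u A)"
        by (intro as obj u FF(2) HF(2) P p o m)
      also have "Cmp \<E> (?H A) (?H B) (?H C) (?p B C g) (?p A B f) =
          on_mor H (P A) (P C) (Cmp \<D> (P A) (P B) (P C) (p B C g) (p A B f))"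
        by (intro HF(4)[symmetric] P p o m)
      finally show "Cmp \<E> (?F A) (?H A) (?H C) (?p A C (Cmp \<C> A B C g f)) (u A) =
        Cmp \<E> (?F A) (?H A) (?H C) (on_mor H (P A) (P C) (Cmp \<D> (P A) (P B) (P C) (p B C g) (p A B f))) (u A)" .
    qed (use o in auto)
    ultimately show "is_functor \<C> \<D> ?P"
      unfolding is_functor_def using P p by simp
  qed
qed

lemma reflect_iso:
  assumes F: "fully_faithful \<C> \<E> F" and o: "A \<in> Obj \<C>" "B \<in> Obj \<C>"
    and w: "is_iso \<E> (on_obj F A) (on_obj F B) w"
  obtains h where "is_iso \<C> A B h" "on_mor F A B h = w"
proof -
  note FD = fully_faithfulD[OF F]
  note FF = is_functorD[OF FD(3)]
  obtain v where v: "w \<in> Mor \<E> (on_obj F A) (on_obj F B)" "v \<in> Mor \<E> (on_obj F B) (on_obj F A)"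
    "Cmp \<E> (on_obj F A) (on_obj F B) (on_obj F A) v w = Ident \<E> (on_obj F A)"
    "Cmp \<E> (on_obj F B) (on_obj F A) (on_obj F B) w v = Ident \<E> (on_obj F B)"
    using w by (rule is_isoE)
  obtain h where h: "h \<in> Mor \<C> A B" "on_mor F A B h = w" using FD(4) o v(1) by blast
  obtain k where k: "k \<in> Mor \<C> B A" "on_mor F B A k = v" using FD(4) o v(2) by blast
  have "Cmp \<C> A B A k h = Ident \<C> A"
    by (rule FD(5)[of A A]) (use o h k v FF cat_comp[OF FD(1)] cat_id[OF FD(1)] in auto)
  moreover have "Cmp \<C> B A B h k = Ident \<C> B"
    by (rule FD(5)[of B B]) (use o h k v FF cat_comp[OF FD(1)] cat_id[OF FD(1)] in auto)
  ultimately show thesis using that is_isoI h k by metis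
qed

text \<open>If \<open>P\<close> and \<open>Q\<close> commute up to isomorphism with functors to \<open>\<E>\<close>, then \<open>F A \<cong> H (P A) \<cong> F (Q (P A))\<close>
  naturally, and a fully faithful \<open>F\<close> reflects this to \<open>A \<cong> Q (P A)\<close>.\<close>

lemma unit_natural_iso:
  assumes F: "fully_faithful \<C> \<E> F" and H: "is_functor \<D> \<E> H"
    and P: "is_functor \<C> \<D> P" and Q: "is_functor \<D> \<C> Q"
    and u: "is_natural_iso \<C> \<E> F (comp_functor H P) u"
    and v: "is_natural_iso \<D> \<E> H (comp_functor F Q) v"
  obtains \<eta> where "is_natural_iso \<C> \<C> id_functor (comp_functor Q P) \<eta>"
proof -
  note FD = fully_faithfulD[OF F]
  note FF = is_functorD[OF FD(3)] and HF = is_functorD[OF H] and PF = is_functorD[OF P] and QF = is_functorD[OF Q]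
  let ?F = "on_obj F" and ?H = "\<lambda>A. on_obj H (on_obj P A)" and ?P = "on_obj P" and ?Q = "\<lambda>A. on_obj Q (on_obj P A)"
  let ?K = "\<lambda>A. on_obj F (?Q A)"
  let ?pm = "on_mor P" and ?qm = "\<lambda>A B f. on_mor Q (?P A) (?P B) (on_mor P A B f)"
  let ?hm = "\<lambda>A B f. on_mor H (?P A) (?P B) (on_mor P A B f)"
  let ?km = "\<lambda>A B f. on_mor F (?Q A) (?Q B) (?qm A B f)"
  have ui: "\<And>A. A\<in>Obj \<C> \<Longrightarrow> is_iso \<E> (?F A) (?H A) (u A)"
    and un: "\<And>A B f. \<lbrakk>A\<in>Obj \<C>; B\<in>Obj \<C>; f\<in>Mor \<C> A B\<rbrakk> \<Longrightarrow>
      Cmp \<E> (?F A) (?F B) (?H B) (u B) (on_mor F A B f) = Cmp \<E> (?F A) (?H A) (?H B) (?hm A B f) (u A)"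
    using u unfolding is_natural_iso_def comp_functor_def by simp_all
  have "\<And>X. X\<in>Obj \<D> \<Longrightarrow> is_iso \<E> (on_obj H X) (?F (on_obj Q X)) (v X)"
    and "\<And>X Y f. \<lbrakk>X\<in>Obj \<D>; Y\<in>Obj \<D>; f\<in>Mor \<D> X Y\<rbrakk> \<Longrightarrow>
      Cmp \<E> (on_obj H X) (on_obj H Y) (?F (on_obj Q Y)) (v Y) (on_mor H X Y f) =
      Cmp \<E> (on_obj H X) (?F (on_obj Q X)) (?F (on_obj Q Y)) (on_mor F (on_obj Q X) (on_obj Q Y) (on_mor Q X Y f)) (v X)"
    using v unfolding is_natural_iso_def comp_functor_def by simp_all
  then have vi: "\<And>A. A\<in>Obj \<C> \<Longrightarrow> is_iso \<E> (?H A) (?K A) (v (?P A))"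
    and vn: "\<And>A B f. \<lbrakk>A\<in>Obj \<C>; B\<in>Obj \<C>; f\<in>Mor \<C> A B\<rbrakk> \<Longrightarrow>
      Cmp \<E> (?H A) (?H B) (?K B) (v (?P B)) (?hm A B f) = Cmp \<E> (?H A) (?K A) (?K B) (?km A B f) (v (?P A))"
    using PF by blast+
  note obj = FF(1) FF(1)[OF QF(1)[OF PF(1)]] HF(1)[OF PF(1)]
  note as = cat_assoc[OF FD(2)]
  note um = is_iso_mor[OF ui] and vm = is_iso_mor[OF vi]
  define w where "w A = Cmp \<E> (?F A) (?H A) (?K A) (v (?P A)) (u A)" for A
  have w: "is_iso \<E> (?F A) (?K A) (w A)" if "A \<in> Obj \<C>" for A
    unfolding w_def by (intro is_iso_comp FD(2) obj that ui vi)
  have wn: "Cmp \<E> (?F A) (?F B) (?K B) (w B) (on_mor F A B f) = Cmp \<E> (?F A) (?K A) (?K B) (?km A B f) (w A)"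
    if o: "A\<in>Obj \<C>" "B\<in>Obj \<C>" "f\<in>Mor \<C> A B" for A B f
  proof -
    have "Cmp \<E> (?F A) (?F B) (?K B) (w B) (on_mor F A B f) =
        Cmp \<E> (?F A) (?H B) (?K B) (v (?P B)) (Cmp \<E> (?F A) (?F B) (?H B) (u B) (on_mor F A B f))"
      unfolding w_def by (intro as[symmetric] obj o FF(2) um vm)
    also have "\<dots> = Cmp \<E> (?F A) (?H B) (?K B) (v (?P B)) (Cmp \<E> (?F A) (?H A) (?H B) (?hm A B f) (u A))"
      using un o by simp
    also have "\<dots> = Cmp \<E> (?F A) (?H A) (?K B) (Cmp \<E> (?H A) (?H B) (?K B) (v (?P B)) (?hm A B f)) (u A)"
      by (intro as obj o HF(2) PF um vm)
    also have "\<dots> = Cmp \<E> (?F A) (?H A) (?K B) (Cmp \<E> (?H A) (?K A) (?K B) (?km A B f) (v (?P A))) (u A)"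
      using vn o by simp
    also have "\<dots> = Cmp \<E> (?F A) (?K A) (?K B) (?km A B f) (w A)"
      unfolding w_def by (intro as[symmetric] obj o FF(2) QF(1,2) PF um vm)
    finally show ?thesis .
  qed
  have "\<forall>A\<in>Obj \<C>. \<exists>h. is_iso \<C> A (?Q A) h \<and> on_mor F A (?Q A) h = w A"
    by (metis reflect_iso[OF F] w PF(1) QF(1))
  then obtain \<eta> where \<eta>: "\<And>A. A\<in>Obj \<C> \<Longrightarrow> is_iso \<C> A (?Q A) (\<eta> A)"
    and F\<eta>: "\<And>A. A\<in>Obj \<C> \<Longrightarrow> on_mor F A (?Q A) (\<eta> A) = w A" by metis
  note \<eta>m = is_iso_mor[OF \<eta>]
  have "Cmp \<C> A B (?Q B) (\<eta> B) f = Cmp \<C> A (?Q A) (?Q B) (?qm A B f) (\<eta> A)"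
    if o: "A\<in>Obj \<C>" "B\<in>Obj \<C>" "f\<in>Mor \<C> A B" for A B f
  proof (rule FD(5)[of A "?Q B"])
    have m: "?qm A B f \<in> Mor \<C> (?Q A) (?Q B)" using PF(1,2) QF(1,2) o by blast
    show "Cmp \<C> A B (?Q B) (\<eta> B) f \<in> Mor \<C> A (?Q B)"
      "Cmp \<C> A (?Q A) (?Q B) (?qm A B f) (\<eta> A) \<in> Mor \<C> A (?Q B)"
      using cat_comp[OF FD(1)] o m PF(1) QF(1) \<eta>m by metis+
    show "on_mor F A (?Q B) (Cmp \<C> A B (?Q B) (\<eta> B) f) = on_mor F A (?Q B) (Cmp \<C> A (?Q A) (?Q B) (?qm A B f) (\<eta> A))"
      using wn[OF o] o m \<eta>m PF(1) QF(1) by (simp add: FF(4) F\<eta>)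
  qed (use o PF(1) QF(1) in auto)
  then show thesis
    using that[of \<eta>] \<eta> unfolding is_natural_iso_def id_functor_def comp_functor_def by simp
qed

lemma natural_iso_sym:
  assumes "is_category \<D>" "is_functor \<C> \<D> F" "is_functor \<C> \<D> G" and \<eta>: "is_natural_iso \<C> \<D> F G \<eta>"
  obtains \<epsilon> where "is_natural_iso \<C> \<D> G F \<epsilon>"
proof -
  note FF = is_functorD[OF assms(2)] and GF = is_functorD[OF assms(3)]
  let ?F = "on_obj F" and ?G = "on_obj G"
  have "\<forall>A\<in>Obj \<C>. \<exists>e. e \<in> Mor \<D> (?G A) (?F A) \<and> Cmp \<D> (?F A) (?G A) (?F A) e (\<eta> A) = Ident \<D> (?F A) \<and>
     Cmp \<D> (?G A) (?F A) (?G A) (\<eta> A) e = Ident \<D> (?G A)"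
    using \<eta> unfolding is_natural_iso_def is_iso_def by blast
  then obtain \<epsilon> where \<epsilon>: "\<And>A. A\<in>Obj \<C> \<Longrightarrow> \<epsilon> A \<in> Mor \<D> (?G A) (?F A)"
    and \<epsilon>\<eta>: "\<And>A. A\<in>Obj \<C> \<Longrightarrow> Cmp \<D> (?F A) (?G A) (?F A) (\<epsilon> A) (\<eta> A) = Ident \<D> (?F A)"
    and \<eta>\<epsilon>: "\<And>A. A\<in>Obj \<C> \<Longrightarrow> Cmp \<D> (?G A) (?F A) (?G A) (\<eta> A) (\<epsilon> A) = Ident \<D> (?G A)" by metis
  have \<eta>m: "\<And>A. A\<in>Obj \<C> \<Longrightarrow> \<eta> A \<in> Mor \<D> (?F A) (?G A)"
    and nat: "\<And>A B f. \<lbrakk>A\<in>Obj \<C>; B\<in>Obj \<C>; f\<in>Mor \<C> A B\<rbrakk> \<Longrightarrow>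
      Cmp \<D> (?F A) (?F B) (?G B) (\<eta> B) (on_mor F A B f) = Cmp \<D> (?F A) (?G A) (?G B) (on_mor G A B f) (\<eta> A)"
    using \<eta> unfolding is_natural_iso_def is_iso_def by blast+
  note as = cat_assoc[OF assms(1)] and c = cat_comp[OF assms(1)]
  have "Cmp \<D> (?G A) (?G B) (?F B) (\<epsilon> B) (on_mor G A B f) = Cmp \<D> (?G A) (?F A) (?F B) (on_mor F A B f) (\<epsilon> A)"
    if o: "A\<in>Obj \<C>" "B\<in>Obj \<C>" "f\<in>Mor \<C> A B" for A B f
  proof -
    have "on_mor G A B f = Cmp \<D> (?G A) (?F A) (?G B) (Cmp \<D> (?F A) (?G A) (?G B) (on_mor G A B f) (\<eta> A)) (\<epsilon> A)"
      by (intro cancel_inverse_right[symmetric] assms(1) FF(1) GF(1,2) o \<eta>m \<epsilon> \<eta>\<epsilon>)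
    also have "\<dots> = Cmp \<D> (?G A) (?F A) (?G B) (Cmp \<D> (?F A) (?F B) (?G B) (\<eta> B) (on_mor F A B f)) (\<epsilon> A)"
      using nat o by simp
    also have "\<dots> = Cmp \<D> (?G A) (?F B) (?G B) (\<eta> B) (Cmp \<D> (?G A) (?F A) (?F B) (on_mor F A B f) (\<epsilon> A))"
      by (intro as[symmetric] FF(1,2) GF(1) o \<eta>m \<epsilon>)
    finally show ?thesis
      using cancel_inverse_left[OF assms(1) GF(1)[OF o(1)] FF(1)[OF o(2)] GF(1)[OF o(2)]
          c[OF GF(1)[OF o(1)] FF(1)[OF o(1)] FF(1)[OF o(2)] \<epsilon>[OF o(1)] FF(2)[OF o]] \<eta>m[OF o(2)] \<epsilon>[OF o(2)] \<epsilon>\<eta>[OF o(2)]]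
      by simp
  qed
  then show thesis
    using that[of \<epsilon>] is_isoI[OF \<epsilon> \<eta>m \<eta>\<epsilon> \<epsilon>\<eta>] unfolding is_natural_iso_def by blast
qed

lemma equivalent_cats_if_weakly_equivalent_to_common:
  assumes F: "weak_equivalence \<C> \<E> F" and H: "weak_equivalence \<D> \<E> H"
  shows "equivalent_cats \<C> \<D>"
proof -
  have Ff: "fully_faithful \<C> \<E> F" and Hf: "fully_faithful \<D> \<E> H"
    using F H unfolding weak_equivalence_def by blast+
  note FD = fully_faithfulD(1-3)[OF Ff] and HD = fully_faithfulD(1-3)[OF Hf]
  obtain P u where P: "is_functor \<C> \<D> P" and u: "is_natural_iso \<C> \<E> F (comp_functor H P) u"
    using lift_functor[OF FD(1,3) H] by blast
  obtain Q v where Q: "is_functor \<D> \<C> Q" and v: "is_natural_iso \<D> \<E> H (comp_functor F Q) v"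
    using lift_functor[OF HD(1,3) F] by blast
  obtain \<eta> where \<eta>: "is_natural_iso \<C> \<C> id_functor (comp_functor Q P) \<eta>"
    using unit_natural_iso[OF Ff HD(3) P Q u v] .
  obtain \<epsilon>' where \<epsilon>': "is_natural_iso \<D> \<D> id_functor (comp_functor P Q) \<epsilon>'"
    using unit_natural_iso[OF Hf FD(3) Q P v u] .
  have id: "is_functor \<D> \<D> id_functor"
    by (simp add: is_functor_def id_functor_def)
  have PQ: "is_functor \<D> \<D> (comp_functor P Q)"
    using is_functorD[OF P] is_functorD[OF Q] by (simp add: is_functor_def comp_functor_def)
  obtain \<epsilon> where "is_natural_iso \<D> \<D> (comp_functor P Q) id_functor \<epsilon>"
    using natural_iso_sym[OF HD(1) id PQ \<epsilon>'] .
  then show ?thesis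
    using FD(1) HD(1) P Q \<eta> unfolding equivalent_cats_def by blast
qed

section \<open>Boolean algebras on carriers of arbitrary type\<close>

lemma sup_eqI:
  assumes L: "partial_order L" and "S \<subseteq> carrier L" "j \<in> carrier L" "\<And>s. s \<in> S \<Longrightarrow> s \<sqsubseteq>\<^bsub>L\<^esub> j"
    "\<And>u. \<lbrakk>u \<in> carrier L; \<And>s. s \<in> S \<Longrightarrow> s \<sqsubseteq>\<^bsub>L\<^esub> u\<rbrakk> \<Longrightarrow> j \<sqsubseteq>\<^bsub>L\<^esub> u"
  shows "\<Squnion>\<^bsub>L\<^esub>S = j"
proof -
  interpret partial_order L by (rule L)
  have "least L j (Upper L S)"
    unfolding least_def Upper_def using assms(2-4) by (auto intro!: assms(5))
  then show ?thesis
    unfolding sup_def using least_unique by blast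
qed

lemma inf_eqI:
  assumes L: "partial_order L" and "S \<subseteq> carrier L" "j \<in> carrier L" "\<And>s. s \<in> S \<Longrightarrow> j \<sqsubseteq>\<^bsub>L\<^esub> s"
    "\<And>u. \<lbrakk>u \<in> carrier L; \<And>s. s \<in> S \<Longrightarrow> u \<sqsubseteq>\<^bsub>L\<^esub> s\<rbrakk> \<Longrightarrow> u \<sqsubseteq>\<^bsub>L\<^esub> j"
  shows "\<Sqinter>\<^bsub>L\<^esub>S = j"
proof -
  interpret partial_order L by (rule L)
  have "greatest L j (Lower L S)"
    unfolding greatest_def Lower_def using assms(2-4) by (auto intro!: assms(5))
  then show ?thesis
    unfolding inf_def using greatest_unique by blast
qed

lemma partial_orderI:
  fixes B (structure)
  assumes eq: "eq B = (=)"
    and "\<And>x. x \<in> carrier B \<Longrightarrow> x \<sqsubseteq> x"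
    and "\<And>x y. \<lbrakk>x \<in> carrier B; y \<in> carrier B; x \<sqsubseteq> y; y \<sqsubseteq> x\<rbrakk> \<Longrightarrow> x = y"
    and "\<And>x y z. \<lbrakk>x \<in> carrier B; y \<in> carrier B; z \<in> carrier B; x \<sqsubseteq> y; y \<sqsubseteq> z\<rbrakk> \<Longrightarrow> x \<sqsubseteq> z"
  shows "partial_order B"
  by unfold_locales (simp_all add: eq, (blast intro: assms)+)

lemma bool_algebraI:
  fixes B (structure)
  assumes po: "partial_order B"
    and m: "\<And>x y. \<lbrakk>x \<in> carrier B; y \<in> carrier B\<rbrakk> \<Longrightarrow> m x y \<in> carrier B \<and> m x y \<sqsubseteq> x \<and> m x y \<sqsubseteq> y \<and>
      (\<forall>w\<in>carrier B. w \<sqsubseteq> x \<longrightarrow> w \<sqsubseteq> y \<longrightarrow> w \<sqsubseteq> m x y)"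
    and j: "\<And>x y. \<lbrakk>x \<in> carrier B; y \<in> carrier B\<rbrakk> \<Longrightarrow> j x y \<in> carrier B \<and> x \<sqsubseteq> j x y \<and> y \<sqsubseteq> j x y \<and>
      (\<forall>w\<in>carrier B. x \<sqsubseteq> w \<longrightarrow> y \<sqsubseteq> w \<longrightarrow> j x y \<sqsubseteq> w)"
    and z: "z \<in> carrier B" "\<And>x. x \<in> carrier B \<Longrightarrow> z \<sqsubseteq> x"
    and u: "u \<in> carrier B" "\<And>x. x \<in> carrier B \<Longrightarrow> x \<sqsubseteq> u"
    and dist: "\<And>x y w. \<lbrakk>x \<in> carrier B; y \<in> carrier B; w \<in> carrier B\<rbrakk> \<Longrightarrow> m x (j y w) = j (m x y) (m x w)"
    and comp: "\<And>x. x \<in> carrier B \<Longrightarrow> \<exists>y\<in>carrier B. m x y = z \<and> j x y = u"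
  shows "bool_algebra B"
    and "\<And>x y. \<lbrakk>x \<in> carrier B; y \<in> carrier B\<rbrakk> \<Longrightarrow> x \<sqinter> y = m x y"
    and "\<And>x y. \<lbrakk>x \<in> carrier B; y \<in> carrier B\<rbrakk> \<Longrightarrow> x \<squnion> y = j x y"
    and "\<bottom> = z" "\<top> = u"
proof -
  interpret partial_order B by (rule po)
  show meet: "\<And>x y. \<lbrakk>x \<in> carrier B; y \<in> carrier B\<rbrakk> \<Longrightarrow> x \<sqinter> y = m x y"
    unfolding meet_def by (rule inf_eqI[OF po]) (use m in auto)
  show join: "\<And>x y. \<lbrakk>x \<in> carrier B; y \<in> carrier B\<rbrakk> \<Longrightarrow> x \<squnion> y = j x y"
    unfolding join_def by (rule sup_eqI[OF po]) (use j in auto)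
  interpret bounded_lattice B
  proof
    fix x y assume xy: "x \<in> carrier B" "y \<in> carrier B"
    have "least B (j x y) (Upper B {x, y})"
      using j[OF xy] xy unfolding least_def Upper_def by auto
    then show "\<exists>s. least B s (Upper B {x, y})" by blast
    have "greatest B (m x y) (Lower B {x, y})"
      using m[OF xy] xy unfolding greatest_def Lower_def by auto
    then show "\<exists>s. greatest B s (Lower B {x, y})" by blast
  next
    have "least B z (carrier B)" using z unfolding least_def by auto
    then show "\<exists>x. least B x (carrier B)" by blast
    have "greatest B u (carrier B)" using u unfolding greatest_def by auto
    then show "\<exists>x. greatest B x (carrier B)" by blast
  qed
  show bot: "\<bottom> = z" using z bottom_eq by metis
  show top: "\<top> = u" using u top_eq by metis
  show "bool_algebra B"
    unfolding bool_algebra_def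
    using m j meet join dist comp bot top by (auto intro: bounded_lattice_axioms)
qed

lemma (in bounded_lattice) inf_of_empty: "\<Sqinter>{} = \<top>"
  by (rule inf_eqI[OF partial_order_axioms]) auto

lemma (in bounded_lattice) sup_of_empty: "\<Squnion>{} = \<bottom>"
  by (rule sup_eqI[OF partial_order_axioms]) auto

lemma (in bounded_lattice) finite_inf:
  assumes "finite S" "S \<subseteq> carrier L"
  shows finite_meet_closed: "\<Sqinter>S \<in> carrier L"
    and finite_meet_lower: "\<And>s. s \<in> S \<Longrightarrow> \<Sqinter>S \<sqsubseteq> s"
    and finite_meet_greatest: "\<And>u. \<lbrakk>u \<in> carrier L; \<And>s. s \<in> S \<Longrightarrow> u \<sqsubseteq> s\<rbrakk> \<Longrightarrow> u \<sqsubseteq> \<Sqinter>S"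
proof -
  have "\<Sqinter>S \<in> carrier L \<and> (\<forall>s\<in>S. \<Sqinter>S \<sqsubseteq> s) \<and> (\<forall>u\<in>carrier L. (\<forall>s\<in>S. u \<sqsubseteq> s) \<longrightarrow> u \<sqsubseteq> \<Sqinter>S)"
  proof (cases "S = {}")
    case False
    then have "greatest L (\<Sqinter>S) (Lower L S)" using assms by (intro finite_inf_greatest)
    then show ?thesis using assms unfolding greatest_def Lower_def by auto
  qed (simp add: inf_of_empty)
  then show "\<Sqinter>S \<in> carrier L" "\<And>s. s \<in> S \<Longrightarrow> \<Sqinter>S \<sqsubseteq> s"
    "\<And>u. \<lbrakk>u \<in> carrier L; \<And>s. s \<in> S \<Longrightarrow> u \<sqsubseteq> s\<rbrakk> \<Longrightarrow> u \<sqsubseteq> \<Sqinter>S" by blast+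
qed

lemma (in bounded_lattice) inf_of_insert:
  assumes "finite S" "S \<subseteq> carrier L" "x \<in> carrier L"
  shows "\<Sqinter>(insert x S) = x \<sqinter> \<Sqinter>S"
proof (rule inf_eqI[OF partial_order_axioms])
  note S = finite_inf[OF assms(1,2)]
  show "x \<sqinter> \<Sqinter>S \<sqsubseteq> s" if "s \<in> insert x S" for s
  proof (cases "s = x")
    case False
    then have "x \<sqinter> \<Sqinter>S \<sqsubseteq> \<Sqinter>S" "\<Sqinter>S \<sqsubseteq> s" using that S assms meet_right by auto
    then show ?thesis using le_trans[of "x \<sqinter> \<Sqinter>S" "\<Sqinter>S" s] S(1) assms that by auto
  qed (use assms S(1) meet_left in auto)
  show "u \<sqsubseteq> x \<sqinter> \<Sqinter>S" if "u \<in> carrier L" "\<And>s. s \<in> insert x S \<Longrightarrow> u \<sqsubseteq> s" for u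
    using that S assms by (intro meet_le) auto
qed (use assms finite_meet_closed in auto)

lemma (in bounded_lattice) finite_sup:
  assumes "finite S" "S \<subseteq> carrier L"
  shows finite_join_closed: "\<Squnion>S \<in> carrier L"
    and finite_join_upper: "\<And>s. s \<in> S \<Longrightarrow> s \<sqsubseteq> \<Squnion>S"
    and finite_join_least: "\<And>u. \<lbrakk>u \<in> carrier L; \<And>s. s \<in> S \<Longrightarrow> s \<sqsubseteq> u\<rbrakk> \<Longrightarrow> \<Squnion>S \<sqsubseteq> u"
proof -
  have "\<Squnion>S \<in> carrier L \<and> (\<forall>s\<in>S. s \<sqsubseteq> \<Squnion>S) \<and> (\<forall>u\<in>carrier L. (\<forall>s\<in>S. s \<sqsubseteq> u) \<longrightarrow> \<Squnion>S \<sqsubseteq> u)"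
  proof (cases "S = {}")
    case False
    then have "least L (\<Squnion>S) (Upper L S)" using assms by (intro finite_sup_least)
    then show ?thesis using assms unfolding least_def Upper_def by auto
  qed (simp add: sup_of_empty)
  then show "\<Squnion>S \<in> carrier L" "\<And>s. s \<in> S \<Longrightarrow> s \<sqsubseteq> \<Squnion>S"
    "\<And>u. \<lbrakk>u \<in> carrier L; \<And>s. s \<in> S \<Longrightarrow> s \<sqsubseteq> u\<rbrakk> \<Longrightarrow> \<Squnion>S \<sqsubseteq> u" by blast+
qed

lemma (in bounded_lattice) sup_of_insert:
  assumes "finite S" "S \<subseteq> carrier L" "x \<in> carrier L"
  shows "\<Squnion>(insert x S) = x \<squnion> \<Squnion>S"
proof (rule sup_eqI[OF partial_order_axioms])
  note S = finite_sup[OF assms(1,2)]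
  show "s \<sqsubseteq> x \<squnion> \<Squnion>S" if "s \<in> insert x S" for s
  proof (cases "s = x")
    case False
    then have "\<Squnion>S \<sqsubseteq> x \<squnion> \<Squnion>S" "s \<sqsubseteq> \<Squnion>S" using that S assms join_right by auto
    then show ?thesis using le_trans[of s "\<Squnion>S" "x \<squnion> \<Squnion>S"] S(1) assms that by auto
  qed (use assms S(1) join_left in auto)
  show "x \<squnion> \<Squnion>S \<sqsubseteq> u" if "u \<in> carrier L" "\<And>s. s \<in> insert x S \<Longrightarrow> s \<sqsubseteq> u" for u
    using that S assms by (intro join_le) auto
qed (use assms finite_join_closed in auto)

lemma bool_algebra_lattice: "bool_algebra B \<Longrightarrow> bounded_lattice B"
  unfolding bool_algebra_def by blast

lemma bool_algebra_partial_order: "bool_algebra B \<Longrightarrow> partial_order B"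
  by (auto dest!: bool_algebra_lattice intro: bounded_lattice.axioms(1) lattice.axioms upper_semilattice.axioms)

text \<open>The flag \<open>lat\<close> selects between the two kinds of morphisms, so that each argument about them
  is given once. The carriers may have any type, while \<open>\<U>\<close> still bounds their size in terms of
  \<open>'a\<close>: such algebras are the intermediate stage between frames or spaces and algebras on \<open>'a\<close>.\<close>

definition ba_morphisms :: "bool \<Rightarrow> 'b gorder \<Rightarrow> 'c gorder \<Rightarrow> ('b \<Rightarrow> 'c) set" where
  "ba_morphisms lat B C = (if lat then lattice_morphisms B C else meet_morphisms B C)"

definition BA :: "bool \<Rightarrow> 'a set set \<Rightarrow> ('b gorder, 'b \<Rightarrow> 'b) cat" where
  "BA lat \<U> = \<lparr>Obj = {B. bool_algebra B \<and> of_size \<U> (carrier B)},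
     Mor = ba_morphisms lat, Ident = (\<lambda>B. \<lambda>x\<in>carrier B. x),
     Cmp = (\<lambda>B C D g f. compose (carrier B) g f)\<rparr>"

lemma BA_simps:
  "B \<in> Obj (BA lat \<U>) \<longleftrightarrow> bool_algebra B \<and> of_size \<U> (carrier B)"
  "Mor (BA lat \<U>) = ba_morphisms lat"
  "Ident (BA lat \<U>) B = (\<lambda>x\<in>carrier B. x)"
  "Cmp (BA lat \<U>) B C D g f = compose (carrier B) g f"
  unfolding BA_def by simp_all

lemma BA_M_eq: "BA_M \<U> = BA False \<U>" and BA_L_eq: "BA_L \<U> = BA True \<U>"
  unfolding BA_M_def BA_L_def BA_def ba_morphisms_def by simp_all

lemma ba_morphisms_iff:
  assumes B: "bool_algebra B" and C: "bool_algebra C"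
  shows "f \<in> ba_morphisms lat B C \<longleftrightarrow> f \<in> carrier B \<rightarrow>\<^sub>E carrier C \<and> f \<top>\<^bsub>B\<^esub> = \<top>\<^bsub>C\<^esub> \<and>
    (\<forall>x\<in>carrier B. \<forall>y\<in>carrier B. f (x \<sqinter>\<^bsub>B\<^esub> y) = f x \<sqinter>\<^bsub>C\<^esub> f y) \<and>
    (lat \<longrightarrow> (\<forall>x\<in>carrier B. \<forall>y\<in>carrier B. f (x \<squnion>\<^bsub>B\<^esub> y) = f x \<squnion>\<^bsub>C\<^esub> f y))"
    (is "_ \<longleftrightarrow> ?R")
proof -
  interpret B: bounded_lattice B by (rule bool_algebra_lattice[OF B])
  interpret C: bounded_lattice C by (rule bool_algebra_lattice[OF C])
  show ?thesis
  proof
    assume f: "f \<in> ba_morphisms lat B C"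
    then have m: "f \<in> carrier B \<rightarrow>\<^sub>E carrier C"
      "\<And>S. \<lbrakk>S \<subseteq> carrier B; finite S\<rbrakk> \<Longrightarrow> f (\<Sqinter>\<^bsub>B\<^esub>S) = \<Sqinter>\<^bsub>C\<^esub>(f ` S)"
      unfolding ba_morphisms_def lattice_morphisms_def meet_morphisms_def by (auto split: if_splits)
    have j: "f (\<Squnion>\<^bsub>B\<^esub>S) = \<Squnion>\<^bsub>C\<^esub>(f ` S)" if "lat" "S \<subseteq> carrier B" "finite S" "S \<noteq> {}" for S
      using f that unfolding ba_morphisms_def lattice_morphisms_def by auto
    show ?R
      using m(1) m(2)[of "{}"] m(2)[of "{x, y}" for x y] j[of "{x, y}" for x y]
      by (simp add: B.inf_of_empty C.inf_of_empty meet_def join_def)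
  next
    assume R: ?R
    then have fc: "\<And>x. x \<in> carrier B \<Longrightarrow> f x \<in> carrier C" by auto
    have inf: "f (\<Sqinter>\<^bsub>B\<^esub>S) = \<Sqinter>\<^bsub>C\<^esub>(f ` S)" if "finite S" "S \<subseteq> carrier B" for S
      using that
    proof (induction S rule: finite_induct)
      case empty
      then show ?case using R B.inf_of_empty C.inf_of_empty by simp
    next
      case (insert x S)
      then have "f ` S \<subseteq> carrier C" using fc by auto
      then show ?case using insert R fc by (simp add: B.inf_of_insert C.inf_of_insert B.finite_meet_closed)
    qed
    have sup: "f (\<Squnion>\<^bsub>B\<^esub>S) = \<Squnion>\<^bsub>C\<^esub>(f ` S)" if "finite S" "S \<noteq> {}" "S \<subseteq> carrier B" lat for S
      using that
    proof (induction S rule: finite_ne_induct)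
      case (singleton x)
      then show ?case using fc by simp
    next
      case (insert x S)
      then have "f ` S \<subseteq> carrier C" using fc by auto
      then show ?case using insert R fc by (simp add: B.sup_of_insert C.sup_of_insert B.finite_join_closed)
    qed
    show "f \<in> ba_morphisms lat B C"
      using R inf sup unfolding ba_morphisms_def lattice_morphisms_def meet_morphisms_def by auto
  qed
qed

lemma ba_morphism_funcset: "f \<in> ba_morphisms lat B C \<Longrightarrow> f \<in> carrier B \<rightarrow>\<^sub>E carrier C"
  unfolding ba_morphisms_def lattice_morphisms_def meet_morphisms_def by (auto split: if_splits)

lemma ba_morphisms_compose:
  assumes B: "bool_algebra B" and C: "bool_algebra C" and D: "bool_algebra D"
    and f: "f \<in> ba_morphisms lat B C" and g: "g \<in> ba_morphisms lat C D"
  shows "compose (carrier B) g f \<in> ba_morphisms lat B D"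
proof -
  interpret B: bounded_lattice B by (rule bool_algebra_lattice[OF B])
  have "\<And>x. x \<in> carrier B \<Longrightarrow> f x \<in> carrier C" "\<And>x. x \<in> carrier C \<Longrightarrow> g x \<in> carrier D"
    using f g ba_morphism_funcset by blast+
  then show ?thesis
    using f g unfolding ba_morphisms_iff[OF B C] ba_morphisms_iff[OF C D] ba_morphisms_iff[OF B D]
    by (simp add: compose_eq PiE_iff compose_def)
qed

lemma ba_morphisms_ident:
  assumes B: "bool_algebra B"
  shows "(\<lambda>x\<in>carrier B. x) \<in> ba_morphisms lat B B"
proof -
  interpret B: bounded_lattice B by (rule bool_algebra_lattice[OF B])
  show ?thesis unfolding ba_morphisms_iff[OF B B] by simp
qed

lemma compose_ident_left: "f \<in> A \<rightarrow>\<^sub>E B \<Longrightarrow> compose A (\<lambda>x\<in>B. x) f = f"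
  and compose_ident_right: "f \<in> A \<rightarrow>\<^sub>E B \<Longrightarrow> compose A f (\<lambda>x\<in>A. x) = f"
  by (auto simp: compose_def fun_eq_iff PiE_iff extensional_def)

lemma compose_compose: "f \<in> A \<rightarrow>\<^sub>E B \<Longrightarrow> compose A h (compose A g f) = compose A (compose B h g) f"
  by (auto simp: compose_def fun_eq_iff)

lemma is_category_BA: "is_category (BA lat \<U> :: ('b gorder, 'b \<Rightarrow> 'b) cat)"
  unfolding is_category_def
proof (intro conjI ballI)
  fix B C D :: "'b gorder" and f g
  assume "B \<in> Obj (BA lat \<U>)" "C \<in> Obj (BA lat \<U>)" "D \<in> Obj (BA lat \<U>)"
    "f \<in> Mor (BA lat \<U>) B C" "g \<in> Mor (BA lat \<U>) C D"
  then show "Cmp (BA lat \<U>) B C D g f \<in> Mor (BA lat \<U>) B D"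
    unfolding BA_simps using ba_morphisms_compose by blast
qed (auto intro!: ba_morphisms_ident compose_ident_left compose_ident_right
      compose_compose dest: ba_morphism_funcset simp: BA_simps)

definition order_iso :: "'b gorder \<Rightarrow> 'c gorder \<Rightarrow> ('b \<Rightarrow> 'c) \<Rightarrow> bool" where
  "order_iso B C e \<longleftrightarrow> bij_betw e (carrier B) (carrier C) \<and>
    (\<forall>x\<in>carrier B. \<forall>y\<in>carrier B. x \<sqsubseteq>\<^bsub>B\<^esub> y \<longleftrightarrow> e x \<sqsubseteq>\<^bsub>C\<^esub> e y)"

lemma order_iso_inv:
  assumes "order_iso B C e"
  shows "order_iso C B (inv_into (carrier B) e)"
proof -
  have bij: "bij_betw e (carrier B) (carrier C)" using assms unfolding order_iso_def by blast
  let ?d = "inv_into (carrier B) e"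
  have d: "bij_betw ?d (carrier C) (carrier B)" using bij by (rule bij_betw_inv_into)
  have "x \<sqsubseteq>\<^bsub>C\<^esub> y \<longleftrightarrow> ?d x \<sqsubseteq>\<^bsub>B\<^esub> ?d y" if "x \<in> carrier C" "y \<in> carrier C" for x y
    using assms bij_betwE[OF d] bij_betw_inv_into_right[OF bij] that unfolding order_iso_def by simp
  then show ?thesis unfolding order_iso_def using d by blast
qed

lemma order_iso_trans: "order_iso B C e \<Longrightarrow> order_iso C D d \<Longrightarrow> order_iso B D (d \<circ> e)"
  unfolding order_iso_def by (auto intro: bij_betw_trans dest: bij_betwE)

lemma bool_algebra_order_iso:
  assumes B: "bool_algebra B" and e: "order_iso B C e" and eq: "eq C = (=)"
  shows "bool_algebra C"
    "\<And>x y. \<lbrakk>x \<in> carrier B; y \<in> carrier B\<rbrakk> \<Longrightarrow> e (x \<sqinter>\<^bsub>B\<^esub> y) = e x \<sqinter>\<^bsub>C\<^esub> e y"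
    "\<And>x y. \<lbrakk>x \<in> carrier B; y \<in> carrier B\<rbrakk> \<Longrightarrow> e (x \<squnion>\<^bsub>B\<^esub> y) = e x \<squnion>\<^bsub>C\<^esub> e y"
    "e \<top>\<^bsub>B\<^esub> = \<top>\<^bsub>C\<^esub>"
proof -
  interpret B: bounded_lattice B by (rule bool_algebra_lattice[OF B])
  have bij: "bij_betw e (carrier B) (carrier C)"
    and le: "\<And>x y. \<lbrakk>x \<in> carrier B; y \<in> carrier B\<rbrakk> \<Longrightarrow> e x \<sqsubseteq>\<^bsub>C\<^esub> e y \<longleftrightarrow> x \<sqsubseteq>\<^bsub>B\<^esub> y"
    using e unfolding order_iso_def by auto
  then have C: "carrier C = e ` carrier B" and inj: "inj_on e (carrier B)"
    unfolding bij_betw_def by auto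
  define i where "i = inv_into (carrier B) e"
  have i: "\<And>x. x \<in> carrier B \<Longrightarrow> i (e x) = x" unfolding i_def using inj by simp
  have ie: "x \<in> carrier B \<Longrightarrow> y \<in> carrier B \<Longrightarrow> e x = e y \<longleftrightarrow> x = y" for x y
    using inj by (meson inj_on_eq_iff)
  have po: "partial_order C"
    by (rule partial_orderI) (auto simp: eq C le intro: B.le_trans B.le_antisym[THEN arg_cong])
  have "bool_algebra B" by (rule B)
  then have dist: "\<And>x y z. \<lbrakk>x \<in> carrier B; y \<in> carrier B; z \<in> carrier B\<rbrakk> \<Longrightarrow>
       x \<sqinter>\<^bsub>B\<^esub> (y \<squnion>\<^bsub>B\<^esub> z) = (x \<sqinter>\<^bsub>B\<^esub> y) \<squnion>\<^bsub>B\<^esub> (x \<sqinter>\<^bsub>B\<^esub> z)"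
    and compl: "\<And>x. x \<in> carrier B \<Longrightarrow> \<exists>y\<in>carrier B. x \<sqinter>\<^bsub>B\<^esub> y = \<bottom>\<^bsub>B\<^esub> \<and> x \<squnion>\<^bsub>B\<^esub> y = \<top>\<^bsub>B\<^esub>"
    unfolding bool_algebra_def by auto
  note ba = bool_algebraI[of C "\<lambda>x y. e (i x \<sqinter>\<^bsub>B\<^esub> i y)" "\<lambda>x y. e (i x \<squnion>\<^bsub>B\<^esub> i y)" "e \<bottom>\<^bsub>B\<^esub>" "e \<top>\<^bsub>B\<^esub>", OF po]
  show "bool_algebra C"
    by (rule ba) (auto simp: C i le ie dist compl intro: B.meet_left B.meet_right B.join_left B.join_right
        B.meet_le B.join_le)
  show "\<And>x y. \<lbrakk>x \<in> carrier B; y \<in> carrier B\<rbrakk> \<Longrightarrow> e (x \<sqinter>\<^bsub>B\<^esub> y) = e x \<sqinter>\<^bsub>C\<^esub> e y"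
    by (subst ba(2)) (auto simp: C i le ie dist compl intro: B.meet_left B.meet_right B.join_left B.join_right
        B.meet_le B.join_le)
  show "\<And>x y. \<lbrakk>x \<in> carrier B; y \<in> carrier B\<rbrakk> \<Longrightarrow> e (x \<squnion>\<^bsub>B\<^esub> y) = e x \<squnion>\<^bsub>C\<^esub> e y"
    by (subst ba(3)) (auto simp: C i le ie dist compl intro: B.meet_left B.meet_right B.join_left B.join_right
        B.meet_le B.join_le)
  show "e \<top>\<^bsub>B\<^esub> = \<top>\<^bsub>C\<^esub>"
    by (subst ba(5)) (auto simp: C i le ie dist compl intro: B.meet_left B.meet_right B.join_left B.join_right
        B.meet_le B.join_le)
qed

lemma partial_order_eq: "partial_order B \<Longrightarrow> eq B = (=)"
  by (rule partial_order.eq_is_equal)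

lemma order_iso_morphism:
  assumes B: "bool_algebra B" and C: "bool_algebra C" and e: "order_iso B C e"
  shows "restrict e (carrier B) \<in> ba_morphisms lat B C"
proof -
  interpret B: bounded_lattice B by (rule bool_algebra_lattice[OF B])
  note * = bool_algebra_order_iso[OF B e partial_order_eq[OF bool_algebra_partial_order[OF C]]]
  have "e \<in> carrier B \<rightarrow> carrier C" using e unfolding order_iso_def by (auto dest: bij_betwE)
  then show ?thesis
    unfolding ba_morphisms_iff[OF B C] using *(2,3,4) by auto
qed

definition transport :: "('b \<Rightarrow> 'c) \<Rightarrow> 'b gorder \<Rightarrow> 'c gorder" where
  "transport e B = \<lparr>carrier = e ` carrier B, eq = (=),
     le = (\<lambda>x y. inv_into (carrier B) e x \<sqsubseteq>\<^bsub>B\<^esub> inv_into (carrier B) e y)\<rparr>"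

lemma order_iso_transport: "inj_on e (carrier B) \<Longrightarrow> order_iso B (transport e B) e"
  unfolding order_iso_def transport_def by (simp add: bij_betw_def)

lemma bool_algebra_transport:
  "\<lbrakk>bool_algebra B; inj_on e (carrier B)\<rbrakk> \<Longrightarrow> bool_algebra (transport e B)"
  by (rule bool_algebra_order_iso(1)[OF _ order_iso_transport]) (auto simp: transport_def)

text \<open>An algebra of permitted size on any type can be moved to a carrier in \<open>\<U>\<close> along a chosen injection.
  Morphisms are conjugated with the injections, hence this is a fully faithful functor.\<close>

lemma transport_functor:
  fixes \<U> :: "'a set set"
  obtains T :: "('b gorder, 'b \<Rightarrow> 'b, 'a gorder, 'a \<Rightarrow> 'a) functr" where
    "fully_faithful (BA lat \<U>) (BA lat \<U>) T"
    "\<And>B. \<lbrakk>bool_algebra B; of_size \<U> (carrier B)\<rbrakk> \<Longrightarrow> \<exists>e. order_iso B (on_obj T B) e"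
proof -
  have "\<forall>B :: 'b gorder. \<exists>e. of_size \<U> (carrier B) \<longrightarrow> inj_on e (carrier B) \<and> e ` carrier B \<in> \<U>"
    unfolding of_size_def eqpoll_def bij_betw_def by blast
  then obtain e where e: "\<And>B :: 'b gorder. of_size \<U> (carrier B) \<Longrightarrow> inj_on (e B) (carrier B)"
    and im: "\<And>B :: 'b gorder. of_size \<U> (carrier B) \<Longrightarrow> e B ` carrier B \<in> \<U>" by metis
  define d where "d B = inv_into (carrier B) (e B)" for B
  define tr where "tr B C f = (\<lambda>x\<in>e B ` carrier B. e C (f (d B x)))" for B C f
  define T where "T = \<lparr>on_obj = (\<lambda>B. transport (e B) B), on_mor = tr\<rparr>"
  let ?T = "\<lambda>B. transport (e B) B"
  have carT: "carrier (?T B) = e B ` carrier B" for B by (simp add: transport_def)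
  have de: "d B (e B x) = x" if "of_size \<U> (carrier B)" "x \<in> carrier B" for B x
    unfolding d_def using e[OF that(1)] that(2) by simp
  have ed: "e B (d B y) = y" and dc: "d B y \<in> carrier B" if "y \<in> e B ` carrier B" for B y
    unfolding d_def using that by (auto intro: f_inv_into_f inv_into_into)
  have T: "bool_algebra (?T B) \<and> of_size \<U> (carrier (?T B))" if "bool_algebra B" "of_size \<U> (carrier B)" for B
    using that im[of B] e[of B] by (auto intro: bool_algebra_transport simp: carT of_size_def)
  have eiso: "order_iso B (?T B) (e B)" if "of_size \<U> (carrier B)" for B
    using that e by (intro order_iso_transport)
  have em: "restrict (e B) (carrier B) \<in> ba_morphisms lat B (?T B)"
    and dm: "restrict (d B) (e B ` carrier B) \<in> ba_morphisms lat (?T B) B"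
    if "bool_algebra B" "of_size \<U> (carrier B)" for B
    using that order_iso_morphism[OF _ _ eiso[of B], of lat]
      order_iso_morphism[OF _ _ order_iso_inv[OF eiso[of B]], of lat] T[of B]
    unfolding d_def carT by auto
  have trm: "tr B C f \<in> ba_morphisms lat (?T B) (?T C)"
    if B: "bool_algebra B" "of_size \<U> (carrier B)" and C: "bool_algebra C" "of_size \<U> (carrier C)"
      and f: "f \<in> ba_morphisms lat B C" for B C f
  proof -
    have "compose (carrier (?T B)) (compose (carrier B) (restrict (e C) (carrier C)) f)
       (restrict (d B) (e B ` carrier B)) \<in> ba_morphisms lat (?T B) (?T C)"
      by (intro ba_morphisms_compose[where C = B] ba_morphisms_compose[where C = C] em dm f
          conjunct1[OF T] B C)
    moreover have "compose (carrier (?T B)) (compose (carrier B) (restrict (e C) (carrier C)) f)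
       (restrict (d B) (e B ` carrier B)) = tr B C f"
      using ba_morphism_funcset[OF f] dc unfolding tr_def compose_def carT by (auto simp: fun_eq_iff)
    ultimately show ?thesis by simp
  qed
  have "fully_faithful (BA lat \<U>) (BA lat \<U>) T"
    unfolding fully_faithful_def
  proof (intro conjI ballI is_category_BA)
    show "is_functor (BA lat \<U>) (BA lat \<U>) T"
      unfolding is_functor_def BA_simps
    proof (intro conjI ballI)
      fix B :: "'b gorder" assume "B \<in> Obj (BA lat \<U>)"
      then have B: "bool_algebra B" "of_size \<U> (carrier B)" unfolding BA_simps by auto
      show "bool_algebra (on_obj T B)" "of_size \<U> (carrier (on_obj T B))"
        using T B unfolding T_def by auto
      show "on_mor T B B (\<lambda>x\<in>carrier B. x) = (\<lambda>x\<in>carrier (on_obj T B). x)"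
        by (auto simp: T_def tr_def carT fun_eq_iff ed dc)
      fix C :: "'b gorder" and f assume "C \<in> Obj (BA lat \<U>)" and f: "f \<in> ba_morphisms lat B C"
      then have C: "bool_algebra C" "of_size \<U> (carrier C)" unfolding BA_simps by auto
      show "on_mor T B C f \<in> ba_morphisms lat (on_obj T B) (on_obj T C)"
        using trm B C f unfolding T_def by simp
      fix D :: "'b gorder" and g assume "D \<in> Obj (BA lat \<U>)" and g: "g \<in> ba_morphisms lat C D"
      show "on_mor T B D (compose (carrier B) g f) =
        compose (carrier (on_obj T B)) (on_mor T C D g) (on_mor T B C f)"
        using ba_morphism_funcset[OF f] dc
        by (auto simp: T_def tr_def carT compose_def fun_eq_iff de C PiE_iff)
    qed
    fix B C :: "'b gorder" assume "B \<in> Obj (BA lat \<U>)" "C \<in> Obj (BA lat \<U>)"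
    then have B: "bool_algebra B" "of_size \<U> (carrier B)" and C: "bool_algebra C" "of_size \<U> (carrier C)"
      unfolding BA_simps by auto
    define tr' where "tr' g = (\<lambda>x\<in>carrier B. d C (g (e B x)))" for g
    have "tr' g \<in> ba_morphisms lat B C" if g: "g \<in> ba_morphisms lat (?T B) (?T C)" for g
    proof -
      have "compose (carrier B) (compose (carrier (?T B)) (restrict (d C) (e C ` carrier C)) g)
         (restrict (e B) (carrier B)) \<in> ba_morphisms lat B C"
        by (intro ba_morphisms_compose[where C = "?T B"] ba_morphisms_compose[where C = "?T C"] em dm g
            conjunct1[OF T] B C)
      moreover have "compose (carrier B) (compose (carrier (?T B)) (restrict (d C) (e C ` carrier C)) g)
         (restrict (e B) (carrier B)) = tr' g"
        using ba_morphism_funcset[OF g] unfolding tr'_def compose_def carT by (auto simp: fun_eq_iff)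
      ultimately show ?thesis by simp
    qed
    moreover have "tr' (tr B C f) = f" if "f \<in> ba_morphisms lat B C" for f
      using ba_morphism_funcset[OF that] B C
      by (auto simp: fun_eq_iff tr'_def tr_def de PiE_iff extensional_def)
    moreover have "tr B C (tr' g) = g" if "g \<in> ba_morphisms lat (?T B) (?T C)" for g
      using ba_morphism_funcset[OF that] dc ed unfolding carT
      by (auto simp: fun_eq_iff tr'_def tr_def PiE_iff extensional_def)
    ultimately show "bij_betw (on_mor T B C) (Mor (BA lat \<U>) B C) (Mor (BA lat \<U>) (on_obj T B) (on_obj T C))"
      using trm[OF B C] unfolding BA_simps T_def by (intro bij_betw_byWitness[where f' = tr']) auto
  qed
  then show thesis using that[of T] eiso unfolding T_def by auto
qed

text \<open>The algebras \<open>K(L)\<close> and \<open>Clop(X)\<close> live on larger types than \<open>'a\<close>. Transport to \<open>'a\<close> keeps a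
  functor into them fully faithful. For essential surjectivity an order isomorphism with a value of
  the functor suffices, as it preserves all operations.\<close>

lemma weak_equivalence_to_BA:
  fixes \<U> :: "'a set set" and G :: "('o, 'm, 'b gorder, 'b \<Rightarrow> 'b) functr"
  assumes G: "fully_faithful \<C> (BA lat \<U>) G"
    and es: "\<And>B :: 'a gorder. \<lbrakk>bool_algebra B; of_size \<U> (carrier B)\<rbrakk> \<Longrightarrow>
      \<exists>A\<in>Obj \<C>. \<exists>e. order_iso B (on_obj G A) e"
  obtains F where "weak_equivalence \<C> (BA lat \<U> :: ('a gorder, 'a \<Rightarrow> 'a) cat) F"
proof -
  obtain T :: "('b gorder, 'b \<Rightarrow> 'b, 'a gorder, 'a \<Rightarrow> 'a) functr" where
    T: "fully_faithful (BA lat \<U>) (BA lat \<U>) T"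
    and Tiso: "\<And>B. \<lbrakk>bool_algebra B; of_size \<U> (carrier B)\<rbrakk> \<Longrightarrow> \<exists>e. order_iso B (on_obj T B) e"
    using transport_functor[where lat = lat and \<U> = \<U>] by metis
  let ?F = "comp_functor T G"
  have ff: "fully_faithful \<C> (BA lat \<U>) ?F" by (rule fully_faithful_comp[OF G T])
  have "\<exists>A\<in>Obj \<C>. \<exists>u\<in>ba_morphisms lat (on_obj ?F A) B. \<exists>v\<in>ba_morphisms lat B (on_obj ?F A).
      compose (carrier (on_obj ?F A)) v u = (\<lambda>x\<in>carrier (on_obj ?F A). x) \<and>
      compose (carrier B) u v = (\<lambda>x\<in>carrier B. x)"
    if B: "bool_algebra B" "of_size \<U> (carrier B)" for B :: "'a gorder"
  proof -
    obtain A e where A: "A \<in> Obj \<C>" and e: "order_iso B (on_obj G A) e" using es B by blast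
    have GA: "bool_algebra (on_obj G A)" "of_size \<U> (carrier (on_obj G A))"
      using functor_obj[OF fully_faithfulD(3)[OF G] A] unfolding BA_simps by auto
    then obtain d where "order_iso (on_obj G A) (on_obj T (on_obj G A)) d" using Tiso by blast
    then have i: "order_iso B (on_obj ?F A) (d \<circ> e)"
      using e order_iso_trans unfolding comp_functor_def by fastforce
    have FA: "bool_algebra (on_obj ?F A)"
      using functor_obj[OF fully_faithfulD(3)[OF ff] A] unfolding BA_simps by auto
    define i where "i = d \<circ> e"
    have bij: "bij_betw i (carrier B) (carrier (on_obj ?F A))"
      using i unfolding order_iso_def i_def by blast
    note v = order_iso_morphism[OF B(1) FA i, of lat, folded i_def]
      and u = order_iso_morphism[OF FA B(1) order_iso_inv[OF i], of lat, folded i_def]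
    have "compose (carrier B) (restrict (inv_into (carrier B) i) (carrier (on_obj ?F A)))
        (restrict i (carrier B)) = (\<lambda>x\<in>carrier B. x)"
      using bij bij_betwE[OF bij] by (auto simp: compose_def fun_eq_iff bij_betw_def)
    moreover have "compose (carrier (on_obj ?F A)) (restrict i (carrier B))
        (restrict (inv_into (carrier B) i) (carrier (on_obj ?F A))) = (\<lambda>x\<in>carrier (on_obj ?F A). x)"
      using bij_betwE[OF bij_betw_inv_into[OF bij]] bij_betw_inv_into_right[OF bij]
      by (auto simp: compose_def fun_eq_iff)
    ultimately show ?thesis using A u v by blast
  qed
  then have "weak_equivalence \<C> (BA lat \<U>) ?F"
    using ff unfolding weak_equivalence_def by (simp add: BA_simps)
  then show thesis by (rule that)
qed

section \<open>Distributive lattices\<close>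

locale distributive_lattice = bounded_lattice L for L (structure) +
  assumes meet_join_distrib: "\<lbrakk>x \<in> carrier L; y \<in> carrier L; z \<in> carrier L\<rbrakk> \<Longrightarrow>
    x \<sqinter> (y \<squnion> z) = (x \<sqinter> y) \<squnion> (x \<sqinter> z)"
begin

lemma le_joinI1: "\<lbrakk>z \<sqsubseteq> x; x \<in> carrier L; y \<in> carrier L; z \<in> carrier L\<rbrakk> \<Longrightarrow> z \<sqsubseteq> x \<squnion> y"
  and le_joinI2: "\<lbrakk>z \<sqsubseteq> y; x \<in> carrier L; y \<in> carrier L; z \<in> carrier L\<rbrakk> \<Longrightarrow> z \<sqsubseteq> x \<squnion> y"
  and meet_leI1: "\<lbrakk>x \<sqsubseteq> z; x \<in> carrier L; y \<in> carrier L; z \<in> carrier L\<rbrakk> \<Longrightarrow> x \<sqinter> y \<sqsubseteq> z"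
  and meet_leI2: "\<lbrakk>y \<sqsubseteq> z; x \<in> carrier L; y \<in> carrier L; z \<in> carrier L\<rbrakk> \<Longrightarrow> x \<sqinter> y \<sqsubseteq> z"
  by (meson le_trans join_left join_right meet_left meet_right join_closed meet_closed)+

lemma le_bottom_eq: "\<lbrakk>x \<in> carrier L; x \<sqsubseteq> \<bottom>\<rbrakk> \<Longrightarrow> x = \<bottom>"
  by (simp add: le_antisym)

lemma top_le_eq: "\<lbrakk>x \<in> carrier L; \<top> \<sqsubseteq> x\<rbrakk> \<Longrightarrow> x = \<top>"
  by (simp add: le_antisym)

lemma join_meet_distrib:
  assumes c: "x \<in> carrier L" "y \<in> carrier L" "z \<in> carrier L"
  shows "x \<squnion> (y \<sqinter> z) = (x \<squnion> y) \<sqinter> (x \<squnion> z)"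
proof (rule le_antisym)
  show "x \<squnion> (y \<sqinter> z) \<sqsubseteq> (x \<squnion> y) \<sqinter> (x \<squnion> z)"
    by (intro join_le meet_le le_joinI1 le_refl le_joinI2 meet_left meet_right join_closed meet_closed c)
  have "(x \<squnion> y) \<sqinter> (x \<squnion> z) = ((x \<squnion> y) \<sqinter> x) \<squnion> (z \<sqinter> (x \<squnion> y))"
    using c meet_join_distrib[of "x \<squnion> y" x z] meet_comm[of L z] by simp
  also have "\<dots> = ((x \<squnion> y) \<sqinter> x) \<squnion> ((z \<sqinter> x) \<squnion> (z \<sqinter> y))"
    using c meet_join_distrib by simp
  also have "\<dots> \<sqsubseteq> x \<squnion> (y \<sqinter> z)"
  proof (intro join_le join_closed meet_closed c)
    show "(x \<squnion> y) \<sqinter> x \<sqsubseteq> x \<squnion> (y \<sqinter> z)"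
      by (intro le_joinI1 meet_leI2 le_refl join_closed meet_closed c)
    show "z \<sqinter> x \<sqsubseteq> x \<squnion> (y \<sqinter> z)"
      by (intro le_joinI1 meet_leI2 le_refl join_closed meet_closed c)
    show "z \<sqinter> y \<sqsubseteq> x \<squnion> (y \<sqinter> z)"
      using c meet_comm[of L z y] by (auto intro: le_joinI2)
  qed
  finally show "(x \<squnion> y) \<sqinter> (x \<squnion> z) \<sqsubseteq> x \<squnion> (y \<sqinter> z)" .
qed (use c in auto)

lemma complement_join:
  assumes c: "a \<in> carrier L" "a' \<in> carrier L" "b \<in> carrier L" "b' \<in> carrier L"
    and a: "a \<sqinter> a' = \<bottom>" "a \<squnion> a' = \<top>" and b: "b \<sqinter> b' = \<bottom>" "b \<squnion> b' = \<top>"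
  shows "(a \<squnion> b) \<sqinter> (a' \<sqinter> b') = \<bottom>" and "(a \<squnion> b) \<squnion> (a' \<sqinter> b') = \<top>"
proof -
  have "(a' \<sqinter> b') \<sqinter> a \<sqsubseteq> a \<sqinter> a'" "(a' \<sqinter> b') \<sqinter> b \<sqsubseteq> b \<sqinter> b'"
    using c by (simp_all add: meet_le meet_leI1[OF meet_left] meet_leI1[OF meet_right] meet_right)
  then have "((a' \<sqinter> b') \<sqinter> a) \<squnion> ((a' \<sqinter> b') \<sqinter> b) \<sqsubseteq> \<bottom>"
    using a b c by (intro join_le) auto
  then show "(a \<squnion> b) \<sqinter> (a' \<sqinter> b') = \<bottom>"
    using c meet_join_distrib[of "a' \<sqinter> b'" a b] le_bottom_eq meet_comm[of L "a \<squnion> b"] by simp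
  have "a \<squnion> a' \<sqsubseteq> (a \<squnion> b) \<squnion> a'" "b \<squnion> b' \<sqsubseteq> (a \<squnion> b) \<squnion> b'"
    using c by (simp_all add: join_le le_joinI1[OF join_left] le_joinI1[OF join_right] join_right)
  then have "\<top> \<sqsubseteq> ((a \<squnion> b) \<squnion> a') \<sqinter> ((a \<squnion> b) \<squnion> b')"
    using a b c by (intro meet_le) auto
  then show "(a \<squnion> b) \<squnion> (a' \<sqinter> b') = \<top>"
    using c join_meet_distrib[of "a \<squnion> b" a' b'] top_le_eq by simp
qed

lemma join_bottom_right: "x \<in> carrier L \<Longrightarrow> x \<squnion> \<bottom> = x"
  by (metis bottom_closed bottom_lower le_iff_meet join_comm)

lemma meet_top_right: "x \<in> carrier L \<Longrightarrow> x \<sqinter> \<top> = x"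
  by (metis top_closed top_higher le_iff_join)

end

section \<open>Stone frames and their compact elements\<close>

locale stone_frame_lattice = fixes L (structure)
  assumes stone: "stone_frame L"

sublocale stone_frame_lattice \<subseteq> complete_lattice L
  using stone unfolding stone_frame_def compact_frame_def frame_def by blast

sublocale stone_frame_lattice \<subseteq> bounded_lattice L
  by unfold_locales

context stone_frame_lattice
begin

lemma frame_distrib:
  "\<lbrakk>a \<in> carrier L; S \<subseteq> carrier L\<rbrakk> \<Longrightarrow> a \<sqinter> \<Squnion>S = \<Squnion>((\<lambda>s. a \<sqinter> s) ` S)"
  using stone unfolding stone_frame_def compact_frame_def frame_def by blast

lemma stone_meet_join_distrib:
  assumes "x \<in> carrier L" "y \<in> carrier L" "z \<in> carrier L"
  shows "x \<sqinter> (y \<squnion> z) = (x \<sqinter> y) \<squnion> (x \<sqinter> z)"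
  using frame_distrib[of x "{y, z}"] assms by (simp add: join_def)

end

sublocale stone_frame_lattice \<subseteq> distributive_lattice L
  by unfold_locales (rule stone_meet_join_distrib)

context stone_frame_lattice
begin

lemma complemented_iff:
  "a \<in> complemented_elems L \<longleftrightarrow> a \<in> carrier L \<and> (\<exists>b\<in>carrier L. a \<sqinter> b = \<bottom> \<and> a \<squnion> b = \<top>)"
proof
  assume a: "a \<in> complemented_elems L"
  then have ac: "a \<in> carrier L" "a \<squnion> pseudocomplement L a = \<top>"
    unfolding complemented_elems_def by auto
  let ?S = "{x \<in> carrier L. a \<sqinter> x = \<bottom>}"
  have "a \<sqinter> pseudocomplement L a = \<Squnion>((\<lambda>s. a \<sqinter> s) ` ?S)"
    unfolding pseudocomplement_def using frame_distrib[of a ?S] ac by auto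
  also have "\<dots> \<sqsubseteq> \<bottom>" by (rule sup_least) (auto simp: ac)
  finally have "a \<sqinter> pseudocomplement L a = \<bottom>"
    using ac by (intro le_bottom_eq) (auto simp: pseudocomplement_def intro!: meet_closed sup_closed)
  moreover have "pseudocomplement L a \<in> carrier L"
    unfolding pseudocomplement_def by (rule sup_closed) auto
  ultimately show "a \<in> carrier L \<and> (\<exists>b\<in>carrier L. a \<sqinter> b = \<bottom> \<and> a \<squnion> b = \<top>)"
    using ac by blast
next
  assume "a \<in> carrier L \<and> (\<exists>b\<in>carrier L. a \<sqinter> b = \<bottom> \<and> a \<squnion> b = \<top>)"
  then obtain b where ab: "a \<in> carrier L" "b \<in> carrier L" "a \<sqinter> b = \<bottom>" "a \<squnion> b = \<top>" by blast
  have pc: "pseudocomplement L a \<in> carrier L"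
    unfolding pseudocomplement_def by (rule sup_closed) auto
  have b_le: "b \<sqsubseteq> pseudocomplement L a"
    unfolding pseudocomplement_def by (rule sup_upper) (use ab in auto)
  have "a \<squnion> b \<sqsubseteq> a \<squnion> pseudocomplement L a"
    by (rule join_le[OF join_left le_joinI2[OF b_le]]) (use ab pc in auto)
  then show "a \<in> complemented_elems L"
    using ab(1,4) pc top_le_eq unfolding complemented_elems_def by auto
qed

lemma complemented_bottom: "\<bottom> \<in> complemented_elems L"
  unfolding complemented_iff using meet_top_right[of "\<bottom>"] join_bottom_right[of "\<top>"]
  by (auto intro!: bexI[of _ "\<top>"] simp: join_comm[of L "\<bottom>"])

lemma complemented_complement:
  assumes "a \<in> complemented_elems L"
  obtains b where "b \<in> complemented_elems L" "a \<sqinter> b = \<bottom>" "a \<squnion> b = \<top>"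
  using assms unfolding complemented_iff by (metis meet_comm join_comm)

lemma complemented_join:
  assumes "a \<in> complemented_elems L" "b \<in> complemented_elems L"
  shows "a \<squnion> b \<in> complemented_elems L"
  using assms complement_join[of a _ b] unfolding complemented_iff by (metis join_closed meet_closed)

lemma complemented_meet:
  assumes "a \<in> complemented_elems L" "b \<in> complemented_elems L"
  shows "a \<sqinter> b \<in> complemented_elems L"
proof -
  obtain a' where a: "a' \<in> complemented_elems L" "a \<sqinter> a' = \<bottom>" "a \<squnion> a' = \<top>"
    using assms(1) complemented_complement by blast
  obtain b' where b: "b' \<in> complemented_elems L" "b \<sqinter> b' = \<bottom>" "b \<squnion> b' = \<top>"
    using assms(2) complemented_complement by blast
  have c: "a \<in> carrier L" "b \<in> carrier L" "a' \<in> carrier L" "b' \<in> carrier L"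
    using assms a b complemented_iff by auto
  then have "(a' \<squnion> b') \<sqinter> (a \<sqinter> b) = \<bottom>" "(a' \<squnion> b') \<squnion> (a \<sqinter> b) = \<top>"
    using complement_join[of a' a b' b] a b by (simp_all add: meet_comm join_comm)
  then show ?thesis
    using c unfolding complemented_iff by (auto intro!: bexI[of _ "a' \<squnion> b'"] simp: meet_comm join_comm)
qed

lemma finite_sup_of_insert:
  "\<lbrakk>x \<in> carrier L; S \<subseteq> carrier L\<rbrakk> \<Longrightarrow> \<Squnion>(insert x S) = x \<squnion> \<Squnion>S"
  using weak_sup_insert eq_is_equal by simp

lemma complemented_finite_sup:
  "\<lbrakk>finite T; T \<subseteq> complemented_elems L\<rbrakk> \<Longrightarrow> \<Squnion>T \<in> complemented_elems L"
proof (induction T rule: finite_induct)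
  case empty
  then show ?case using complemented_bottom sup_of_empty by simp
next
  case (insert x T)
  then have "x \<in> carrier L" "T \<subseteq> carrier L" using complemented_iff by auto
  then show ?case using insert finite_sup_of_insert complemented_join by simp
qed

lemma compact_carrier: "k \<in> compact_elems L \<Longrightarrow> k \<in> carrier L"
  unfolding compact_elems_def by blast

lemma compactE:
  assumes "k \<in> compact_elems L" "S \<subseteq> carrier L" "k \<sqsubseteq> \<Squnion>S"
  obtains T where "T \<subseteq> S" "finite T" "k \<sqsubseteq> \<Squnion>T"
  using assms unfolding compact_elems_def by blast

text \<open>If \<open>b\<close> is a complement of \<open>a\<close>, a cover of \<open>a\<close> together with \<open>b\<close> covers the compact top; the
  finite subcover covers \<open>a\<close> without the help of \<open>b\<close>. Conversely, in a zero-dimensional frame a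
  compact element is a finite join of complemented ones.\<close>

lemma compact_eq_complemented: "compact_elems L = complemented_elems L"
proof (intro equalityI subsetI)
  fix k assume k: "k \<in> compact_elems L"
  obtain S where S: "S \<subseteq> complemented_elems L" "k = \<Squnion>S"
    using stone compact_carrier[OF k] unfolding stone_frame_def zero_dim_frame_def by blast
  have Sc: "S \<subseteq> carrier L" using S complemented_iff by auto
  obtain T where T: "T \<subseteq> S" "finite T" "k \<sqsubseteq> \<Squnion>T"
    using k Sc S(2) le_refl[OF compact_carrier[OF k]] by (metis compactE)
  have Tc: "T \<subseteq> carrier L" using T Sc by blast
  have "\<Squnion>T \<sqsubseteq> k" unfolding S(2) using T Sc by (intro sup_least sup_closed sup_upper) auto
  then have "k = \<Squnion>T" using T(3) compact_carrier[OF k] Tc by (intro le_antisym) auto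
  then show "k \<in> complemented_elems L" using complemented_finite_sup T S by blast
next
  fix a assume a: "a \<in> complemented_elems L"
  then obtain b where b: "b \<in> carrier L" "a \<sqinter> b = \<bottom>" "a \<squnion> b = \<top>" and ac: "a \<in> carrier L"
    unfolding complemented_iff by blast
  have "\<exists>T\<subseteq>S. finite T \<and> a \<sqsubseteq> \<Squnion>T" if S: "S \<subseteq> carrier L" "a \<sqsubseteq> \<Squnion>S" for S
  proof -
    have bS: "insert b S \<subseteq> carrier L" using b S by auto
    have "\<top> \<sqsubseteq> \<Squnion>(insert b S)"
      unfolding b(3)[symmetric] finite_sup_of_insert[OF b(1) S(1)]
      using ac b(1) S by (auto intro!: join_le intro: le_joinI1 le_joinI2)
    moreover have "\<top> \<in> compact_elems L" using stone unfolding stone_frame_def compact_frame_def by blast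
    ultimately obtain T where T: "T \<subseteq> insert b S" "finite T" "\<top> \<sqsubseteq> \<Squnion>T" using bS compactE by metis
    let ?T = "T - {b}"
    have Tc: "T \<subseteq> carrier L" "?T \<subseteq> carrier L" using T bS by auto
    have "a = a \<sqinter> \<Squnion>T" using top_le_eq[OF sup_closed[OF Tc(1)] T(3)] meet_top_right[OF ac] by simp
    also have "\<dots> = \<Squnion>((\<lambda>s. a \<sqinter> s) ` T)" using frame_distrib ac Tc by blast
    also have "\<dots> \<sqsubseteq> \<Squnion>?T"
    proof (rule sup_least)
      show "(\<lambda>s. a \<sqinter> s) ` T \<subseteq> carrier L" using ac Tc by auto
      fix x assume "x \<in> (\<lambda>s. a \<sqinter> s) ` T"
      then obtain s where s: "s \<in> T" "x = a \<sqinter> s" by blast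
      show "x \<sqsubseteq> \<Squnion>?T"
      proof (cases "s = b")
        case True
        then show ?thesis using b s Tc by simp
      next
        case False
        then have "s \<sqsubseteq> \<Squnion>?T" using s Tc by (intro sup_upper) auto
        then show ?thesis using s ac Tc by (auto intro!: meet_leI2)
      qed
    qed (use Tc in auto)
    finally show ?thesis using T by (intro exI[of _ ?T]) auto
  qed
  then show "a \<in> compact_elems L" using ac unfolding compact_elems_def by blast
qed

lemma compact_bottom: "\<bottom> \<in> compact_elems L" and compact_top: "\<top> \<in> compact_elems L"
  and compact_join: "\<And>a b. \<lbrakk>a \<in> compact_elems L; b \<in> compact_elems L\<rbrakk> \<Longrightarrow> a \<squnion> b \<in> compact_elems L"
  and compact_meet: "\<And>a b. \<lbrakk>a \<in> compact_elems L; b \<in> compact_elems L\<rbrakk> \<Longrightarrow> a \<sqinter> b \<in> compact_elems L"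
  using stone complemented_bottom complemented_join complemented_meet
  unfolding compact_eq_complemented[symmetric] stone_frame_def compact_frame_def by blast+

lemma sup_compacts_below:
  assumes a: "a \<in> carrier L"
  shows "\<Squnion>{k \<in> compact_elems L. k \<sqsubseteq> a} = a"
proof (rule sup_eqI[OF partial_order_axioms])
  obtain S where S: "S \<subseteq> complemented_elems L" "a = \<Squnion>S"
    using stone a unfolding stone_frame_def zero_dim_frame_def by blast
  have Sc: "S \<subseteq> carrier L" using S complemented_iff by auto
  fix u assume u: "u \<in> carrier L" "\<And>k. k \<in> {k \<in> compact_elems L. k \<sqsubseteq> a} \<Longrightarrow> k \<sqsubseteq> u"
  have "s \<sqsubseteq> a" if "s \<in> S" for s using S Sc that sup_upper by blast
  then show "a \<sqsubseteq> u"
    unfolding S(2) using u Sc S by (intro sup_least) (auto simp: compact_eq_complemented)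
qed (use a compact_carrier in auto)

end

text \<open>A morphism of Stone frames preserves joins of compact elements, whereas the morphisms of
  boolean algebras preserve meets. So the order of the compact elements is reversed.\<close>

definition compacts_dual :: "'b gorder \<Rightarrow> 'b gorder" where
  "compacts_dual L = \<lparr>carrier = compact_elems L, eq = (=), le = (\<lambda>x y. y \<sqsubseteq>\<^bsub>L\<^esub> x)\<rparr>"

lemma compacts_dual_simps:
  "carrier (compacts_dual L) = compact_elems L"
  "x \<sqsubseteq>\<^bsub>compacts_dual L\<^esub> y \<longleftrightarrow> y \<sqsubseteq>\<^bsub>L\<^esub> x"
  unfolding compacts_dual_def by simp_all

lemma
  assumes L: "stone_frame L"
  shows bool_algebra_compacts_dual: "bool_algebra (compacts_dual L)"
    and meet_compacts_dual: "\<And>x y. \<lbrakk>x \<in> compact_elems L; y \<in> compact_elems L\<rbrakk> \<Longrightarrow>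
      x \<sqinter>\<^bsub>compacts_dual L\<^esub> y = x \<squnion>\<^bsub>L\<^esub> y"
    and join_compacts_dual: "\<And>x y. \<lbrakk>x \<in> compact_elems L; y \<in> compact_elems L\<rbrakk> \<Longrightarrow>
      x \<squnion>\<^bsub>compacts_dual L\<^esub> y = x \<sqinter>\<^bsub>L\<^esub> y"
    and top_compacts_dual: "\<top>\<^bsub>compacts_dual L\<^esub> = \<bottom>\<^bsub>L\<^esub>"
proof -
  interpret stone_frame_lattice L by unfold_locales (rule L)
  note K = compact_carrier
  have po: "partial_order (compacts_dual L)"
  proof (rule partial_orderI)
    show "eq (compacts_dual L) = (=)" by (simp add: compacts_dual_def)
  qed (auto simp: compacts_dual_simps intro: le_antisym le_trans K)
  have compl: "\<exists>y\<in>compact_elems L. x \<squnion>\<^bsub>L\<^esub> y = \<top>\<^bsub>L\<^esub> \<and> x \<sqinter>\<^bsub>L\<^esub> y = \<bottom>\<^bsub>L\<^esub>" if "x \<in> compact_elems L" for x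
    using that unfolding compact_eq_complemented by (metis complemented_complement)
  note ba = bool_algebraI[of "compacts_dual L" "\<lambda>x y. x \<squnion>\<^bsub>L\<^esub> y" "\<lambda>x y. x \<sqinter>\<^bsub>L\<^esub> y" "\<top>\<^bsub>L\<^esub>" "\<bottom>\<^bsub>L\<^esub>", OF po]
  show "bool_algebra (compacts_dual L)"
    by (rule ba) (auto simp: compacts_dual_simps compl join_meet_distrib K compact_join compact_meet
        compact_top compact_bottom intro: join_left join_right meet_left meet_right join_le meet_le)
  show "x \<sqinter>\<^bsub>compacts_dual L\<^esub> y = x \<squnion>\<^bsub>L\<^esub> y" if "x \<in> compact_elems L" "y \<in> compact_elems L" for x y
    by (rule ba) (use that in \<open>auto simp: compacts_dual_simps compl join_meet_distrib K compact_join compact_meet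
        compact_top compact_bottom intro: join_left join_right meet_left meet_right join_le meet_le\<close>)
  show "x \<squnion>\<^bsub>compacts_dual L\<^esub> y = x \<sqinter>\<^bsub>L\<^esub> y" if "x \<in> compact_elems L" "y \<in> compact_elems L" for x y
    by (rule ba) (use that in \<open>auto simp: compacts_dual_simps compl join_meet_distrib K compact_join compact_meet
        compact_top compact_bottom intro: join_left join_right meet_left meet_right join_le meet_le\<close>)
  show "\<top>\<^bsub>compacts_dual L\<^esub> = \<bottom>\<^bsub>L\<^esub>"
    by (rule ba) (auto simp: compacts_dual_simps compl join_meet_distrib K compact_join compact_meet
        compact_top compact_bottom intro: join_left join_right meet_left meet_right join_le meet_le)
qed

section \<open>Morphisms of Stone frames as morphisms of boolean algebras\<close>

definition frame_morphisms :: "bool \<Rightarrow> 'b gorder \<Rightarrow> 'c gorder \<Rightarrow> ('b \<Rightarrow> 'c) set" where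
  "frame_morphisms lat L M = (if lat then finf_morphisms L M else sup_morphisms L M)"

definition StoneFrm :: "bool \<Rightarrow> 'a set set \<Rightarrow> ('a set gorder, 'a set \<Rightarrow> 'a set) cat" where
  "StoneFrm lat \<U> = \<lparr>Obj = {L. stone_frame L \<and> of_size \<U> (compact_elems L)},
     Mor = frame_morphisms lat, Ident = (\<lambda>L. \<lambda>x\<in>carrier L. x),
     Cmp = (\<lambda>L M N \<beta> \<alpha>. compose (carrier L) \<beta> \<alpha>)\<rparr>"

lemma StoneFrm_simps:
  "L \<in> Obj (StoneFrm lat \<U>) \<longleftrightarrow> stone_frame L \<and> of_size \<U> (compact_elems L)"
  "Mor (StoneFrm lat \<U>) = frame_morphisms lat"
  "Ident (StoneFrm lat \<U>) L = (\<lambda>x\<in>carrier L. x)"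
  "Cmp (StoneFrm lat \<U>) L M N \<beta> \<alpha> = compose (carrier L) \<beta> \<alpha>"
  unfolding StoneFrm_def by simp_all

lemma StoneFrm_Sup_eq: "StoneFrm_Sup \<U> = StoneFrm False \<U>"
  and StoneFrm_FInf_eq: "StoneFrm_FInf \<U> = StoneFrm True \<U>"
  unfolding StoneFrm_Sup_def StoneFrm_FInf_def StoneFrm_def frame_morphisms_def by simp_all

lemma frame_morphismD:
  assumes "\<alpha> \<in> frame_morphisms lat L M"
  shows "\<alpha> \<in> carrier L \<rightarrow>\<^sub>E carrier M"
    and "\<And>S. S \<subseteq> carrier L \<Longrightarrow> \<alpha> (\<Squnion>\<^bsub>L\<^esub>S) = \<Squnion>\<^bsub>M\<^esub>(\<alpha> ` S)"
    and "\<And>k. k \<in> compact_elems L \<Longrightarrow> \<alpha> k \<in> compact_elems M"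
  using assms unfolding frame_morphisms_def finf_morphisms_def sup_morphisms_def
  by (auto split: if_splits)

text \<open>In a Stone frame finite meets of compact elements are compact, so the condition on
  \<open>finf_morphisms\<close> applies to every nonempty finite set of them and reduces to binary meets.\<close>

lemma frame_morphisms_iff:
  assumes L: "stone_frame L" and M: "stone_frame M"
  shows "\<alpha> \<in> frame_morphisms lat L M \<longleftrightarrow> \<alpha> \<in> sup_morphisms L M \<and>
    (lat \<longrightarrow> (\<forall>x\<in>compact_elems L. \<forall>y\<in>compact_elems L. \<alpha> (x \<sqinter>\<^bsub>L\<^esub> y) = \<alpha> x \<sqinter>\<^bsub>M\<^esub> \<alpha> y))"
proof (cases lat)
  case True
  interpret L: stone_frame_lattice L by unfold_locales (rule L)
  interpret M: stone_frame_lattice M by unfold_locales (rule M)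
  have fwd: "\<alpha> \<in> finf_morphisms L M" if \<alpha>: "\<alpha> \<in> sup_morphisms L M"
    and m: "\<forall>x\<in>compact_elems L. \<forall>y\<in>compact_elems L. \<alpha> (x \<sqinter>\<^bsub>L\<^esub> y) = \<alpha> x \<sqinter>\<^bsub>M\<^esub> \<alpha> y"
  proof -
    have \<alpha>c: "\<And>x. x \<in> carrier L \<Longrightarrow> \<alpha> x \<in> carrier M" using \<alpha> unfolding sup_morphisms_def by auto
    have "\<alpha> (\<Sqinter>\<^bsub>L\<^esub>S) = \<Sqinter>\<^bsub>M\<^esub>(\<alpha> ` S) \<and> \<Sqinter>\<^bsub>L\<^esub>S \<in> compact_elems L"
      if "finite S" "S \<noteq> {}" "S \<subseteq> compact_elems L" for S
      using that
    proof (induction S rule: finite_ne_induct)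
      case (singleton x)
      then show ?case using \<alpha>c L.compact_carrier by simp
    next
      case (insert x S)
      then have S: "S \<subseteq> carrier L" "\<alpha> ` S \<subseteq> carrier M" and x: "x \<in> carrier L"
        using \<alpha>c L.compact_carrier by auto
      then show ?case
        using insert m \<alpha>c L.inf_of_insert M.inf_of_insert L.compact_meet by auto
    qed
    then show ?thesis using \<alpha> unfolding finf_morphisms_def by blast
  qed
  have bwd: "\<alpha> (x \<sqinter>\<^bsub>L\<^esub> y) = \<alpha> x \<sqinter>\<^bsub>M\<^esub> \<alpha> y"
    if "\<alpha> \<in> finf_morphisms L M" "x \<in> compact_elems L" "y \<in> compact_elems L" for x y
  proof -
    have "\<Sqinter>\<^bsub>L\<^esub>{x, y} \<in> compact_elems L" using L.compact_meet that unfolding meet_def by blast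
    moreover have "\<forall>S. S \<noteq> {} \<and> finite S \<and> S \<subseteq> compact_elems L \<and> \<Sqinter>\<^bsub>L\<^esub>S \<in> compact_elems L \<longrightarrow>
        \<alpha> (\<Sqinter>\<^bsub>L\<^esub>S) = \<Sqinter>\<^bsub>M\<^esub>(\<alpha> ` S)"
      using that(1) unfolding finf_morphisms_def by simp
    ultimately have "\<alpha> (\<Sqinter>\<^bsub>L\<^esub>{x, y}) = \<Sqinter>\<^bsub>M\<^esub>(\<alpha> ` {x, y})"
      using that(2,3) by simp
    then show ?thesis unfolding meet_def by simp
  qed
  have "\<alpha> \<in> finf_morphisms L M \<longleftrightarrow> \<alpha> \<in> sup_morphisms L M \<and>
    (\<forall>x\<in>compact_elems L. \<forall>y\<in>compact_elems L. \<alpha> (x \<sqinter>\<^bsub>L\<^esub> y) = \<alpha> x \<sqinter>\<^bsub>M\<^esub> \<alpha> y)"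
  proof
    assume "\<alpha> \<in> finf_morphisms L M"
    then show "\<alpha> \<in> sup_morphisms L M \<and>
      (\<forall>x\<in>compact_elems L. \<forall>y\<in>compact_elems L. \<alpha> (x \<sqinter>\<^bsub>L\<^esub> y) = \<alpha> x \<sqinter>\<^bsub>M\<^esub> \<alpha> y)"
      by (intro conjI ballI bwd) (simp add: finf_morphisms_def)
  qed (elim conjE, rule fwd)
  then show ?thesis using True by (simp add: frame_morphisms_def)
qed (simp add: frame_morphisms_def)

lemma frame_morphisms_compose:
  assumes L: "stone_frame L" and M: "stone_frame M" and N: "stone_frame N"
    and \<alpha>: "\<alpha> \<in> frame_morphisms lat L M" and \<beta>: "\<beta> \<in> frame_morphisms lat M N"
  shows "compose (carrier L) \<beta> \<alpha> \<in> frame_morphisms lat L N"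
proof -
  interpret L: stone_frame_lattice L by unfold_locales (rule L)
  note a = frame_morphismD[OF \<alpha>] and b = frame_morphismD[OF \<beta>]
  have ac: "\<And>x. x \<in> carrier L \<Longrightarrow> \<alpha> x \<in> carrier M" using a(1) by auto
  have "compose (carrier L) \<beta> \<alpha> (\<Squnion>\<^bsub>L\<^esub>S) = \<Squnion>\<^bsub>N\<^esub>(compose (carrier L) \<beta> \<alpha> ` S)" if S: "S \<subseteq> carrier L" for S
  proof -
    have "compose (carrier L) \<beta> \<alpha> ` S = \<beta> ` \<alpha> ` S"
      using S by (auto simp: compose_def image_image)
    moreover have "\<alpha> ` S \<subseteq> carrier M" using S ac by auto
    ultimately show ?thesis using S a(2) b(2) by (simp add: compose_def)
  qed
  then have "compose (carrier L) \<beta> \<alpha> \<in> sup_morphisms L N"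
    using a b L.compact_carrier unfolding sup_morphisms_def by (auto simp: compose_def)
  moreover have "lat \<longrightarrow> (\<forall>x\<in>compact_elems L. \<forall>y\<in>compact_elems L.
      compose (carrier L) \<beta> \<alpha> (x \<sqinter>\<^bsub>L\<^esub> y) = compose (carrier L) \<beta> \<alpha> x \<sqinter>\<^bsub>N\<^esub> compose (carrier L) \<beta> \<alpha> y)"
    using \<alpha> \<beta> a(3) L.compact_carrier
    unfolding frame_morphisms_iff[OF L M] frame_morphisms_iff[OF M N] by (simp add: compose_def)
  ultimately show ?thesis unfolding frame_morphisms_iff[OF L N] by blast
qed

lemma frame_morphisms_ident:
  assumes L: "stone_frame L"
  shows "(\<lambda>x\<in>carrier L. x) \<in> frame_morphisms lat L L"
proof -
  interpret L: stone_frame_lattice L by unfold_locales (rule L)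
  have "(\<lambda>x\<in>carrier L. x) ` S = S" if "S \<subseteq> carrier L" for S using that by auto
  then show ?thesis
    unfolding frame_morphisms_iff[OF L L] sup_morphisms_def using L.compact_carrier by auto
qed

lemma is_category_StoneFrm: "is_category (StoneFrm lat \<U>)"
  unfolding is_category_def
proof (intro conjI ballI)
  fix L M N :: "'a set gorder" and \<alpha> \<beta>
  assume "L \<in> Obj (StoneFrm lat \<U>)" "M \<in> Obj (StoneFrm lat \<U>)" "N \<in> Obj (StoneFrm lat \<U>)"
    "\<alpha> \<in> Mor (StoneFrm lat \<U>) L M" "\<beta> \<in> Mor (StoneFrm lat \<U>) M N"
  then show "Cmp (StoneFrm lat \<U>) L M N \<beta> \<alpha> \<in> Mor (StoneFrm lat \<U>) L N"
    unfolding StoneFrm_simps using frame_morphisms_compose by blast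
qed (auto intro!: frame_morphisms_ident compose_ident_left compose_ident_right
      compose_compose dest: frame_morphismD(1) simp: StoneFrm_simps)

text \<open>The forced definition \<open>\<alpha> a = \<Squnion>{h k | k compact, k \<le> a}\<close> preserves joins: a compact
  element below a join lies below the join of finitely many compact elements that are below members
  of the family, and \<open>h\<close> preserves finite joins.\<close>

lemma extend_to_frame_morphism:
  assumes L: "stone_frame L" and M: "stone_frame M"
    and h: "h \<in> ba_morphisms lat (compacts_dual L) (compacts_dual M)"
  obtains \<alpha> where "\<alpha> \<in> frame_morphisms lat L M" "restrict \<alpha> (compact_elems L) = h"
proof -
  interpret L: stone_frame_lattice L by unfold_locales (rule L)
  interpret M: stone_frame_lattice M by unfold_locales (rule M)
  let ?K = "compact_elems L"
  have "h \<in> ?K \<rightarrow>\<^sub>E compact_elems M" and hbot: "h \<bottom>\<^bsub>L\<^esub> = \<bottom>\<^bsub>M\<^esub>"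
    and "\<forall>x\<in>?K. \<forall>y\<in>?K. h (x \<sqinter>\<^bsub>compacts_dual L\<^esub> y) = h x \<sqinter>\<^bsub>compacts_dual M\<^esub> h y"
    and "lat \<longrightarrow> (\<forall>x\<in>?K. \<forall>y\<in>?K. h (x \<squnion>\<^bsub>compacts_dual L\<^esub> y) = h x \<squnion>\<^bsub>compacts_dual M\<^esub> h y)"
    using h unfolding ba_morphisms_iff[OF bool_algebra_compacts_dual[OF L] bool_algebra_compacts_dual[OF M]]
      compacts_dual_simps top_compacts_dual[OF L] top_compacts_dual[OF M] by blast+
  then have hE: "h \<in> ?K \<rightarrow>\<^sub>E compact_elems M" and hK: "\<And>k. k \<in> ?K \<Longrightarrow> h k \<in> compact_elems M"
    and hj: "\<And>x y. \<lbrakk>x \<in> ?K; y \<in> ?K\<rbrakk> \<Longrightarrow> h (x \<squnion>\<^bsub>L\<^esub> y) = h x \<squnion>\<^bsub>M\<^esub> h y"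
    and hm: "\<And>x y. \<lbrakk>lat; x \<in> ?K; y \<in> ?K\<rbrakk> \<Longrightarrow> h (x \<sqinter>\<^bsub>L\<^esub> y) = h x \<sqinter>\<^bsub>M\<^esub> h y"
    by (auto simp: meet_compacts_dual[OF L] join_compacts_dual[OF L] meet_compacts_dual[OF M]
        join_compacts_dual[OF M] PiE_iff)
  have hc: "\<And>k. k \<in> ?K \<Longrightarrow> h k \<in> carrier M" using hK M.compact_carrier by blast
  have mono: "h x \<sqsubseteq>\<^bsub>M\<^esub> h y" if "x \<in> ?K" "y \<in> ?K" "x \<sqsubseteq>\<^bsub>L\<^esub> y" for x y
    using hj[OF that(1,2)] that L.le_iff_meet M.le_iff_meet hc L.compact_carrier by metis
  have hsup: "h (\<Squnion>\<^bsub>L\<^esub>T) = \<Squnion>\<^bsub>M\<^esub>(h ` T) \<and> \<Squnion>\<^bsub>L\<^esub>T \<in> ?K" if "finite T" "T \<subseteq> ?K" for T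
    using that
  proof (induction T rule: finite_induct)
    case empty
    then show ?case using hbot L.sup_of_empty M.sup_of_empty L.compact_bottom by simp
  next
    case (insert x T)
    then have "T \<subseteq> carrier L" "h ` T \<subseteq> carrier M" "x \<in> carrier L" "h x \<in> carrier M"
      using hc L.compact_carrier by auto
    then show ?case
      using insert hj L.finite_sup_of_insert M.finite_sup_of_insert L.compact_join by auto
  qed
  let ?b = "\<lambda>a. {k \<in> ?K. k \<sqsubseteq>\<^bsub>L\<^esub> a}"
  have bc: "h ` ?b a \<subseteq> carrier M" for a using hc by auto
  define \<alpha> where "\<alpha> = (\<lambda>a\<in>carrier L. \<Squnion>\<^bsub>M\<^esub>(h ` ?b a))"
  have \<alpha>: "\<alpha> a = \<Squnion>\<^bsub>M\<^esub>(h ` ?b a)" if "a \<in> carrier L" for a using that by (simp add: \<alpha>_def)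
  have \<alpha>c: "\<alpha> a \<in> carrier M" if "a \<in> carrier L" for a unfolding \<alpha>[OF that] by (rule M.sup_closed[OF bc])
  have \<alpha>K: "\<alpha> k = h k" if k: "k \<in> ?K" for k
    unfolding \<alpha>[OF L.compact_carrier[OF k]]
    by (rule sup_eqI[OF M.partial_order_axioms bc]) (use k hc mono L.compact_carrier in auto)
  have \<alpha>mono: "\<alpha> a \<sqsubseteq>\<^bsub>M\<^esub> \<alpha> b" if "a \<in> carrier L" "b \<in> carrier L" "a \<sqsubseteq>\<^bsub>L\<^esub> b" for a b
    unfolding \<alpha>[OF that(1)] \<alpha>[OF that(2)]
  proof (rule M.sup_least[OF bc])
    fix x assume "x \<in> h ` ?b a"
    then show "x \<sqsubseteq>\<^bsub>M\<^esub> \<Squnion>\<^bsub>M\<^esub>(h ` ?b b)"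
      using that L.compact_carrier by (intro M.sup_upper[OF bc]) (auto intro: L.le_trans)
  qed (rule M.sup_closed[OF bc])
  have "\<alpha> (\<Squnion>\<^bsub>L\<^esub>S) = \<Squnion>\<^bsub>M\<^esub>(\<alpha> ` S)" if S: "S \<subseteq> carrier L" for S
  proof (rule M.le_antisym)
    have \<alpha>S: "\<alpha> ` S \<subseteq> carrier M" using S \<alpha>c by auto
    show cl: "\<alpha> (\<Squnion>\<^bsub>L\<^esub>S) \<in> carrier M" "\<Squnion>\<^bsub>M\<^esub>(\<alpha> ` S) \<in> carrier M"
      using S \<alpha>S \<alpha>c by auto
    show "\<Squnion>\<^bsub>M\<^esub>(\<alpha> ` S) \<sqsubseteq>\<^bsub>M\<^esub> \<alpha> (\<Squnion>\<^bsub>L\<^esub>S)"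
      using S cl L.sup_upper by (intro M.sup_least[OF \<alpha>S]) (auto intro!: \<alpha>mono)
    show "\<alpha> (\<Squnion>\<^bsub>L\<^esub>S) \<sqsubseteq>\<^bsub>M\<^esub> \<Squnion>\<^bsub>M\<^esub>(\<alpha> ` S)"
      unfolding \<alpha>[OF L.sup_closed[OF S]]
    proof (rule M.sup_least[OF bc cl(2)])
      fix x assume "x \<in> h ` ?b (\<Squnion>\<^bsub>L\<^esub>S)"
      then obtain k where k: "k \<in> ?K" "k \<sqsubseteq>\<^bsub>L\<^esub> \<Squnion>\<^bsub>L\<^esub>S" "x = h k" by blast
      let ?S = "{k \<in> ?K. \<exists>s\<in>S. k \<sqsubseteq>\<^bsub>L\<^esub> s}"
      have S': "?S \<subseteq> carrier L" using L.compact_carrier by auto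
      have "s \<sqsubseteq>\<^bsub>L\<^esub> \<Squnion>\<^bsub>L\<^esub>?S" if s: "s \<in> S" for s
      proof -
        have "\<Squnion>\<^bsub>L\<^esub>(?b s) \<sqsubseteq>\<^bsub>L\<^esub> \<Squnion>\<^bsub>L\<^esub>?S"
          using S' s L.compact_carrier by (intro L.sup_least L.sup_closed L.sup_upper[OF S']) auto
        then show ?thesis using L.sup_compacts_below s S by auto
      qed
      then have "\<Squnion>\<^bsub>L\<^esub>S \<sqsubseteq>\<^bsub>L\<^esub> \<Squnion>\<^bsub>L\<^esub>?S" using S S' by (intro L.sup_least L.sup_closed) auto
      then have "k \<sqsubseteq>\<^bsub>L\<^esub> \<Squnion>\<^bsub>L\<^esub>?S"
        using k L.compact_carrier[OF k(1)] S S' L.le_trans[of k "\<Squnion>\<^bsub>L\<^esub>S" "\<Squnion>\<^bsub>L\<^esub>?S"] by auto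
      then obtain T where T: "T \<subseteq> ?S" "finite T" "k \<sqsubseteq>\<^bsub>L\<^esub> \<Squnion>\<^bsub>L\<^esub>T"
        using L.compactE[OF k(1) S'] by blast
      have TK: "T \<subseteq> ?K" and hT: "h ` T \<subseteq> carrier M" using T hc by auto
      have "h k \<sqsubseteq>\<^bsub>M\<^esub> \<Squnion>\<^bsub>M\<^esub>(h ` T)" using mono[OF k(1) _ T(3)] hsup[OF T(2) TK] by simp
      moreover have "\<Squnion>\<^bsub>M\<^esub>(h ` T) \<sqsubseteq>\<^bsub>M\<^esub> \<Squnion>\<^bsub>M\<^esub>(\<alpha> ` S)"
      proof (rule M.sup_least[OF hT cl(2)])
        fix y assume "y \<in> h ` T"
        then obtain t s where t: "t \<in> ?K" "y = h t" "s \<in> S" "t \<sqsubseteq>\<^bsub>L\<^esub> s" using T by blast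
        then have "y \<sqsubseteq>\<^bsub>M\<^esub> \<alpha> s" "\<alpha> s \<sqsubseteq>\<^bsub>M\<^esub> \<Squnion>\<^bsub>M\<^esub>(\<alpha> ` S)"
          using \<alpha>K[OF t(1)] \<alpha>mono[OF L.compact_carrier[OF t(1)], of s] S M.sup_upper[OF \<alpha>S] by auto
        then show "y \<sqsubseteq>\<^bsub>M\<^esub> \<Squnion>\<^bsub>M\<^esub>(\<alpha> ` S)"
          using M.le_trans[of y "\<alpha> s" "\<Squnion>\<^bsub>M\<^esub>(\<alpha> ` S)"] t hc \<alpha>S cl by auto
      qed
      ultimately show "x \<sqsubseteq>\<^bsub>M\<^esub> \<Squnion>\<^bsub>M\<^esub>(\<alpha> ` S)"
        using M.le_trans[of x "\<Squnion>\<^bsub>M\<^esub>(h ` T)" "\<Squnion>\<^bsub>M\<^esub>(\<alpha> ` S)"] k hc hT cl by auto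
    qed
  qed
  then have "\<alpha> \<in> sup_morphisms L M"
    using \<alpha>c \<alpha>K hK unfolding sup_morphisms_def by (auto simp: \<alpha>_def)
  then have "\<alpha> \<in> frame_morphisms lat L M"
    unfolding frame_morphisms_iff[OF L M] using \<alpha>K hm L.compact_meet by auto
  moreover have "restrict \<alpha> ?K = h"
    using \<alpha>K hE by (auto simp: fun_eq_iff PiE_iff extensional_def)
  ultimately show thesis by (rule that)
qed

lemma restrict_frame_morphism:
  assumes L: "stone_frame L" and M: "stone_frame M" and \<alpha>: "\<alpha> \<in> frame_morphisms lat L M"
  shows "restrict \<alpha> (compact_elems L) \<in> ba_morphisms lat (compacts_dual L) (compacts_dual M)"
proof -
  interpret L: stone_frame_lattice L by unfold_locales (rule L)
  interpret M: stone_frame_lattice M by unfold_locales (rule M)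
  note a = frame_morphismD[OF \<alpha>]
  have "\<alpha> \<bottom>\<^bsub>L\<^esub> = \<bottom>\<^bsub>M\<^esub>" using a(2)[of "{}"] L.sup_of_empty M.sup_of_empty by simp
  moreover have "\<alpha> (x \<squnion>\<^bsub>L\<^esub> y) = \<alpha> x \<squnion>\<^bsub>M\<^esub> \<alpha> y" if "x \<in> carrier L" "y \<in> carrier L" for x y
    using a(2)[of "{x, y}"] that unfolding join_def by simp
  moreover have "\<alpha> (x \<sqinter>\<^bsub>L\<^esub> y) = \<alpha> x \<sqinter>\<^bsub>M\<^esub> \<alpha> y" if "lat" "x \<in> compact_elems L" "y \<in> compact_elems L" for x y
    using \<alpha> that unfolding frame_morphisms_iff[OF L M] by blast
  ultimately show ?thesis
    unfolding ba_morphisms_iff[OF bool_algebra_compacts_dual[OF L] bool_algebra_compacts_dual[OF M]]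
      compacts_dual_simps top_compacts_dual[OF L] top_compacts_dual[OF M]
    using a(3) L.compact_carrier L.compact_join L.compact_meet L.compact_bottom
    by (auto simp: meet_compacts_dual[OF L] join_compacts_dual[OF L] meet_compacts_dual[OF M]
        join_compacts_dual[OF M])
qed

lemma frame_morphism_determined:
  assumes L: "stone_frame L" and \<alpha>: "\<alpha> \<in> frame_morphisms lat L M" and \<beta>: "\<beta> \<in> frame_morphisms lat L M"
    and eq: "restrict \<alpha> (compact_elems L) = restrict \<beta> (compact_elems L)"
  shows "\<alpha> = \<beta>"
proof
  interpret L: stone_frame_lattice L by unfold_locales (rule L)
  fix a
  show "\<alpha> a = \<beta> a"
  proof (cases "a \<in> carrier L")
    case True
    let ?S = "{k \<in> compact_elems L. k \<sqsubseteq>\<^bsub>L\<^esub> a}"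
    have "\<alpha> ` ?S = \<beta> ` ?S" using eq by (intro image_cong refl) (metis (no_types, lifting) mem_Collect_eq restrict_apply')
    moreover have "?S \<subseteq> carrier L" using L.compact_carrier by auto
    ultimately show ?thesis
      using frame_morphismD(2)[OF \<alpha>, of ?S] frame_morphismD(2)[OF \<beta>, of ?S] L.sup_compacts_below[OF True]
      by simp
  next
    case False
    then show ?thesis using frame_morphismD(1)[OF \<alpha>] frame_morphismD(1)[OF \<beta>] by (simp add: PiE_iff extensional_def)
  qed
qed

definition compacts_functor ::
  "('a set gorder, 'a set \<Rightarrow> 'a set, 'a set gorder, 'a set \<Rightarrow> 'a set) functr" where
  "compacts_functor = \<lparr>on_obj = compacts_dual, on_mor = (\<lambda>L M \<alpha>. restrict \<alpha> (compact_elems L))\<rparr>"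

lemma fully_faithful_compacts_functor:
  fixes \<U> :: "'a set set"
  shows "fully_faithful (StoneFrm lat \<U>) (BA lat \<U>) compacts_functor"
  unfolding fully_faithful_def
proof (intro conjI ballI is_category_StoneFrm is_category_BA)
  show "is_functor (StoneFrm lat \<U>) (BA lat \<U>) compacts_functor"
    unfolding is_functor_def
  proof (intro conjI ballI)
    fix L :: "'a set gorder" assume "L \<in> Obj (StoneFrm lat \<U>)"
    then have L: "stone_frame L" and s: "of_size \<U> (compact_elems L)" unfolding StoneFrm_simps by auto
    interpret L: stone_frame_lattice L by unfold_locales (rule L)
    show "on_obj compacts_functor L \<in> Obj (BA lat \<U>)"
      unfolding BA_simps compacts_functor_def using bool_algebra_compacts_dual[OF L] s
      by (simp add: compacts_dual_simps)
    show "on_mor compacts_functor L L (Ident (StoneFrm lat \<U>) L) = Ident (BA lat \<U>) (on_obj compacts_functor L)"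
      using L.compact_carrier by (auto simp: BA_simps StoneFrm_simps compacts_functor_def compacts_dual_simps fun_eq_iff)
    fix M :: "'a set gorder" and \<alpha> assume "M \<in> Obj (StoneFrm lat \<U>)" and "\<alpha> \<in> Mor (StoneFrm lat \<U>) L M"
    then have M: "stone_frame M" and \<alpha>: "\<alpha> \<in> frame_morphisms lat L M" unfolding StoneFrm_simps by auto
    show "on_mor compacts_functor L M \<alpha> \<in> Mor (BA lat \<U>) (on_obj compacts_functor L) (on_obj compacts_functor M)"
      using restrict_frame_morphism[OF L M \<alpha>] by (simp add: BA_simps compacts_functor_def)
    fix N :: "'a set gorder" and \<beta>
    show "on_mor compacts_functor L N (Cmp (StoneFrm lat \<U>) L M N \<beta> \<alpha>) =
      Cmp (BA lat \<U>) (on_obj compacts_functor L) (on_obj compacts_functor M) (on_obj compacts_functor N)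
        (on_mor compacts_functor M N \<beta>) (on_mor compacts_functor L M \<alpha>)"
      using L.compact_carrier frame_morphismD(3)[OF \<alpha>]
      by (auto simp: BA_simps StoneFrm_simps compacts_functor_def compacts_dual_simps compose_def fun_eq_iff)
  qed
  fix L M :: "'a set gorder" assume "L \<in> Obj (StoneFrm lat \<U>)" "M \<in> Obj (StoneFrm lat \<U>)"
  then have L: "stone_frame L" and M: "stone_frame M" unfolding StoneFrm_simps by auto
  have "bij_betw (\<lambda>\<alpha>. restrict \<alpha> (compact_elems L)) (frame_morphisms lat L M)
     (ba_morphisms lat (compacts_dual L) (compacts_dual M))"
    unfolding bij_betw_def inj_on_def
    using frame_morphism_determined[OF L] restrict_frame_morphism[OF L M] extend_to_frame_morphism[OF L M]
    by (auto simp: image_iff) metis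
  then show "bij_betw (on_mor compacts_functor L M) (Mor (StoneFrm lat \<U>) L M)
     (Mor (BA lat \<U>) (on_obj compacts_functor L) (on_obj compacts_functor M))"
    by (simp add: BA_simps StoneFrm_simps compacts_functor_def)
qed

section \<open>The Stone frame of filters of a boolean algebra\<close>

locale boolean_lattice = fixes L (structure)
  assumes bool_algebra: "bool_algebra L"

sublocale boolean_lattice \<subseteq> bounded_lattice L
  by (rule bool_algebra_lattice[OF bool_algebra])

sublocale boolean_lattice \<subseteq> distributive_lattice L
  using bool_algebra by unfold_locales (simp add: bool_algebra_def)

definition ba_filters :: "('b, 'e) gorder_scheme \<Rightarrow> 'b set set" where
  "ba_filters B = {F. F \<subseteq> carrier B \<and> \<top>\<^bsub>B\<^esub> \<in> F \<and> (\<forall>x\<in>F. \<forall>y\<in>F. x \<sqinter>\<^bsub>B\<^esub> y \<in> F) \<and>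
     (\<forall>x\<in>F. \<forall>y\<in>carrier B. x \<sqsubseteq>\<^bsub>B\<^esub> y \<longrightarrow> y \<in> F)}"

definition principal_filter :: "('b, 'e) gorder_scheme \<Rightarrow> 'b \<Rightarrow> 'b set" where
  "principal_filter B b = {x \<in> carrier B. b \<sqsubseteq>\<^bsub>B\<^esub> x}"

definition filter_frame :: "('b, 'e) gorder_scheme \<Rightarrow> 'b set gorder" where
  "filter_frame B = \<lparr>carrier = ba_filters B, eq = (=), le = (\<subseteq>)\<rparr>"

lemma filter_frame_simps:
  "carrier (filter_frame B) = ba_filters B" "eq (filter_frame B) = (=)"
  "F \<sqsubseteq>\<^bsub>filter_frame B\<^esub> G \<longleftrightarrow> F \<subseteq> G"
  unfolding filter_frame_def by simp_all

lemma ba_filterD: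
  assumes "F \<in> ba_filters B"
  shows "F \<subseteq> carrier B" "\<top>\<^bsub>B\<^esub> \<in> F" "\<And>x y. \<lbrakk>x \<in> F; y \<in> F\<rbrakk> \<Longrightarrow> x \<sqinter>\<^bsub>B\<^esub> y \<in> F"
    "\<And>x y. \<lbrakk>x \<in> F; y \<in> carrier B; x \<sqsubseteq>\<^bsub>B\<^esub> y\<rbrakk> \<Longrightarrow> y \<in> F"
  using assms unfolding ba_filters_def by auto

lemma ba_filterI:
  assumes "F \<subseteq> carrier B" "\<top>\<^bsub>B\<^esub> \<in> F" "\<And>x y. \<lbrakk>x \<in> F; y \<in> F\<rbrakk> \<Longrightarrow> x \<sqinter>\<^bsub>B\<^esub> y \<in> F"
    "\<And>x y. \<lbrakk>x \<in> F; y \<in> carrier B; x \<sqsubseteq>\<^bsub>B\<^esub> y\<rbrakk> \<Longrightarrow> y \<in> F"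
  shows "F \<in> ba_filters B"
  using assms unfolding ba_filters_def by auto

context boolean_lattice
begin

abbreviation "Filt \<equiv> filter_frame L"

lemma partial_order_filter_frame: "partial_order Filt"
  by (rule partial_orderI) (auto simp: filter_frame_simps)

lemma principal_filter_filter: "b \<in> carrier L \<Longrightarrow> principal_filter L b \<in> ba_filters L"
  by (rule ba_filterI) (simp_all add: principal_filter_def subset_eq meet_le, blast intro: le_trans)

lemma principal_filter_subset:
  "\<lbrakk>b \<in> carrier L; F \<in> ba_filters L\<rbrakk> \<Longrightarrow> principal_filter L b \<subseteq> F \<longleftrightarrow> b \<in> F"
  unfolding principal_filter_def using ba_filterD(4)[of F L b] le_refl[of b] by blast

lemma carrier_filter: "carrier L \<in> ba_filters L"
  by (rule ba_filterI) auto

lemma top_filter: "{\<top>} \<in> ba_filters L"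
  by (rule ba_filterI) (auto simp: meet_top_right top_le_eq)

lemma inter_filter: "\<lbrakk>F \<in> ba_filters L; G \<in> ba_filters L\<rbrakk> \<Longrightarrow> F \<inter> G \<in> ba_filters L"
  by (rule ba_filterI) (auto dest: ba_filterD)

lemma sup_filter_frame:
  assumes "S \<subseteq> ba_filters L"
  shows "\<Squnion>\<^bsub>Filt\<^esub>S = \<Inter>{F \<in> ba_filters L. \<Union>S \<subseteq> F}" "least Filt (\<Squnion>\<^bsub>Filt\<^esub>S) (Upper Filt S)"
proof -
  let ?G = "\<Inter>{F \<in> ba_filters L. \<Union>S \<subseteq> F}"
  have US: "\<Union>S \<subseteq> carrier L" using assms ba_filterD(1) by blast
  have G: "?G \<in> ba_filters L"
  proof (rule ba_filterI)
    show "?G \<subseteq> carrier L" using carrier_filter US by blast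
  qed (auto dest: ba_filterD)
  show eq: "\<Squnion>\<^bsub>Filt\<^esub>S = ?G"
    by (rule sup_eqI[OF partial_order_filter_frame]) (use assms G in \<open>simp_all add: filter_frame_simps, blast+\<close>)
  show "least Filt (\<Squnion>\<^bsub>Filt\<^esub>S) (Upper Filt S)"
    unfolding eq least_def Upper_def using G assms by (auto simp: filter_frame_simps)
qed

lemma filter_frame_sup_least:
  "\<lbrakk>S \<subseteq> ba_filters L; G \<in> ba_filters L; \<And>F. F \<in> S \<Longrightarrow> F \<subseteq> G\<rbrakk> \<Longrightarrow> \<Squnion>\<^bsub>Filt\<^esub>S \<subseteq> G"
  and filter_frame_sup_upper: "\<lbrakk>S \<subseteq> ba_filters L; F \<in> S\<rbrakk> \<Longrightarrow> F \<subseteq> \<Squnion>\<^bsub>Filt\<^esub>S"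
  and filter_frame_sup_filter: "S \<subseteq> ba_filters L \<Longrightarrow> \<Squnion>\<^bsub>Filt\<^esub>S \<in> ba_filters L"
  using sup_filter_frame unfolding least_def Upper_def by (auto simp: filter_frame_simps)

lemma complete_lattice_filter_frame: "complete_lattice Filt"
proof (rule partial_order.complete_latticeI[OF partial_order_filter_frame])
  fix S assume S: "S \<subseteq> carrier Filt"
  then show "\<exists>s. least Filt s (Upper Filt S)"
    by (intro exI[of _ "\<Squnion>\<^bsub>Filt\<^esub>S"] sup_filter_frame(2)) (simp add: filter_frame_simps)
  have "carrier L \<inter> \<Inter>S \<in> ba_filters L"
    using S by (intro ba_filterI) (auto simp: filter_frame_simps dest!: subsetD dest: ba_filterD)
  then have "greatest Filt (carrier L \<inter> \<Inter>S) (Lower Filt S)"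
    unfolding greatest_def Lower_def using S by (auto simp: filter_frame_simps dest: ba_filterD)
  then show "\<exists>i. greatest Filt i (Lower Filt S)" by blast
qed

lemma filter_frame_meet: "\<lbrakk>F \<in> ba_filters L; G \<in> ba_filters L\<rbrakk> \<Longrightarrow> F \<sqinter>\<^bsub>Filt\<^esub> G = F \<inter> G"
  unfolding meet_def
  by (rule inf_eqI[OF partial_order_filter_frame]) (auto simp: filter_frame_simps inter_filter)

lemma filter_frame_bottom: "\<bottom>\<^bsub>Filt\<^esub> = {\<top>}" and filter_frame_top: "\<top>\<^bsub>Filt\<^esub> = carrier L"
proof -
  interpret Filt: complete_lattice Filt by (rule complete_lattice_filter_frame)
  have "{\<top>} \<subseteq> \<bottom>\<^bsub>Filt\<^esub>" using Filt.bottom_closed ba_filterD(2) unfolding filter_frame_simps by blast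
  moreover have "\<bottom>\<^bsub>Filt\<^esub> \<subseteq> {\<top>}" using Filt.bottom_lower[of "{\<top>}"] top_filter unfolding filter_frame_simps by blast
  ultimately show "\<bottom>\<^bsub>Filt\<^esub> = {\<top>}" by blast
  have "\<top>\<^bsub>Filt\<^esub> \<subseteq> carrier L" using Filt.top_closed ba_filterD(1) unfolding filter_frame_simps by blast
  moreover have "carrier L \<subseteq> \<top>\<^bsub>Filt\<^esub>"
    using Filt.top_higher[of "carrier L"] carrier_filter unfolding filter_frame_simps by blast
  ultimately show "\<top>\<^bsub>Filt\<^esub> = carrier L" by blast
qed

text \<open>Meeting with a filter \<open>F\<close> has a right adjoint, which sends \<open>G\<close> to the filter of all \<open>y\<close> whose
  joins with members of \<open>F\<close> lie in \<open>G\<close>. Hence it preserves all joins.\<close>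

lemma frame_filter_frame: "frame Filt"
  unfolding frame_def
proof (intro conjI ballI allI impI complete_lattice_filter_frame)
  fix F S assume F: "F \<in> carrier Filt" and S: "S \<subseteq> carrier Filt"
  then have Ff: "F \<in> ba_filters L" and Sf: "S \<subseteq> ba_filters L" by (simp_all add: filter_frame_simps)
  let ?T = "(\<lambda>G. F \<sqinter>\<^bsub>Filt\<^esub> G) ` S"
  have Tf: "?T \<subseteq> ba_filters L" using Ff Sf filter_frame_meet inter_filter by auto
  let ?G = "\<Squnion>\<^bsub>Filt\<^esub>?T"
  have G: "?G \<in> ba_filters L" using filter_frame_sup_filter[OF Tf] .
  define I where "I = {y \<in> carrier L. \<forall>x\<in>F. x \<squnion> y \<in> ?G}"
  have Fc: "\<And>x. x \<in> F \<Longrightarrow> x \<in> carrier L" using ba_filterD(1)[OF Ff] by blast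
  have I: "I \<in> ba_filters L"
  proof (rule ba_filterI)
    have "x \<squnion> \<top> = \<top>" if "x \<in> F" for x using Fc[OF that] by (intro top_le_eq) (auto intro: le_joinI2)
    then show "\<top> \<in> I" unfolding I_def using ba_filterD(2)[OF G] by simp
    show "y \<sqinter> z \<in> I" if "y \<in> I" "z \<in> I" for y z
      using that Fc join_meet_distrib ba_filterD(3)[OF G] unfolding I_def by simp
    show "z \<in> I" if y: "y \<in> I" "z \<in> carrier L" "y \<sqsubseteq> z" for y z
    proof -
      have yc: "y \<in> carrier L" using y unfolding I_def by simp
      have "x \<squnion> z \<in> ?G" if x: "x \<in> F" for x
      proof (rule ba_filterD(4)[OF G])
        show "x \<squnion> y \<in> ?G" using y(1) x unfolding I_def by blast
        show "x \<squnion> y \<sqsubseteq> x \<squnion> z"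
          by (rule join_le[OF join_left le_joinI2[OF y(3)]]) (use Fc[OF x] yc y in auto)
      qed (use y Fc[OF x] in auto)
      then show ?thesis unfolding I_def using y by blast
    qed
  qed (simp add: I_def)
  have "H \<subseteq> I" if H: "H \<in> S" for H
  proof
    fix y assume y: "y \<in> H"
    have Hf: "H \<in> ba_filters L" using H Sf by blast
    have yc: "y \<in> carrier L" using y ba_filterD(1)[OF Hf] by blast
    have "x \<squnion> y \<in> ?G" if x: "x \<in> F" for x
    proof -
      have "x \<squnion> y \<in> F \<inter> H"
        using x y yc Fc[OF x] ba_filterD(4)[OF Ff x, of "x \<squnion> y"] ba_filterD(4)[OF Hf y, of "x \<squnion> y"]
          join_left join_right by simp
      moreover have "F \<inter> H \<subseteq> ?G"
        using filter_frame_sup_upper[OF Tf, of "F \<inter> H"] H filter_frame_meet[OF Ff Hf] by auto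
      ultimately show ?thesis by blast
    qed
    then show "y \<in> I" using yc unfolding I_def by blast
  qed
  then have SI: "\<Squnion>\<^bsub>Filt\<^esub>S \<subseteq> I" by (rule filter_frame_sup_least[OF Sf I])
  have "F \<inter> \<Squnion>\<^bsub>Filt\<^esub>S \<subseteq> ?G"
  proof
    fix x assume x: "x \<in> F \<inter> \<Squnion>\<^bsub>Filt\<^esub>S"
    then have "x \<squnion> x \<in> ?G" using SI unfolding I_def by blast
    moreover have "x \<squnion> x = x" using x Fc le_iff_meet by (metis IntD1 le_refl)
    ultimately show "x \<in> ?G" by simp
  qed
  moreover have "?G \<subseteq> F \<inter> \<Squnion>\<^bsub>Filt\<^esub>S"
    using filter_frame_sup_upper[OF Sf] filter_frame_meet[OF Ff] Sf
    by (intro filter_frame_sup_least[OF Tf] inter_filter Ff filter_frame_sup_filter[OF Sf]) blast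
  ultimately show "F \<sqinter>\<^bsub>Filt\<^esub> \<Squnion>\<^bsub>Filt\<^esub>S = ?G"
    using filter_frame_meet[OF Ff filter_frame_sup_filter[OF Sf]] by blast
qed

text \<open>The union of all finite subjoins of a family of filters is directed, hence a filter, hence
  the join of the family. So if \<open>b\<close> lies in the join, it lies in a finite subjoin.\<close>

lemma principal_filter_compact:
  assumes b: "b \<in> carrier L"
  shows "principal_filter L b \<in> compact_elems Filt"
proof -
  have "\<exists>T\<subseteq>S. finite T \<and> principal_filter L b \<subseteq> \<Squnion>\<^bsub>Filt\<^esub>T"
    if S: "S \<subseteq> ba_filters L" "principal_filter L b \<subseteq> \<Squnion>\<^bsub>Filt\<^esub>S" for S
  proof -
    define D where "D = {x. \<exists>T\<subseteq>S. finite T \<and> x \<in> \<Squnion>\<^bsub>Filt\<^esub>T}"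
    have Tf: "\<And>T. T \<subseteq> S \<Longrightarrow> \<Squnion>\<^bsub>Filt\<^esub>T \<in> ba_filters L" using S by (intro filter_frame_sup_filter) auto
    have D: "D \<in> ba_filters L"
    proof (rule ba_filterI)
      show "D \<subseteq> carrier L" unfolding D_def using ba_filterD(1)[OF Tf] by blast
      show "\<top> \<in> D" unfolding D_def using ba_filterD(2)[OF Tf[of "{}"]] by (auto intro!: exI[of _ "{}"])
      show "x \<sqinter> y \<in> D" if xy: "x \<in> D" "y \<in> D" for x y
      proof -
        obtain T T' where T: "T \<subseteq> S" "finite T" "x \<in> \<Squnion>\<^bsub>Filt\<^esub>T" "T' \<subseteq> S" "finite T'" "y \<in> \<Squnion>\<^bsub>Filt\<^esub>T'"
          using xy unfolding D_def by blast
        have U: "T \<union> T' \<subseteq> ba_filters L" and UF: "\<Squnion>\<^bsub>Filt\<^esub>(T \<union> T') \<in> ba_filters L" using T S Tf by auto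
        have "\<Squnion>\<^bsub>Filt\<^esub>T \<subseteq> \<Squnion>\<^bsub>Filt\<^esub>(T \<union> T')" "\<Squnion>\<^bsub>Filt\<^esub>T' \<subseteq> \<Squnion>\<^bsub>Filt\<^esub>(T \<union> T')"
          by (intro filter_frame_sup_least UF filter_frame_sup_upper[OF U]; use U in blast)+
        then have "x \<sqinter> y \<in> \<Squnion>\<^bsub>Filt\<^esub>(T \<union> T')" using T ba_filterD(3)[OF UF] by blast
        then show ?thesis unfolding D_def using T by (intro CollectI exI[of _ "T \<union> T'"]) auto
      qed
      show "y \<in> D" if "x \<in> D" "y \<in> carrier L" "x \<sqsubseteq> y" for x y
        using that ba_filterD(4)[OF Tf] unfolding D_def by blast
    qed
    have "F \<subseteq> D" if "F \<in> S" for F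
    proof -
      have "F \<subseteq> \<Squnion>\<^bsub>Filt\<^esub>{F}" using that S by (intro filter_frame_sup_upper) auto
      then show ?thesis unfolding D_def using that by (intro subsetI CollectI exI[of _ "{F}"]) auto
    qed
    then have "\<Squnion>\<^bsub>Filt\<^esub>S \<subseteq> D" by (rule filter_frame_sup_least[OF S(1) D])
    then have "b \<in> D" using principal_filter_subset[OF b filter_frame_sup_filter[OF S(1)]] S(2) by blast
    then obtain T where T: "T \<subseteq> S" "finite T" "b \<in> \<Squnion>\<^bsub>Filt\<^esub>T" unfolding D_def by blast
    then show ?thesis using principal_filter_subset[OF b Tf] by blast
  qed
  then show ?thesis unfolding compact_elems_def filter_frame_simps using principal_filter_filter[OF b] by blast
qed

lemma sup_principal_filters:
  assumes F: "F \<in> ba_filters L"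
  shows "F = \<Squnion>\<^bsub>Filt\<^esub>(principal_filter L ` F)"
proof
  have P: "principal_filter L ` F \<subseteq> ba_filters L"
    using principal_filter_filter ba_filterD(1)[OF F] by blast
  show "F \<subseteq> \<Squnion>\<^bsub>Filt\<^esub>(principal_filter L ` F)"
  proof
    fix x assume x: "x \<in> F"
    then have "x \<in> carrier L" using ba_filterD(1)[OF F] by blast
    moreover have "principal_filter L x \<subseteq> \<Squnion>\<^bsub>Filt\<^esub>(principal_filter L ` F)"
      using x by (intro filter_frame_sup_upper[OF P]) blast
    ultimately show "x \<in> \<Squnion>\<^bsub>Filt\<^esub>(principal_filter L ` F)"
      using principal_filter_subset[OF _ filter_frame_sup_filter[OF P]] by blast
  qed
  show "\<Squnion>\<^bsub>Filt\<^esub>(principal_filter L ` F) \<subseteq> F"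
    using principal_filter_subset[OF _ F] ba_filterD(1)[OF F] by (intro filter_frame_sup_least[OF P F]) blast
qed

text \<open>A compact filter \<open>F\<close> lies below the join of finitely many principal filters of elements of \<open>F\<close>;
  the meet of these elements is in \<open>F\<close> and generates \<open>F\<close>.\<close>

lemma compact_elems_filter_frame: "compact_elems Filt = principal_filter L ` carrier L"
proof
  show "principal_filter L ` carrier L \<subseteq> compact_elems Filt" using principal_filter_compact by blast
  show "compact_elems Filt \<subseteq> principal_filter L ` carrier L"
  proof
    fix F assume "F \<in> compact_elems Filt"
    then have F: "F \<in> ba_filters L" and c: "\<And>S. \<lbrakk>S \<subseteq> ba_filters L; F \<subseteq> \<Squnion>\<^bsub>Filt\<^esub>S\<rbrakk> \<Longrightarrow> \<exists>T\<subseteq>S. finite T \<and> F \<subseteq> \<Squnion>\<^bsub>Filt\<^esub>T"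
      unfolding compact_elems_def filter_frame_simps by blast+
    have P: "principal_filter L ` F \<subseteq> ba_filters L"
      using principal_filter_filter ba_filterD(1)[OF F] by blast
    obtain T where T: "T \<subseteq> principal_filter L ` F" "finite T" "F \<subseteq> \<Squnion>\<^bsub>Filt\<^esub>T"
      using c[OF P] sup_principal_filters[OF F] by blast
    obtain A where A: "finite A" "A \<subseteq> F" "T = principal_filter L ` A"
      using finite_subset_image[OF T(2,1)] by blast
    have "\<exists>b\<in>F. \<forall>a\<in>A. b \<sqsubseteq> a"
      using A(1,2)
    proof (induction A rule: finite_induct)
      case empty
      then show ?case using ba_filterD(2)[OF F] by blast
    next
      case (insert a A)
      then obtain b where b: "b \<in> F" "\<forall>a\<in>A. b \<sqsubseteq> a" by blast
      have c: "a \<in> carrier L" "b \<in> carrier L" "A \<subseteq> carrier L" using insert b ba_filterD(1)[OF F] by auto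
      have "a \<sqinter> b \<in> F" using ba_filterD(3)[OF F] insert b by blast
      moreover have "\<forall>x\<in>insert a A. a \<sqinter> b \<sqsubseteq> x"
        using b c meet_left meet_leI2 by auto
      ultimately show ?case by blast
    qed
    then obtain b where b: "b \<in> F" "\<forall>a\<in>A. b \<sqsubseteq> a" by blast
    have bc: "b \<in> carrier L" using b ba_filterD(1)[OF F] by blast
    have "\<Squnion>\<^bsub>Filt\<^esub>T \<subseteq> principal_filter L b"
    proof (rule filter_frame_sup_least)
      show "G \<subseteq> principal_filter L b" if "G \<in> T" for G
      proof -
        obtain a where a: "a \<in> A" "G = principal_filter L a" using \<open>G \<in> T\<close> A(3) by blast
        then have "a \<in> carrier L" "b \<sqsubseteq> a" using A(2) ba_filterD(1)[OF F] b(2) by auto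
        then show ?thesis
          unfolding a(2) principal_filter_subset[OF \<open>a \<in> carrier L\<close> principal_filter_filter[OF bc]]
          by (simp add: principal_filter_def)
      qed
    qed (use T P principal_filter_filter[OF bc] in auto)
    moreover have "principal_filter L b \<subseteq> F" using principal_filter_subset[OF bc F] b by blast
    ultimately show "F \<in> principal_filter L ` carrier L" using T(3) bc by blast
  qed
qed

text \<open>The principal filters of an element and its complement are complements of each other, and
  every filter is the join of the principal filters below it.\<close>

lemma stone_frame_filter_frame: "stone_frame Filt"
proof -
  interpret Filt: complete_lattice Filt by (rule complete_lattice_filter_frame)
  have "carrier L = principal_filter L \<bottom>" unfolding principal_filter_def by auto
  then have "\<top>\<^bsub>Filt\<^esub> \<in> compact_elems Filt"
    using filter_frame_top principal_filter_compact[OF bottom_closed] by simp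
  moreover have "principal_filter L b \<in> complemented_elems Filt" if b: "b \<in> carrier L" for b
  proof -
    let ?P = "principal_filter L"
    obtain c where c: "c \<in> carrier L" "b \<sqinter> c = \<bottom>" "b \<squnion> c = \<top>"
      using bool_algebra b unfolding bool_algebra_def by blast
    note f = principal_filter_filter[OF b] principal_filter_filter[OF c(1)]
    have "?P b \<inter> ?P c \<subseteq> {\<top>}"
    proof
      fix x assume "x \<in> ?P b \<inter> ?P c"
      then have x: "x \<in> carrier L" "b \<sqsubseteq> x" "c \<sqsubseteq> x" unfolding principal_filter_def by auto
      then have "b \<squnion> c \<sqsubseteq> x" by (rule_tac join_le) (use b c in auto)
      then show "x \<in> {\<top>}" using c x top_le_eq by simp
    qed
    then have "?P b \<sqinter>\<^bsub>Filt\<^esub> ?P c = \<bottom>\<^bsub>Filt\<^esub>"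
      using filter_frame_meet f filter_frame_bottom ba_filterD(2)[OF inter_filter[OF f]] by auto
    then have "?P c \<subseteq> pseudocomplement Filt (?P b)"
      unfolding pseudocomplement_def using f by (intro filter_frame_sup_upper) (auto simp: filter_frame_simps)
    moreover have pc: "pseudocomplement Filt (?P b) \<in> ba_filters L"
      unfolding pseudocomplement_def by (rule filter_frame_sup_filter) (auto simp: filter_frame_simps)
    moreover define J where "J = ?P b \<squnion>\<^bsub>Filt\<^esub> pseudocomplement Filt (?P b)"
    have J: "?P b \<subseteq> J" "pseudocomplement Filt (?P b) \<subseteq> J" "J \<in> ba_filters L"
      unfolding J_def using f pc Filt.join_left Filt.join_right Filt.join_closed unfolding filter_frame_simps by auto
    ultimately have "b \<in> J" "c \<in> J" using b c by (auto simp: principal_filter_def)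
    then have "\<bottom> \<in> J" using ba_filterD(3)[OF J(3)] c by metis
    then have "J = carrier L"
      using ba_filterD(4)[OF J(3)] ba_filterD(1)[OF J(3)] by auto
    then show ?thesis
      unfolding complemented_elems_def J_def filter_frame_top using f by (simp add: filter_frame_simps)
  qed
  then have "\<exists>S\<subseteq>complemented_elems Filt. F = \<Squnion>\<^bsub>Filt\<^esub>S" if "F \<in> ba_filters L" for F
    using sup_principal_filters[OF that] ba_filterD(1)[OF that]
    by (intro exI[of _ "principal_filter L ` F"]) auto
  ultimately show ?thesis
    using frame_filter_frame
    unfolding stone_frame_def compact_frame_def zero_dim_frame_def by (simp add: filter_frame_simps)
qed

end

lemma order_iso_principal_filter:
  fixes B :: "'b gorder"
  assumes "bool_algebra B"
  shows "order_iso B (compacts_dual (filter_frame B)) (principal_filter B)"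
proof -
  interpret boolean_lattice B by unfold_locales (rule assms)
  have le: "principal_filter B x \<subseteq> principal_filter B y \<longleftrightarrow> y \<sqsubseteq>\<^bsub>B\<^esub> x" if "x \<in> carrier B" "y \<in> carrier B" for x y
    using principal_filter_subset[OF that(1) principal_filter_filter[OF that(2)]] that
    by (simp add: principal_filter_def)
  have "inj_on (principal_filter B) (carrier B)"
    by (intro inj_onI le_antisym) (simp_all flip: le)
  then show ?thesis
    unfolding order_iso_def compacts_dual_simps filter_frame_simps compact_elems_filter_frame
    using le by (simp add: bij_betw_def)
qed

lemma weak_equivalence_StoneFrm:
  fixes \<U> :: "'a set set"
  obtains F where "weak_equivalence (StoneFrm lat \<U>) (BA lat \<U> :: ('a gorder, 'a \<Rightarrow> 'a) cat) F"
proof (rule weak_equivalence_to_BA[OF fully_faithful_compacts_functor])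
  fix B :: "'a gorder" assume B: "bool_algebra B" "of_size \<U> (carrier B)"
  interpret boolean_lattice B by unfold_locales (rule B(1))
  note iso = order_iso_principal_filter[OF B(1)]
  then have "carrier B \<approx> compact_elems (filter_frame B)"
    unfolding order_iso_def eqpoll_def compacts_dual_simps by blast
  then have "of_size \<U> (compact_elems (filter_frame B))"
    using B(2) eqpoll_sym eqpoll_trans unfolding of_size_def by blast
  then show "\<exists>L\<in>Obj (StoneFrm lat \<U>). \<exists>e. order_iso B (on_obj compacts_functor L) e"
    using stone_frame_filter_frame iso
    by (intro bexI[of _ "filter_frame B"] exI[of _ "principal_filter B"])
      (simp_all add: StoneFrm_simps compacts_functor_def)
qed

section \<open>Stone spaces and their clopen sets\<close>

lemma Clop_subset: "U \<in> Clop X \<Longrightarrow> U \<subseteq> topspace X"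
  unfolding Clop_def by (auto dest: openin_subset)

lemma Clop_ops:
  shows Clop_empty: "{} \<in> Clop X" and Clop_topspace: "topspace X \<in> Clop X"
    and Clop_Int: "\<And>U V. \<lbrakk>U \<in> Clop X; V \<in> Clop X\<rbrakk> \<Longrightarrow> U \<inter> V \<in> Clop X"
    and Clop_Un: "\<And>U V. \<lbrakk>U \<in> Clop X; V \<in> Clop X\<rbrakk> \<Longrightarrow> U \<union> V \<in> Clop X"
    and Clop_Diff: "\<And>U. U \<in> Clop X \<Longrightarrow> topspace X - U \<in> Clop X"
  unfolding Clop_def by auto

definition clopen_algebra :: "'p topology \<Rightarrow> 'p set gorder" where
  "clopen_algebra X = \<lparr>carrier = Clop X, eq = (=), le = (\<subseteq>)\<rparr>"

lemma clopen_algebra_simps: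
  "carrier (clopen_algebra X) = Clop X" "U \<sqsubseteq>\<^bsub>clopen_algebra X\<^esub> V \<longleftrightarrow> U \<subseteq> V"
  unfolding clopen_algebra_def by simp_all

lemma
  shows bool_algebra_clopen_algebra: "bool_algebra (clopen_algebra X)"
    and meet_clopen_algebra: "\<And>U V. \<lbrakk>U \<in> Clop X; V \<in> Clop X\<rbrakk> \<Longrightarrow> U \<sqinter>\<^bsub>clopen_algebra X\<^esub> V = U \<inter> V"
    and join_clopen_algebra: "\<And>U V. \<lbrakk>U \<in> Clop X; V \<in> Clop X\<rbrakk> \<Longrightarrow> U \<squnion>\<^bsub>clopen_algebra X\<^esub> V = U \<union> V"
    and top_clopen_algebra: "\<top>\<^bsub>clopen_algebra X\<^esub> = topspace X"
proof -
  have po: "partial_order (clopen_algebra X)"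
    by (rule partial_orderI) (auto simp: clopen_algebra_def)
  have compl: "\<exists>V\<in>Clop X. U \<inter> V = {} \<and> U \<union> V = topspace X" if "U \<in> Clop X" for U
    using that Clop_subset[OF that] by (intro bexI[of _ "topspace X - U"] Clop_Diff) auto
  note ba = bool_algebraI[of "clopen_algebra X" "\<lambda>U V. U \<inter> V" "\<lambda>U V. U \<union> V" "{}" "topspace X", OF po]
  note s = clopen_algebra_simps Clop_ops compl Clop_subset
  show "bool_algebra (clopen_algebra X)" by (rule ba) (auto simp: s dest: Clop_subset)
  show "U \<sqinter>\<^bsub>clopen_algebra X\<^esub> V = U \<inter> V" if "U \<in> Clop X" "V \<in> Clop X" for U V
    by (rule ba) (use that in \<open>auto simp: s dest: Clop_subset\<close>)
  show "U \<squnion>\<^bsub>clopen_algebra X\<^esub> V = U \<union> V" if "U \<in> Clop X" "V \<in> Clop X" for U V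
    by (rule ba) (use that in \<open>auto simp: s dest: Clop_subset\<close>)
  show "\<top>\<^bsub>clopen_algebra X\<^esub> = topspace X" by (rule ba) (auto simp: s dest: Clop_subset)
qed

lemma clopen_morphisms_iff:
  "h \<in> ba_morphisms lat (clopen_algebra Y) (clopen_algebra X) \<longleftrightarrow>
    h \<in> Clop Y \<rightarrow>\<^sub>E Clop X \<and> h (topspace Y) = topspace X \<and>
    (\<forall>U\<in>Clop Y. \<forall>V\<in>Clop Y. h (U \<inter> V) = h U \<inter> h V) \<and>
    (lat \<longrightarrow> (\<forall>U\<in>Clop Y. \<forall>V\<in>Clop Y. h (U \<union> V) = h U \<union> h V))"
  unfolding ba_morphisms_iff[OF bool_algebra_clopen_algebra bool_algebra_clopen_algebra]
    clopen_algebra_simps top_clopen_algebra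
  by (simp add: meet_clopen_algebra join_clopen_algebra PiE_iff cong: conj_cong)

lemma stone_space_separation:
  assumes "stone_space X" "x \<in> topspace X" "y \<in> topspace X" "x \<noteq> y"
  obtains U where "U \<in> Clop X" "x \<in> U" "y \<notin> U"
proof -
  obtain V W where "openin X V" "x \<in> V" "y \<in> W" "disjnt V W"
    using assms unfolding stone_space_def Hausdorff_space_def by metis
  moreover then obtain U where "U \<in> Clop X" "x \<in> U" "U \<subseteq> V"
    using assms(1) unfolding stone_space_def zero_dim_space_def by blast
  ultimately show thesis using that unfolding disjnt_def by blast
qed

section \<open>Relations between Stone spaces as meet-preserving maps\<close>

definition box_map :: "'p topology \<Rightarrow> 'q topology \<Rightarrow> ('p \<times> 'q) set \<Rightarrow> 'q set \<Rightarrow> 'p set" where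
  "box_map X Y R = (\<lambda>U\<in>Clop Y. rel_box X R U)"

text \<open>The largest relation \<open>R\<close> between the points with \<open>R[x] \<subseteq> U\<close> whenever \<open>U\<close> is clopen and \<open>x \<in> h U\<close>.\<close>

definition box_relation :: "'p topology \<Rightarrow> 'q topology \<Rightarrow> ('q set \<Rightarrow> 'p set) \<Rightarrow> ('p \<times> 'q) set" where
  "box_relation X Y h = {(x, y). x \<in> topspace X \<and> y \<in> topspace Y \<and> (\<forall>U\<in>Clop Y. x \<in> h U \<longrightarrow> y \<in> U)}"

lemma box_map_morphism:
  assumes "R \<in> gen_priestley_morphisms X Y"
  shows "box_map X Y R \<in> ba_morphisms False (clopen_algebra Y) (clopen_algebra X)"
  using assms unfolding clopen_morphisms_iff gen_priestley_morphisms_def box_map_def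
  by (auto simp: Clop_ops rel_box_def)

lemma box_relation_box_map:
  assumes R: "R \<in> gen_priestley_morphisms X Y"
  shows "box_relation X Y (box_map X Y R) = R"
proof (intro equalityI subrelI)
  fix x y assume "(x, y) \<in> box_relation X Y (box_map X Y R)"
  then have xy: "x \<in> topspace X" "y \<in> topspace Y" "\<And>U. \<lbrakk>U \<in> Clop Y; R `` {x} \<subseteq> U\<rbrakk> \<Longrightarrow> y \<in> U"
    unfolding box_relation_def box_map_def rel_box_def by auto
  show "(x, y) \<in> R"
  proof (rule ccontr)
    assume "(x, y) \<notin> R"
    then obtain U where "U \<in> Clop Y" "R `` {x} \<subseteq> U" "y \<notin> U"
      using R xy(1,2) unfolding gen_priestley_morphisms_def by blast
    then show False using xy(3) by blast
  qed
next
  fix x y assume "(x, y) \<in> R"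
  then show "(x, y) \<in> box_relation X Y (box_map X Y R)"
    using R unfolding gen_priestley_morphisms_def box_relation_def box_map_def rel_box_def by auto
qed

text \<open>The image of \<open>x\<close> under the relation of \<open>h\<close> is the intersection of all clopen \<open>V\<close> with
  \<open>x \<in> h V\<close>, a family closed under finite intersections. If the image lies in the open set \<open>U\<close>, by
  compactness a single \<open>V\<close> from the family does, so that \<open>x \<in> h V \<subseteq> h U\<close>.\<close>

lemma rel_box_box_relation:
  assumes Y: "compact_space Y" and h: "h \<in> ba_morphisms lat (clopen_algebra Y) (clopen_algebra X)"
    and U: "U \<in> Clop Y"
  shows "rel_box X (box_relation X Y h) U = h U"
proof (intro equalityI subsetI)
  have hU: "\<And>V. V \<in> Clop Y \<Longrightarrow> h V \<in> Clop X" and htop: "h (topspace Y) = topspace X"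
    and hint: "\<And>V W. \<lbrakk>V \<in> Clop Y; W \<in> Clop Y\<rbrakk> \<Longrightarrow> h (V \<inter> W) = h V \<inter> h W"
    using h unfolding clopen_morphisms_iff by auto
  show "x \<in> rel_box X (box_relation X Y h) U" if "x \<in> h U" for x
    using that Clop_subset[OF hU[OF U]] U unfolding rel_box_def box_relation_def by auto
  fix x assume x: "x \<in> rel_box X (box_relation X Y h) U"
  define \<V> where "\<V> = {V \<in> Clop Y. x \<in> h V}"
  have xX: "x \<in> topspace X" using x unfolding rel_box_def by auto
  have "y \<in> U" if "y \<in> topspace Y" "\<forall>V\<in>\<V>. y \<in> V" for y
    using x that xX unfolding rel_box_def box_relation_def \<V>_def by auto
  then have "topspace Y \<subseteq> \<Union>(insert U ((\<lambda>V. topspace Y - V) ` \<V>))" by blast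
  moreover have "\<forall>W\<in>insert U ((\<lambda>V. topspace Y - V) ` \<V>). openin Y W"
    using U Clop_Diff unfolding \<V>_def Clop_def by blast
  ultimately obtain \<F> where \<F>: "finite \<F>" "\<F> \<subseteq> insert U ((\<lambda>V. topspace Y - V) ` \<V>)" "topspace Y \<subseteq> \<Union>\<F>"
    using Y unfolding compact_space_alt by meson
  then have "\<F> - {U} \<subseteq> (\<lambda>V. topspace Y - V) ` \<V>" "finite (\<F> - {U})" by auto
  then obtain \<G> where \<G>: "\<G> \<subseteq> \<V>" "finite \<G>" "\<F> - {U} = (\<lambda>V. topspace Y - V) ` \<G>"
    by (meson finite_subset_image)
  have "topspace Y \<inter> \<Inter>\<G> \<in> \<V>"
    using \<G>(2,1)
  proof (induction \<G> rule: finite_induct)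
    case empty
    then show ?case using xX htop unfolding \<V>_def by (simp add: Clop_ops)
  next
    case (insert V \<G>)
    then have "topspace Y \<inter> \<Inter>(insert V \<G>) = V \<inter> (topspace Y \<inter> \<Inter>\<G>)" by auto
    then show ?case using insert hint unfolding \<V>_def by (simp add: Clop_Int)
  qed
  moreover define W where "W = topspace Y \<inter> \<Inter>\<G>"
  ultimately have W: "W \<in> Clop Y" "x \<in> h W" unfolding \<V>_def by auto
  have "W \<subseteq> U"
  proof
    fix y assume y: "y \<in> W"
    then obtain F where F: "F \<in> \<F>" "y \<in> F" using \<F>(3) unfolding W_def by blast
    show "y \<in> U"
    proof (rule ccontr)
      assume "y \<notin> U"
      then have "F \<in> (\<lambda>V. topspace Y - V) ` \<G>" using F \<G>(3) by blast
      then show False using F y unfolding W_def by auto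
    qed
  qed
  then have "W \<inter> U = W" by blast
  then have "h W = h W \<inter> h U" using hint[OF W(1) U] by simp
  then show "x \<in> h U" using W(2) by blast
qed

lemma box_relation_morphism:
  assumes Y: "compact_space Y" and h: "h \<in> ba_morphisms lat (clopen_algebra Y) (clopen_algebra X)"
  shows "box_relation X Y h \<in> gen_priestley_morphisms X Y"
proof -
  have "\<exists>U\<in>Clop Y. box_relation X Y h `` {x} \<subseteq> U \<and> y \<notin> U"
    if "x \<in> topspace X" "y \<in> topspace Y" "(x, y) \<notin> box_relation X Y h" for x y
    using that unfolding box_relation_def by auto
  moreover have "h U \<in> Clop X" if "U \<in> Clop Y" for U
    using h that unfolding clopen_morphisms_iff by auto
  ultimately show ?thesis
    unfolding gen_priestley_morphisms_def using rel_box_box_relation[OF Y h]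
    by (auto simp: box_relation_def)
qed

lemma box_map_box_relation:
  assumes "compact_space Y" "h \<in> ba_morphisms lat (clopen_algebra Y) (clopen_algebra X)"
  shows "box_map X Y (box_relation X Y h) = h"
proof
  fix U
  show "box_map X Y (box_relation X Y h) U = h U"
    using rel_box_box_relation[OF assms, of U] assms(2)
    unfolding box_map_def clopen_morphisms_iff by (cases "U \<in> Clop Y") (auto simp: PiE_iff extensional_def)
qed

lemma bij_betw_box_map:
  assumes "compact_space Y"
  shows "bij_betw (box_map X Y) (gen_priestley_morphisms X Y)
    (ba_morphisms False (clopen_algebra Y) (clopen_algebra X))"
  by (rule bij_betw_byWitness[where f' = "box_relation X Y"])
    (use assms in \<open>auto simp: box_relation_box_map box_map_box_relation box_map_morphism box_relation_morphism\<close>)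

text \<open>The composite of \<open>R\<close> and \<open>S\<close> is by definition the relation of \<open>\<box>\<^sub>R \<circ> \<box>\<^sub>S\<close>.\<close>

lemma gen_priestley_comp_morphism:
  assumes Z: "compact_space Z"
    and R: "R \<in> gen_priestley_morphisms X Y" and S: "S \<in> gen_priestley_morphisms Y Z"
  shows "gen_priestley_comp X Y Z S R \<in> gen_priestley_morphisms X Z"
    and "box_map X Z (gen_priestley_comp X Y Z S R) = compose (Clop Z) (box_map X Y R) (box_map Y Z S)"
proof -
  let ?h = "compose (Clop Z) (box_map X Y R) (box_map Y Z S)"
  have h: "?h \<in> ba_morphisms False (clopen_algebra Z) (clopen_algebra X)"
    using ba_morphisms_compose[OF _ _ _ box_map_morphism[OF S] box_map_morphism[OF R]]
    by (simp add: bool_algebra_clopen_algebra clopen_algebra_simps)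
  have "rel_box Y S U \<in> Clop Y" if "U \<in> Clop Z" for U
    using S that unfolding gen_priestley_morphisms_def by blast
  then have eq: "gen_priestley_comp X Y Z S R = box_relation X Z ?h"
    unfolding gen_priestley_comp_def box_relation_def by (auto simp: compose_def box_map_def)
  show "gen_priestley_comp X Y Z S R \<in> gen_priestley_morphisms X Z"
    unfolding eq by (rule box_relation_morphism[OF Z h])
  show "box_map X Z (gen_priestley_comp X Y Z S R) = ?h"
    unfolding eq by (rule box_map_box_relation[OF Z h])
qed

lemma Id_on_morphism:
  assumes X: "stone_space X"
  shows "Id_on (topspace X) \<in> gen_priestley_morphisms X X"
    and "box_map X X (Id_on (topspace X)) = (\<lambda>U\<in>Clop X. U)"
proof -
  have box: "rel_box X (Id_on (topspace X)) U = U" if "U \<in> Clop X" for U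
    using Clop_subset[OF that] unfolding rel_box_def by auto
  have "\<exists>U\<in>Clop X. Id_on (topspace X) `` {x} \<subseteq> U \<and> y \<notin> U"
    if xy: "x \<in> topspace X" "y \<in> topspace X" "(x, y) \<notin> Id_on (topspace X)" for x y
  proof -
    obtain U where "U \<in> Clop X" "x \<in> U" "y \<notin> U"
      using stone_space_separation[OF X xy(1,2)] xy by blast
    then show ?thesis by (intro bexI[of _ U]) auto
  qed
  then show "Id_on (topspace X) \<in> gen_priestley_morphisms X X"
    unfolding gen_priestley_morphisms_def using box by auto
  show "box_map X X (Id_on (topspace X)) = (\<lambda>U\<in>Clop X. U)"
    unfolding box_map_def using box by (auto simp: fun_eq_iff)
qed

definition clopen_functor ::
  "('p topology, ('p \<times> 'p) set, 'p set gorder, 'p set \<Rightarrow> 'p set) functr" where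
  "clopen_functor = \<lparr>on_obj = clopen_algebra, on_mor = (\<lambda>Y X R. box_map X Y R)\<rparr>"

lemma fully_faithful_clopen_functor:
  fixes \<U> :: "'a set set"
  shows "fully_faithful (op_cat (Stone_R \<U>)) (BA False \<U>) clopen_functor"
proof (rule fully_faithfulI[OF is_category_BA])
  fix X assume "X \<in> Obj (op_cat (Stone_R \<U>))"
  then have X: "stone_space X" "of_size \<U> (Clop X)" unfolding op_cat_def Stone_R_def by auto
  show "on_obj clopen_functor X \<in> Obj (BA False \<U>)"
    using X bool_algebra_clopen_algebra unfolding BA_simps clopen_functor_def
    by (simp add: clopen_algebra_simps)
  show "Ident (op_cat (Stone_R \<U>)) X \<in> Mor (op_cat (Stone_R \<U>)) X X \<and>
      on_mor clopen_functor X X (Ident (op_cat (Stone_R \<U>)) X) = Ident (BA False \<U>) (on_obj clopen_functor X)"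
    using Id_on_morphism[OF X(1)] unfolding op_cat_def Stone_R_def clopen_functor_def
    by (simp add: BA_simps clopen_algebra_simps)
  fix Y assume "Y \<in> Obj (op_cat (Stone_R \<U>))"
  show "bij_betw (on_mor clopen_functor X Y) (Mor (op_cat (Stone_R \<U>)) X Y)
      (Mor (BA False \<U>) (on_obj clopen_functor X) (on_obj clopen_functor Y))"
    using bij_betw_box_map[of X Y] X unfolding stone_space_def op_cat_def Stone_R_def clopen_functor_def
    by (simp add: BA_simps)
  fix Z R S assume R: "R \<in> Mor (op_cat (Stone_R \<U>)) X Y" and S: "S \<in> Mor (op_cat (Stone_R \<U>)) Y Z"
  show "Cmp (op_cat (Stone_R \<U>)) X Y Z S R \<in> Mor (op_cat (Stone_R \<U>)) X Z \<and>
      on_mor clopen_functor X Z (Cmp (op_cat (Stone_R \<U>)) X Y Z S R) =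
      Cmp (BA False \<U>) (on_obj clopen_functor X) (on_obj clopen_functor Y) (on_obj clopen_functor Z)
        (on_mor clopen_functor Y Z S) (on_mor clopen_functor X Y R)"
    using gen_priestley_comp_morphism[of X S Z Y R] X R S
    unfolding stone_space_def op_cat_def Stone_R_def clopen_functor_def
    by (simp add: BA_simps clopen_algebra_simps)
qed

section \<open>Partial functions as relations\<close>

text \<open>For the graph of a partial function, clopenness of the domain is the case \<open>U = {}\<close> of
  clopenness of \<open>\<box> U\<close>.\<close>

lemma partial_morphism_iff_graph:
  "f \<in> partial_strong_priestley_morphisms X Y \<longleftrightarrow> Map.graph f \<subseteq> topspace X \<times> topspace Y \<and>
    (\<forall>U\<in>Clop Y. rel_box X (Map.graph f) U \<in> Clop X)"
proof -
  have sub: "dom f \<subseteq> topspace X \<and> ran f \<subseteq> topspace Y \<longleftrightarrow> Map.graph f \<subseteq> topspace X \<times> topspace Y"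
    unfolding Map.graph_def dom_def ran_def by auto
  have box: "topspace X - f -` (Some ` (topspace Y - U)) = rel_box X (Map.graph f) U"
    if "Map.graph f \<subseteq> topspace X \<times> topspace Y" for U
    using that unfolding rel_box_def Map.graph_def by auto
  have dom: "dom f = topspace X - rel_box X (Map.graph f) {}" if "Map.graph f \<subseteq> topspace X \<times> topspace Y"
    using that unfolding rel_box_def Map.graph_def by (auto simp: dom_def)
  show ?thesis
    unfolding partial_strong_priestley_morphisms_def mem_Collect_eq
    using sub box dom Clop_Diff Clop_empty by metis
qed

lemma graph_morphism:
  assumes Y: "stone_space Y" and f: "f \<in> partial_strong_priestley_morphisms X Y"
  shows "Map.graph f \<in> gen_priestley_morphisms X Y"
proof -
  have "\<exists>U\<in>Clop Y. Map.graph f `` {x} \<subseteq> U \<and> y \<notin> U"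
    if xy: "x \<in> topspace X" "y \<in> topspace Y" "(x, y) \<notin> Map.graph f" for x y
  proof (cases "f x")
    case None
    then show ?thesis by (intro bexI[of _ "{}"] Clop_empty) (auto simp: Map.graph_def)
  next
    case (Some z)
    then have "z \<in> topspace Y" "z \<noteq> y" using f xy unfolding partial_morphism_iff_graph Map.graph_def by auto
    then obtain U where "U \<in> Clop Y" "z \<in> U" "y \<notin> U"
      using stone_space_separation[OF Y _ xy(2)] by blast
    then show ?thesis using Some by (intro bexI[of _ U]) (auto simp: Map.graph_def)
  qed
  then show ?thesis
    using f unfolding partial_morphism_iff_graph gen_priestley_morphisms_def by blast
qed

lemma box_map_graph_morphism:
  assumes Y: "stone_space Y" and f: "f \<in> partial_strong_priestley_morphisms X Y"
  shows "box_map X Y (Map.graph f) \<in> ba_morphisms True (clopen_algebra Y) (clopen_algebra X)"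
proof -
  have "rel_box X (Map.graph f) (U \<union> V) = rel_box X (Map.graph f) U \<union> rel_box X (Map.graph f) V" for U V
    unfolding rel_box_def Map.graph_def by auto
  then show ?thesis
    using box_map_morphism[OF graph_morphism[OF Y f]]
    unfolding clopen_morphisms_iff by (auto simp: box_map_def Clop_Un)
qed

text \<open>If \<open>\<box>\<close> preserves binary joins and \<open>y \<noteq> z\<close> were both related to \<open>x\<close>, then \<open>x\<close>
  would lie in \<open>\<box> (U \<union> (Y - U))\<close> for a clopen \<open>U\<close> that separates \<open>y\<close> and \<open>z\<close>, but in neither
  \<open>\<box> U\<close> nor \<open>\<box> (Y - U)\<close>.\<close>

lemma partial_morphism_of_lattice_morphism:
  assumes Y: "stone_space Y" and h: "h \<in> ba_morphisms True (clopen_algebra Y) (clopen_algebra X)"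
  obtains f where "f \<in> partial_strong_priestley_morphisms X Y" "box_map X Y (Map.graph f) = h"
proof -
  have Yc: "compact_space Y" using Y unfolding stone_space_def by blast
  define R where "R = box_relation X Y h"
  have Rm: "R \<in> gen_priestley_morphisms X Y" unfolding R_def by (rule box_relation_morphism[OF Yc h])
  then have RXY: "R \<subseteq> topspace X \<times> topspace Y" unfolding gen_priestley_morphisms_def by blast
  note box = rel_box_box_relation[OF Yc h, folded R_def]
  have unique: "y = z" if "(x, y) \<in> R" "(x, z) \<in> R" for x y z
  proof (rule ccontr)
    assume "y \<noteq> z"
    have xyz: "x \<in> topspace X" "y \<in> topspace Y" "z \<in> topspace Y" using that RXY by auto
    then obtain U where U: "U \<in> Clop Y" "y \<in> U" "z \<notin> U"
      using stone_space_separation[OF Y xyz(2,3) \<open>y \<noteq> z\<close>] by blast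
    let ?V = "topspace Y - U"
    have "U \<union> ?V = topspace Y" using Clop_subset[OF U(1)] by auto
    then have "h (topspace Y) = h U \<union> h ?V"
      using h U(1) Clop_Diff[OF U(1)] unfolding clopen_morphisms_iff by metis
    moreover have "h (topspace Y) = topspace X" using h unfolding clopen_morphisms_iff by blast
    ultimately have "x \<in> rel_box X R U \<union> rel_box X R ?V"
      using xyz(1) box[OF U(1)] box[OF Clop_Diff[OF U(1)]] by auto
    then show False using that U unfolding rel_box_def by auto
  qed
  define f where "f x = (if \<exists>y. (x, y) \<in> R then Some (THE y. (x, y) \<in> R) else None)" for x
  have "f x = Some y \<longleftrightarrow> (x, y) \<in> R" for x y
  proof
    assume "(x, y) \<in> R"
    then have "(THE y. (x, y) \<in> R) = y" using unique by blast
    then show "f x = Some y" using \<open>(x, y) \<in> R\<close> unfolding f_def by auto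
  next
    assume "f x = Some y"
    then obtain z where "(x, z) \<in> R" "y = (THE y. (x, y) \<in> R)" unfolding f_def by (auto split: if_splits)
    then show "(x, y) \<in> R" using unique theI[of "\<lambda>y. (x, y) \<in> R" z] by blast
  qed
  then have g: "Map.graph f = R" unfolding Map.graph_def by auto
  show thesis
  proof (rule that)
    show "f \<in> partial_strong_priestley_morphisms X Y"
      using Rm unfolding partial_morphism_iff_graph g gen_priestley_morphisms_def by blast
    show "box_map X Y (Map.graph f) = h" unfolding g R_def by (rule box_map_box_relation[OF Yc h])
  qed
qed

lemma graph_inj: "Map.graph f = Map.graph g \<Longrightarrow> f = g"
proof
  fix x assume "Map.graph f = Map.graph g"
  then have "\<And>y. f x = Some y \<longleftrightarrow> g x = Some y" unfolding Map.graph_def by blast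
  then show "f x = g x" by (metis not_None_eq)
qed

definition partial_clopen_functor ::
  "('p topology, 'p \<rightharpoonup> 'p, 'p set gorder, 'p set \<Rightarrow> 'p set) functr" where
  "partial_clopen_functor = \<lparr>on_obj = clopen_algebra, on_mor = (\<lambda>Y X f. box_map X Y (Map.graph f))\<rparr>"

lemma fully_faithful_partial_clopen_functor:
  fixes \<U> :: "'a set set"
  shows "fully_faithful (op_cat (Stone_PS \<U>)) (BA True \<U>) partial_clopen_functor"
proof (rule fully_faithfulI[OF is_category_BA])
  fix X assume "X \<in> Obj (op_cat (Stone_PS \<U>))"
  then have X: "stone_space X" "of_size \<U> (Clop X)" unfolding op_cat_def Stone_PS_def by auto
  show "on_obj partial_clopen_functor X \<in> Obj (BA True \<U>)"
    using X bool_algebra_clopen_algebra unfolding BA_simps partial_clopen_functor_def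
    by (simp add: clopen_algebra_simps)
  have g: "Map.graph (Some |` topspace X) = Id_on (topspace X)"
    unfolding Map.graph_def restrict_map_def by (auto split: if_splits)
  have "Some |` topspace X \<in> partial_strong_priestley_morphisms X X"
    using Id_on_morphism(1)[OF X(1)] unfolding partial_morphism_iff_graph g gen_priestley_morphisms_def by blast
  then show "Ident (op_cat (Stone_PS \<U>)) X \<in> Mor (op_cat (Stone_PS \<U>)) X X \<and>
      on_mor partial_clopen_functor X X (Ident (op_cat (Stone_PS \<U>)) X) =
      Ident (BA True \<U>) (on_obj partial_clopen_functor X)"
    using Id_on_morphism(2)[OF X(1)] unfolding op_cat_def Stone_PS_def partial_clopen_functor_def
    by (simp add: BA_simps clopen_algebra_simps g)
  fix Y :: "'a set topology"
  have "inj_on (\<lambda>f. box_map Y X (Map.graph f)) (partial_strong_priestley_morphisms Y X)"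
  proof (intro inj_onI graph_inj)
    fix f g assume "f \<in> partial_strong_priestley_morphisms Y X" "g \<in> partial_strong_priestley_morphisms Y X"
      "box_map Y X (Map.graph f) = box_map Y X (Map.graph g)"
    then show "Map.graph f = Map.graph g"
      using box_relation_box_map[OF graph_morphism[OF X(1), of f Y]]
        box_relation_box_map[OF graph_morphism[OF X(1), of g Y]] by metis
  qed
  moreover have "(\<lambda>f. box_map Y X (Map.graph f)) ` partial_strong_priestley_morphisms Y X =
      ba_morphisms True (clopen_algebra X) (clopen_algebra Y)"
  proof (intro equalityI subsetI)
    fix h assume "h \<in> ba_morphisms True (clopen_algebra X) (clopen_algebra Y)"
    then obtain f where "f \<in> partial_strong_priestley_morphisms Y X" "box_map Y X (Map.graph f) = h"
      by (rule partial_morphism_of_lattice_morphism[OF X(1)])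
    then show "h \<in> (\<lambda>f. box_map Y X (Map.graph f)) ` partial_strong_priestley_morphisms Y X" by blast
  qed (use box_map_graph_morphism[OF X(1)] in blast)
  ultimately have "bij_betw (\<lambda>f. box_map Y X (Map.graph f)) (partial_strong_priestley_morphisms Y X)
      (ba_morphisms True (clopen_algebra X) (clopen_algebra Y))"
    unfolding bij_betw_def by blast
  then show "bij_betw (on_mor partial_clopen_functor X Y) (Mor (op_cat (Stone_PS \<U>)) X Y)
      (Mor (BA True \<U>) (on_obj partial_clopen_functor X) (on_obj partial_clopen_functor Y))"
    unfolding op_cat_def Stone_PS_def partial_clopen_functor_def by (simp add: BA_simps)
  fix Z f g assume f: "f \<in> Mor (op_cat (Stone_PS \<U>)) X Y" and g: "g \<in> Mor (op_cat (Stone_PS \<U>)) Y Z"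
  then have f: "f \<in> partial_strong_priestley_morphisms Y X" and g: "g \<in> partial_strong_priestley_morphisms Z Y"
    unfolding op_cat_def Stone_PS_def by simp_all
  have sub: "Map.graph (f \<circ>\<^sub>m g) \<subseteq> topspace Z \<times> topspace X"
    using f g unfolding partial_morphism_iff_graph by auto
  have "rel_box Z (Map.graph (f \<circ>\<^sub>m g)) U = rel_box Z (Map.graph g) (rel_box Y (Map.graph f) U)" for U
    using f g unfolding partial_morphism_iff_graph rel_box_def by auto
  moreover have "rel_box Y (Map.graph f) U \<in> Clop Y" "rel_box Z (Map.graph g) (rel_box Y (Map.graph f) U) \<in> Clop Z"
    if "U \<in> Clop X" for U
    using f g that unfolding partial_morphism_iff_graph by auto
  ultimately have "f \<circ>\<^sub>m g \<in> partial_strong_priestley_morphisms Z X"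
    and "box_map Z X (Map.graph (f \<circ>\<^sub>m g)) = compose (Clop X) (box_map Z Y (Map.graph g)) (box_map Y X (Map.graph f))"
    using sub unfolding partial_morphism_iff_graph box_map_def compose_def by (auto simp: fun_eq_iff)
  then show "Cmp (op_cat (Stone_PS \<U>)) X Y Z g f \<in> Mor (op_cat (Stone_PS \<U>)) X Z \<and>
      on_mor partial_clopen_functor X Z (Cmp (op_cat (Stone_PS \<U>)) X Y Z g f) =
      Cmp (BA True \<U>) (on_obj partial_clopen_functor X) (on_obj partial_clopen_functor Y)
        (on_obj partial_clopen_functor Z) (on_mor partial_clopen_functor Y Z g) (on_mor partial_clopen_functor X Y f)"
    unfolding op_cat_def Stone_PS_def partial_clopen_functor_def by (simp add: BA_simps clopen_algebra_simps)
qed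

section \<open>The Stone space of a boolean algebra\<close>

definition prime_filters :: "('b, 'e) gorder_scheme \<Rightarrow> 'b set set" where
  "prime_filters B = {P \<in> ba_filters B. \<bottom>\<^bsub>B\<^esub> \<notin> P \<and>
     (\<forall>x\<in>carrier B. \<forall>y\<in>carrier B. x \<squnion>\<^bsub>B\<^esub> y \<in> P \<longrightarrow> x \<in> P \<or> y \<in> P)}"

definition prime_filters_with :: "('b, 'e) gorder_scheme \<Rightarrow> 'b \<Rightarrow> 'b set set" where
  "prime_filters_with B b = {P \<in> prime_filters B. b \<in> P}"

definition prime_filter_space :: "('b, 'e) gorder_scheme \<Rightarrow> 'b set topology" where
  "prime_filter_space B = topology (\<lambda>U. U \<subseteq> prime_filters B \<and>
     (\<forall>P\<in>U. \<exists>b\<in>P. prime_filters_with B b \<subseteq> U))"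

context boolean_lattice
begin

abbreviation "Pts \<equiv> prime_filters L"
abbreviation "\<phi> \<equiv> prime_filters_with L"
abbreviation "Spec \<equiv> prime_filter_space L"

lemma prime_filterD:
  assumes "P \<in> Pts"
  shows "P \<in> ba_filters L" "\<bottom> \<notin> P"
    "\<And>x y. \<lbrakk>x \<in> carrier L; y \<in> carrier L; x \<squnion> y \<in> P\<rbrakk> \<Longrightarrow> x \<in> P \<or> y \<in> P"
  using assms unfolding prime_filters_def by auto

lemma prime_filter_carrier: "\<lbrakk>P \<in> Pts; b \<in> P\<rbrakk> \<Longrightarrow> b \<in> carrier L"
  using prime_filterD(1) ba_filterD(1) by blast

text \<open>A maximal proper filter \<open>M\<close> is prime: if \<open>x \<notin> M\<close>, the filter generated by \<open>M\<close> and \<open>x\<close> is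
  improper, so \<open>m \<sqinter> x = \<bottom>\<close> for some \<open>m\<close> in \<open>M\<close>; if \<open>x \<squnion> y \<in> M\<close>, then \<open>m \<sqinter> (x \<squnion> y) \<in> M\<close> lies below \<open>y\<close>.\<close>

lemma prime_filter_extension:
  assumes F: "F \<in> ba_filters L" "\<bottom> \<notin> F"
  obtains P where "P \<in> Pts" "F \<subseteq> P"
proof -
  define \<A> where "\<A> = {G \<in> ba_filters L. F \<subseteq> G \<and> \<bottom> \<notin> G}"
  have "\<exists>M\<in>\<A>. \<forall>G\<in>\<A>. M \<subseteq> G \<longrightarrow> G = M"
  proof (rule subset_Zorn_nonempty)
    show "\<A> \<noteq> {}" using F unfolding \<A>_def by blast
    fix \<C> assume ne: "\<C> \<noteq> {}" and ch: "subset.chain \<A> \<C>"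
    then have sub: "\<C> \<subseteq> \<A>" and tot: "\<And>G H. \<lbrakk>G \<in> \<C>; H \<in> \<C>\<rbrakk> \<Longrightarrow> G \<subseteq> H \<or> H \<subseteq> G"
      unfolding subset.chain_def by auto
    then have f: "\<And>G. G \<in> \<C> \<Longrightarrow> G \<in> ba_filters L" unfolding \<A>_def by auto
    have "\<Union>\<C> \<in> ba_filters L"
    proof (rule ba_filterI)
      show "\<Union>\<C> \<subseteq> carrier L" using f ba_filterD(1) by blast
      show "\<top> \<in> \<Union>\<C>" using ne f ba_filterD(2) by blast
      show "x \<sqinter> y \<in> \<Union>\<C>" if xy: "x \<in> \<Union>\<C>" "y \<in> \<Union>\<C>" for x y
      proof -
        obtain G H where G: "G \<in> \<C>" "x \<in> G" and H: "H \<in> \<C>" "y \<in> H" using xy by blast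
        from tot[OF G(1) H(1)] show ?thesis
        proof
          assume "G \<subseteq> H"
          then show ?thesis using ba_filterD(3)[OF f[OF H(1)], of x y] G H by blast
        next
          assume "H \<subseteq> G"
          then show ?thesis using ba_filterD(3)[OF f[OF G(1)], of x y] G H by blast
        qed
      qed
      show "y \<in> \<Union>\<C>" if "x \<in> \<Union>\<C>" "y \<in> carrier L" "x \<sqsubseteq> y" for x y
      proof -
        obtain G where G: "G \<in> \<C>" "x \<in> G" using \<open>x \<in> \<Union>\<C>\<close> by blast
        then have "y \<in> G" using ba_filterD(4)[OF f] that(2,3) by blast
        then show ?thesis using G by blast
      qed
    qed
    then show "\<Union>\<C> \<in> \<A>" using ne sub unfolding \<A>_def by blast
  qed
  then obtain M where "M \<in> \<A>" and "\<forall>G\<in>\<A>. M \<subseteq> G \<longrightarrow> G = M" by blast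
  then have M: "M \<in> ba_filters L" "F \<subseteq> M" "\<bottom> \<notin> M"
    and max: "\<And>G. \<lbrakk>G \<in> ba_filters L; \<bottom> \<notin> G; M \<subseteq> G\<rbrakk> \<Longrightarrow> G = M" unfolding \<A>_def by auto
  have Mc: "\<And>m. m \<in> M \<Longrightarrow> m \<in> carrier L" using ba_filterD(1)[OF M(1)] by blast
  have "y \<in> M" if xy: "x \<in> carrier L" "y \<in> carrier L" "x \<squnion> y \<in> M" and x: "x \<notin> M" for x y
  proof -
    define G where "G = {z \<in> carrier L. \<exists>m\<in>M. m \<sqinter> x \<sqsubseteq> z}"
    have G: "G \<in> ba_filters L"
    proof (rule ba_filterI)
      show "\<top> \<in> G"
        unfolding G_def using ba_filterD(2)[OF M(1)] xy by (intro CollectI conjI bexI[of _ "\<top>"]) auto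
      show "z \<sqinter> w \<in> G" if zw: "z \<in> G" "w \<in> G" for z w
      proof -
        obtain m n where m: "m \<in> M" "m \<sqinter> x \<sqsubseteq> z" and n: "n \<in> M" "n \<sqinter> x \<sqsubseteq> w"
          and c: "z \<in> carrier L" "w \<in> carrier L" using zw unfolding G_def by blast
        have mn: "m \<sqinter> n \<in> M" using ba_filterD(3)[OF M(1)] m n by blast
        have "(m \<sqinter> n) \<sqinter> x \<sqsubseteq> m \<sqinter> x" "(m \<sqinter> n) \<sqinter> x \<sqsubseteq> n \<sqinter> x"
          using Mc[OF m(1)] Mc[OF n(1)] xy(1)
          by (simp_all add: meet_le meet_leI1[OF meet_left] meet_leI1[OF meet_right] meet_right)
        then have "(m \<sqinter> n) \<sqinter> x \<sqsubseteq> z" "(m \<sqinter> n) \<sqinter> x \<sqsubseteq> w"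
          using le_trans[OF _ m(2)] le_trans[OF _ n(2)] Mc[OF m(1)] Mc[OF n(1)] xy(1) c by simp_all
        then have "(m \<sqinter> n) \<sqinter> x \<sqsubseteq> z \<sqinter> w" using Mc[OF mn] xy(1) c by (intro meet_le) auto
        then show ?thesis unfolding G_def using mn c by auto
      qed
      show "w \<in> G" if "z \<in> G" "w \<in> carrier L" "z \<sqsubseteq> w" for z w
      proof -
        obtain m where m: "m \<in> M" "m \<sqinter> x \<sqsubseteq> z" "z \<in> carrier L" using \<open>z \<in> G\<close> unfolding G_def by blast
        then have "m \<sqinter> x \<sqsubseteq> w" using le_trans[OF m(2) \<open>z \<sqsubseteq> w\<close>] Mc xy(1) that(2) by simp
        then show ?thesis unfolding G_def using m that(2) by blast
      qed
    qed (simp add: G_def)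
    have "M \<subseteq> G" unfolding G_def using Mc xy(1) meet_left by blast
    moreover have "\<top> \<sqinter> x \<sqsubseteq> x" using xy(1) by (intro meet_right) auto
    then have "x \<in> G" unfolding G_def using ba_filterD(2)[OF M(1)] xy(1) by blast
    ultimately have "\<bottom> \<in> G" using max[OF G] x by blast
    then obtain m where m: "m \<in> M" "m \<sqinter> x \<sqsubseteq> \<bottom>" unfolding G_def by blast
    have mc: "m \<in> carrier L" using m Mc by blast
    have "m \<sqinter> (x \<squnion> y) = (m \<sqinter> x) \<squnion> (m \<sqinter> y)" using meet_join_distrib mc xy by blast
    also have "\<dots> \<sqsubseteq> y"
    proof (rule join_le)
      show "m \<sqinter> x \<sqsubseteq> y" using le_trans[OF m(2) bottom_lower[OF xy(2)]] mc xy by simp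
    qed (use mc xy in \<open>auto intro: meet_right\<close>)
    finally have "m \<sqinter> (x \<squnion> y) \<sqsubseteq> y" .
    moreover have "m \<sqinter> (x \<squnion> y) \<in> M" using ba_filterD(3)[OF M(1) m(1) xy(3)] .
    ultimately show ?thesis using ba_filterD(4)[OF M(1)] xy(2) by blast
  qed
  then have "M \<in> Pts" unfolding prime_filters_def using M by blast
  then show thesis using that M(2) by blast
qed

lemma complementE:
  assumes "b \<in> carrier L"
  obtains c where "c \<in> carrier L" "b \<sqinter> c = \<bottom>" "b \<squnion> c = \<top>"
  using assms bool_algebra unfolding bool_algebra_def by blast

lemma complement_in_prime_filter:
  assumes P: "P \<in> Pts" and bc: "b \<in> carrier L" "c \<in> carrier L" "b \<sqinter> c = \<bottom>" "b \<squnion> c = \<top>"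
  shows "c \<in> P \<longleftrightarrow> b \<notin> P"
  using prime_filterD[OF P] ba_filterD(2,3)[OF prime_filterD(1)[OF P]] bc by metis

lemma phi_complement:
  assumes "b \<in> carrier L" "c \<in> carrier L" "b \<sqinter> c = \<bottom>" "b \<squnion> c = \<top>"
  shows "\<phi> c = Pts - \<phi> b"
  using complement_in_prime_filter[OF _ assms] unfolding prime_filters_with_def by blast

lemma phi_meet: "\<lbrakk>b \<in> carrier L; c \<in> carrier L\<rbrakk> \<Longrightarrow> \<phi> (b \<sqinter> c) = \<phi> b \<inter> \<phi> c"
proof (intro equalityI subsetI)
  assume c: "b \<in> carrier L" "c \<in> carrier L"
  fix P assume P: "P \<in> \<phi> (b \<sqinter> c)"
  then have "P \<in> ba_filters L" "b \<sqinter> c \<in> P" "P \<in> Pts"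
    unfolding prime_filters_with_def using prime_filterD(1) by auto
  then show "P \<in> \<phi> b \<inter> \<phi> c"
    unfolding prime_filters_with_def using ba_filterD(4)[of P L "b \<sqinter> c"] c meet_left meet_right by auto
qed (auto simp: prime_filters_with_def dest: prime_filterD(1) ba_filterD(3))

lemma phi_join: "\<lbrakk>b \<in> carrier L; c \<in> carrier L\<rbrakk> \<Longrightarrow> \<phi> (b \<squnion> c) = \<phi> b \<union> \<phi> c"
proof (intro equalityI subsetI)
  assume c: "b \<in> carrier L" "c \<in> carrier L"
  show "P \<in> \<phi> b \<union> \<phi> c" if "P \<in> \<phi> (b \<squnion> c)" for P
    using that prime_filterD(3)[of P b c] c unfolding prime_filters_with_def by blast
  fix P assume P: "P \<in> \<phi> b \<union> \<phi> c"
  then have "P \<in> Pts" "b \<in> P \<or> c \<in> P" unfolding prime_filters_with_def by auto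
  then show "P \<in> \<phi> (b \<squnion> c)"
    unfolding prime_filters_with_def
    using ba_filterD(4)[OF prime_filterD(1), of P _ "b \<squnion> c"] c join_left join_right by auto
qed

lemma phi_bottom: "\<phi> \<bottom> = {}" and phi_top: "\<phi> \<top> = Pts"
  unfolding prime_filters_with_def using prime_filterD(1,2) ba_filterD(2) by blast+

text \<open>If \<open>b\<close> is not below \<open>c\<close>, its meet with a complement of \<open>c\<close> is not \<open>\<bottom>\<close>, and a prime filter
  containing this meet contains \<open>b\<close> but not \<open>c\<close>.\<close>

lemma phi_subset_iff:
  assumes b: "b \<in> carrier L" and c: "c \<in> carrier L"
  shows "\<phi> b \<subseteq> \<phi> c \<longleftrightarrow> b \<sqsubseteq> c"
proof
  assume "b \<sqsubseteq> c"
  then show "\<phi> b \<subseteq> \<phi> c"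
    unfolding prime_filters_with_def using ba_filterD(4)[OF prime_filterD(1)] c by blast
next
  assume sub: "\<phi> b \<subseteq> \<phi> c"
  obtain c' where c': "c' \<in> carrier L" "c \<sqinter> c' = \<bottom>" "c \<squnion> c' = \<top>" using complementE[OF c] by blast
  have "b \<sqinter> c' \<sqsubseteq> \<bottom>"
  proof (rule ccontr)
    let ?F = "principal_filter L (b \<sqinter> c')"
    assume "\<not> b \<sqinter> c' \<sqsubseteq> \<bottom>"
    then have "\<bottom> \<notin> ?F" unfolding principal_filter_def by blast
    moreover have F: "?F \<in> ba_filters L" using b c' by (intro principal_filter_filter) auto
    ultimately obtain P where P: "P \<in> Pts" "?F \<subseteq> P" using prime_filter_extension by blast
    then have "b \<sqinter> c' \<in> P"
      using principal_filter_subset[OF _ prime_filterD(1)[OF P(1)]] b c' by simp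
    then have "P \<in> \<phi> (b \<sqinter> c')" using P unfolding prime_filters_with_def by blast
    then have "P \<in> \<phi> c" "P \<in> \<phi> c'" using phi_meet b c' sub by auto
    then show False using phi_complement[OF c c'] by blast
  qed
  have "b = b \<sqinter> (c \<squnion> c')" using meet_top_right b c' by simp
  also have "\<dots> = (b \<sqinter> c) \<squnion> (b \<sqinter> c')" using meet_join_distrib b c c' by blast
  also have "\<dots> \<sqsubseteq> c"
  proof (rule join_le)
    show "b \<sqinter> c' \<sqsubseteq> c" using le_trans[OF \<open>b \<sqinter> c' \<sqsubseteq> \<bottom>\<close> bottom_lower[OF c]] b c c' by simp
  qed (use b c c' in \<open>auto intro: meet_right\<close>)
  finally show "b \<sqsubseteq> c" .
qed

lemma openin_Spec: "openin Spec U \<longleftrightarrow> U \<subseteq> Pts \<and> (\<forall>P\<in>U. \<exists>b\<in>P. \<phi> b \<subseteq> U)"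
proof -
  have "istopology (\<lambda>U. U \<subseteq> Pts \<and> (\<forall>P\<in>U. \<exists>b\<in>P. \<phi> b \<subseteq> U))"
    unfolding istopology_def
  proof (intro conjI allI impI)
    fix U V assume U: "U \<subseteq> Pts \<and> (\<forall>P\<in>U. \<exists>b\<in>P. \<phi> b \<subseteq> U)" and V: "V \<subseteq> Pts \<and> (\<forall>P\<in>V. \<exists>b\<in>P. \<phi> b \<subseteq> V)"
    show "\<forall>P\<in>U \<inter> V. \<exists>b\<in>P. \<phi> b \<subseteq> U \<inter> V"
    proof
      fix P assume P: "P \<in> U \<inter> V"
      then have Pf: "P \<in> Pts" using U by blast
      have "\<exists>b\<in>P. \<phi> b \<subseteq> U" "\<exists>c\<in>P. \<phi> c \<subseteq> V" using P U V by simp_all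
      then obtain b c where b: "b \<in> P" "\<phi> b \<subseteq> U" and c: "c \<in> P" "\<phi> c \<subseteq> V" by blast
      have "b \<sqinter> c \<in> P" using b c ba_filterD(3)[OF prime_filterD(1)[OF Pf]] by blast
      moreover have "\<phi> (b \<sqinter> c) = \<phi> b \<inter> \<phi> c"
        using phi_meet b c prime_filter_carrier[OF Pf] by blast
      ultimately show "\<exists>b\<in>P. \<phi> b \<subseteq> U \<inter> V" using b c by blast
    qed
    show "U \<inter> V \<subseteq> Pts" using U by blast
  next
    fix \<K> assume \<K>: "\<forall>U\<in>\<K>. U \<subseteq> Pts \<and> (\<forall>P\<in>U. \<exists>b\<in>P. \<phi> b \<subseteq> U)"
    then show "\<Union>\<K> \<subseteq> Pts" by (simp add: Union_least)
    show "\<forall>P\<in>\<Union>\<K>. \<exists>b\<in>P. \<phi> b \<subseteq> \<Union>\<K>"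
      using \<K> by (meson UnionE Union_upper subset_trans)
  qed
  then show ?thesis unfolding prime_filter_space_def by simp
qed

lemma topspace_Spec: "topspace Spec = Pts"
proof -
  have "openin Spec Pts"
    unfolding openin_Spec using ba_filterD(2)[OF prime_filterD(1)] phi_top by blast
  then show ?thesis
    using openin_subset openin_Spec openin_topspace by (metis subset_antisym)
qed

lemma openin_phi: "b \<in> carrier L \<Longrightarrow> openin Spec (\<phi> b)"
  unfolding openin_Spec prime_filters_with_def by blast

lemma phi_Clop:
  assumes b: "b \<in> carrier L"
  shows "\<phi> b \<in> Clop Spec"
proof -
  obtain c where "c \<in> carrier L" "b \<sqinter> c = \<bottom>" "b \<squnion> c = \<top>" using complementE[OF b] by blast
  then have "openin Spec (Pts - \<phi> b)" using phi_complement[OF b] openin_phi by metis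
  moreover have "\<phi> b \<subseteq> Pts" unfolding prime_filters_with_def by blast
  ultimately show ?thesis
    using openin_phi[OF b] unfolding Clop_def closedin_def topspace_Spec by simp
qed

text \<open>The elements \<open>b\<close> for which finitely many members of an open cover cover everything outside of
  \<open>\<phi> b\<close> form a filter. If it were proper, a prime filter extending it would be a point that the cover
  misses. So \<open>\<bottom>\<close> belongs to it, and \<open>\<phi> \<bottom> = {}\<close>.\<close>

lemma compact_space_Spec: "compact_space Spec"
  unfolding compact_space_alt topspace_Spec
proof (intro allI impI)
  fix \<C> assume \<C>: "(\<forall>U\<in>\<C>. openin Spec U) \<and> Pts \<subseteq> \<Union>\<C>"
  define F where "F = {b \<in> carrier L. \<exists>\<F>. finite \<F> \<and> \<F> \<subseteq> \<C> \<and> Pts \<subseteq> \<phi> b \<union> \<Union>\<F>}"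
  have F: "F \<in> ba_filters L"
  proof (rule ba_filterI)
    show "\<top> \<in> F" unfolding F_def phi_top mem_Collect_eq by (intro conjI exI[of _ "{}"]) auto
    show "b \<sqinter> c \<in> F" if bc: "b \<in> F" "c \<in> F" for b c
    proof -
      obtain \<F> where \<F>: "finite \<F>" "\<F> \<subseteq> \<C>" "Pts \<subseteq> \<phi> b \<union> \<Union>\<F>" and b: "b \<in> carrier L"
        using bc(1) unfolding F_def by auto
      obtain \<G> where \<G>: "finite \<G>" "\<G> \<subseteq> \<C>" "Pts \<subseteq> \<phi> c \<union> \<Union>\<G>" and c: "c \<in> carrier L"
        using bc(2) unfolding F_def by auto
      have "Pts \<subseteq> \<phi> (b \<sqinter> c) \<union> \<Union>(\<F> \<union> \<G>)"
        unfolding phi_meet[OF b c] using \<F>(3) \<G>(3) by blast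
      then show ?thesis
        unfolding F_def using b c \<F> \<G> by (intro CollectI conjI exI[of _ "\<F> \<union> \<G>"]) auto
    qed
    show "c \<in> F" if "b \<in> F" "c \<in> carrier L" "b \<sqsubseteq> c" for b c
      using that phi_subset_iff[of b c] unfolding F_def by blast
  qed (simp add: F_def)
  have "\<bottom> \<in> F"
  proof (rule ccontr)
    assume "\<bottom> \<notin> F"
    then obtain P where P: "P \<in> Pts" "F \<subseteq> P" using prime_filter_extension[OF F] by blast
    then obtain U where U: "U \<in> \<C>" "P \<in> U" "openin Spec U" using \<C> by blast
    then obtain b where b: "b \<in> P" "\<phi> b \<subseteq> U" unfolding openin_Spec by blast
    have bc: "b \<in> carrier L" using prime_filter_carrier P b by blast
    obtain c where c: "c \<in> carrier L" "b \<sqinter> c = \<bottom>" "b \<squnion> c = \<top>" using complementE[OF bc] by blast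
    have "Pts \<subseteq> \<phi> c \<union> \<Union>{U}" using phi_complement[OF bc c] b(2) by blast
    then have "c \<in> F" unfolding F_def mem_Collect_eq using c U by (intro conjI exI[of _ "{U}"]) auto
    then show False using complement_in_prime_filter[OF P(1) bc c] P(2) b(1) by blast
  qed
  then obtain \<F> where "finite \<F>" "\<F> \<subseteq> \<C>" "Pts \<subseteq> \<phi> \<bottom> \<union> \<Union>\<F>" unfolding F_def by auto
  then show "\<exists>\<F>. finite \<F> \<and> \<F> \<subseteq> \<C> \<and> Pts \<subseteq> \<Union>\<F>" unfolding phi_bottom by auto
qed

lemma stone_space_Spec: "stone_space Spec"
  unfolding stone_space_def
proof (intro conjI compact_space_Spec)
  show "zero_dim_space Spec"
    unfolding zero_dim_space_def
  proof (intro allI impI)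
    fix U P assume U: "openin Spec U \<and> P \<in> U"
    then obtain b where b: "b \<in> P" "\<phi> b \<subseteq> U" and P: "P \<in> Pts" unfolding openin_Spec by blast
    then have "\<phi> b \<in> Clop Spec" "P \<in> \<phi> b"
      using phi_Clop prime_filter_carrier unfolding prime_filters_with_def by auto
    then show "\<exists>V\<in>Clop Spec. P \<in> V \<and> V \<subseteq> U" using b by blast
  qed
  have sep: "\<exists>U V. openin Spec U \<and> openin Spec V \<and> P \<in> U \<and> Q \<in> V \<and> disjnt U V"
    if P: "P \<in> Pts" and Q: "Q \<in> Pts" and b: "b \<in> P" "b \<notin> Q" for P Q b
  proof -
    have bc: "b \<in> carrier L" using prime_filter_carrier P b by blast
    obtain c where c: "c \<in> carrier L" "b \<sqinter> c = \<bottom>" "b \<squnion> c = \<top>" using complementE[OF bc] by blast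
    have "P \<in> \<phi> b" "Q \<in> \<phi> c" "disjnt (\<phi> b) (\<phi> c)"
      using P Q b phi_complement[OF bc c] unfolding prime_filters_with_def disjnt_def by auto
    then show ?thesis using openin_phi bc c by blast
  qed
  show "Hausdorff_space Spec"
    unfolding Hausdorff_space_def topspace_Spec
  proof (intro allI impI, elim conjE)
    fix P Q assume PQ: "P \<in> Pts" "Q \<in> Pts" "P \<noteq> Q"
    then obtain b where "b \<in> P \<and> b \<notin> Q \<or> b \<in> Q \<and> b \<notin> P" by blast
    then show "\<exists>U V. openin Spec U \<and> openin Spec V \<and> P \<in> U \<and> Q \<in> V \<and> disjnt U V"
      using sep[OF PQ(1,2)] sep[OF PQ(2,1)] disjnt_sym by meson
  qed
qed

text \<open>A clopen set is open and compact, hence the union of finitely many \<open>\<phi> b\<close>; as \<open>\<phi>\<close> preserves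
  finite joins, it is itself of this form.\<close>

lemma Clop_Spec: "Clop Spec = \<phi> ` carrier L"
proof (intro equalityI subsetI)
  fix U assume U: "U \<in> Clop Spec"
  then have Uo: "openin Spec U" and Uc: "compactin Spec U"
    using closedin_compact_space[OF compact_space_Spec] unfolding Clop_def by auto
  let ?\<C> = "\<phi> ` {b \<in> carrier L. \<phi> b \<subseteq> U}"
  have "U \<subseteq> \<Union>?\<C>"
  proof
    fix P assume P: "P \<in> U"
    then obtain b where "b \<in> P" "\<phi> b \<subseteq> U" "P \<in> Pts" using Uo unfolding openin_Spec by blast
    then show "P \<in> \<Union>?\<C>" using prime_filter_carrier unfolding prime_filters_with_def by blast
  qed
  moreover have "\<forall>V\<in>?\<C>. openin Spec V" using openin_phi by blast
  ultimately obtain \<F> where \<F>: "finite \<F>" "\<F> \<subseteq> ?\<C>" "U \<subseteq> \<Union>\<F>"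
    using Uc unfolding compactin_def by meson
  obtain A where "A \<subseteq> {b \<in> carrier L. \<phi> b \<subseteq> U}" and A: "finite A" "\<F> = \<phi> ` A"
    using finite_subset_image[OF \<F>(1,2)] by auto
  then have AU: "A \<subseteq> carrier L" "\<And>a. a \<in> A \<Longrightarrow> \<phi> a \<subseteq> U" by auto
  have "\<exists>b\<in>carrier L. \<phi> b = \<Union>(\<phi> ` A)"
    using A(1) AU(1)
  proof (induction A rule: finite_induct)
    case empty
    then show ?case using phi_bottom by auto
  next
    case (insert a A)
    then obtain b where "b \<in> carrier L" "\<phi> b = \<Union>(\<phi> ` A)" by blast
    then show ?case using insert phi_join[of a b] by (intro bexI[of _ "a \<squnion> b"]) auto
  qed
  then obtain b where b: "b \<in> carrier L" "\<phi> b = \<Union>(\<phi> ` A)" by blast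
  have "\<Union>(\<phi> ` A) \<subseteq> U" using AU(2) by (rule UN_least)
  then have "U = \<phi> b" using \<F>(3) b(2) A(2) by simp
  then show "U \<in> \<phi> ` carrier L" using b(1) by blast
qed (use phi_Clop in blast)

end

lemma order_iso_prime_filters_with:
  fixes B :: "'b gorder"
  assumes "bool_algebra B"
  shows "order_iso B (clopen_algebra (prime_filter_space B)) (prime_filters_with B)"
proof -
  interpret boolean_lattice B by unfold_locales (rule assms)
  have "inj_on \<phi> (carrier B)"
    by (intro inj_onI le_antisym) (simp_all flip: phi_subset_iff)
  then show ?thesis
    unfolding order_iso_def clopen_algebra_simps Clop_Spec
    using phi_subset_iff by (simp add: bij_betw_def)
qed

lemma stone_space_of_size:
  fixes B :: "'a gorder" and \<U> :: "'a set set"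
  assumes B: "bool_algebra B" "of_size \<U> (carrier B)"
  shows "stone_space (prime_filter_space B)" "of_size \<U> (Clop (prime_filter_space B))"
proof -
  interpret boolean_lattice B by unfold_locales (rule B(1))
  show "stone_space (prime_filter_space B)" by (rule stone_space_Spec)
  have "carrier B \<approx> Clop (prime_filter_space B)"
    using order_iso_prime_filters_with[OF B(1)] unfolding order_iso_def eqpoll_def clopen_algebra_simps by blast
  then show "of_size \<U> (Clop (prime_filter_space B))"
    using B(2) eqpoll_sym eqpoll_trans unfolding of_size_def by blast
qed

lemma weak_equivalence_Stone_R:
  fixes \<U> :: "'a set set"
  obtains F where "weak_equivalence (op_cat (Stone_R \<U>)) (BA False \<U> :: ('a gorder, 'a \<Rightarrow> 'a) cat) F"
proof (rule weak_equivalence_to_BA[OF fully_faithful_clopen_functor])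
  fix B :: "'a gorder" assume B: "bool_algebra B" "of_size \<U> (carrier B)"
  then show "\<exists>X\<in>Obj (op_cat (Stone_R \<U>)). \<exists>e. order_iso B (on_obj clopen_functor X) e"
    using stone_space_of_size[OF B] order_iso_prime_filters_with[OF B(1)]
    by (intro bexI[of _ "prime_filter_space B"] exI[of _ "prime_filters_with B"])
      (simp_all add: op_cat_def Stone_R_def clopen_functor_def)
qed

lemma weak_equivalence_Stone_PS:
  fixes \<U> :: "'a set set"
  obtains F where "weak_equivalence (op_cat (Stone_PS \<U>)) (BA True \<U> :: ('a gorder, 'a \<Rightarrow> 'a) cat) F"
proof (rule weak_equivalence_to_BA[OF fully_faithful_partial_clopen_functor])
  fix B :: "'a gorder" assume B: "bool_algebra B" "of_size \<U> (carrier B)"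
  then show "\<exists>X\<in>Obj (op_cat (Stone_PS \<U>)). \<exists>e. order_iso B (on_obj partial_clopen_functor X) e"
    using stone_space_of_size[OF B] order_iso_prime_filters_with[OF B(1)]
    by (intro bexI[of _ "prime_filter_space B"] exI[of _ "prime_filters_with B"])
      (simp_all add: op_cat_def Stone_PS_def partial_clopen_functor_def)
qed

section \<open>The equivalences\<close>

lemma dually_equivalent_if_op_weak_equivalence:
  assumes "weak_equivalence \<C> \<E> F" "weak_equivalence (op_cat \<D>) \<E> H"
  shows "dually_equivalent_cats \<C> \<D>"
  unfolding dually_equivalent_cats_def
  using equivalent_cats_if_weakly_equivalent_to_common[OF weak_equivalence_op[OF assms(1)]
      weak_equivalence_op[OF assms(2), unfolded op_op_cat]] .

theorem theorem7p16:
  fixes \<U> :: "'a set set"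
  shows "(equivalent_cats (StoneFrm_Sup \<U>) (BA_M \<U>) \<and>
          dually_equivalent_cats (StoneFrm_Sup \<U>) (Stone_R \<U>)) \<and>
         (equivalent_cats (StoneFrm_FInf \<U>) (BA_L \<U>) \<and>
          dually_equivalent_cats (StoneFrm_FInf \<U>) (Stone_PS \<U>))"
proof -
  have eq: "equivalent_cats (StoneFrm lat \<U>) (BA lat \<U> :: ('a gorder, 'a \<Rightarrow> 'a) cat)" for lat
    using weak_equivalence_StoneFrm[of lat \<U>] weak_equivalence_id[OF is_category_BA]
      equivalent_cats_if_weakly_equivalent_to_common by metis
  have "dually_equivalent_cats (StoneFrm False \<U>) (Stone_R \<U>)"
    using weak_equivalence_StoneFrm[of False \<U>] weak_equivalence_Stone_R[of \<U>]
      dually_equivalent_if_op_weak_equivalence by metis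
  moreover have "dually_equivalent_cats (StoneFrm True \<U>) (Stone_PS \<U>)"
    using weak_equivalence_StoneFrm[of True \<U>] weak_equivalence_Stone_PS[of \<U>]
      dually_equivalent_if_op_weak_equivalence by metis
  ultimately show ?thesis
    using eq unfolding StoneFrm_Sup_eq StoneFrm_FInf_eq BA_M_eq BA_L_eq by blast
qed

end
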